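(* Let $\Omega\subset\mathbb R^d$ be nonempty, open, connected with Lebesgue-negligible boundary, $\lambda>0$, and let $P$ be a Borel probability measure on $\mathcal P_2(\mathbb R^d)$ with $\int m_2(\nu)\,dP(\nu)<+\infty$. Let $p\ge1$ and assume $$\int_{\mathcal P_2(\mathbb R^d)}m_p(\nu)\,dP(\nu)<+\infty.$$ Then $\bar\rho=\mathrm{bar}_{\lambda,\Omega}(P)$ satisfies $m_p(\bar\rho)<+\infty$, and more precisely, for any $r>0$, $$m_p(\bar\rho)\le\frac{6^p}{2}\Big(r^p+\int_{\mathcal P_2(\mathbb R^d)}m_p(\nu)\,dP(\nu)\Big)+\frac{|B_1(0)|\,\Gamma\!\left(\frac{d+p}2\right)}{2\,|\Omega\cap B_r(0)|}(96\lambda)^{(d+p)/2}.$$ In particular, if $\Omega=\mathbb R^d$, then $$m_p(\bar\rho)\le\frac{6^p}{2}\int_{\mathcal P_2(\mathbb R^d)}m_p(\nu)\,dP(\nu)+(3456\lambda)^{p/2}\,\Gamma\!\left(\tfrac{d+p}2\right).$$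
   Context: $m_p(\nu)=\int_{\mathbb R^d}\|x\|^p\,d\nu(x)$; $\mathcal P_2(\mathbb R^d)$ is the set of Borel probability measures on $\mathbb R^d$ with $m_2<\infty$, endowed with the $2$-Wasserstein distance $W_2$ ($W_2^2(\mu,\nu)=\inf_{\gamma\in\Pi(\mu,\nu)}\int\|x-y\|^2d\gamma$). $|\cdot|$ is Lebesgue measure, $\Gamma$ the Gamma function; the right-hand side of the first bound is understood as $+\infty$ when $|\Omega\cap B_r(0)|=0$. $\mathrm{bar}_{\lambda,\Omega}(P)$ (entropic-Wasserstein barycenter) is the unique minimizer over $\rho\in\mathcal P_2(\mathbb R^d)$ of $\frac12\int W_2^2(\rho,\nu)\,dP(\nu)+\lambda\,\mathrm{Ent}_\Omega(\rho)$, where $\mathrm{Ent}_\Omega(\rho)=\int_\Omega\rho\log\rho$ if $\rho$ is absolutely continuous with $\int_\Omega\rho=1$, and $+\infty$ otherwise. *)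

theory Defs
  imports "HOL-Probability.Probability"
begin

definition moment :: "real \<Rightarrow> 'a::euclidean_space measure \<Rightarrow> ennreal" where
  "moment p \<nu> = (\<integral>\<^sup>+ x. ennreal (norm x powr p) \<partial>\<nu>)"

definition P2 :: "'a::euclidean_space measure set" where
  "P2 = {\<mu>. prob_space \<mu> \<and> sets \<mu> = sets borel \<and> moment 2 \<mu> < \<infinity>}"

definition couplings ::
    "'a::euclidean_space measure \<Rightarrow> 'a measure \<Rightarrow> ('a \<times> 'a) measure set" where
  "couplings \<mu> \<nu> = {\<gamma>. prob_space \<gamma> \<and> sets \<gamma> = sets (borel \<Otimes>\<^sub>M borel) \<and>
     distr \<gamma> borel fst = \<mu> \<and> distr \<gamma> borel snd = \<nu>}"

definition W2_sq :: "'a::euclidean_space measure \<Rightarrow> 'a measure \<Rightarrow> ennreal" where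
  "W2_sq \<mu> \<nu> = (INF \<gamma>\<in>couplings \<mu> \<nu>. \<integral>\<^sup>+ (x, y). ennreal ((norm (x - y))\<^sup>2) \<partial>\<gamma>)"

text \<open>On \<open>P2\<close> the squared distance is finite, so nothing is lost by passing to the reals.\<close>

definition W2 :: "'a::euclidean_space measure \<Rightarrow> 'a measure \<Rightarrow> real" where
  "W2 \<mu> \<nu> = sqrt (enn2real (W2_sq \<mu> \<nu>))"

definition W2_open :: "'a::euclidean_space measure set \<Rightarrow> bool" where
  "W2_open U \<longleftrightarrow> U \<subseteq> P2 \<and> (\<forall>\<mu>\<in>U. \<exists>e>0. \<forall>\<nu>\<in>P2. W2 \<mu> \<nu> < e \<longrightarrow> \<nu> \<in> U)"

text \<open>Only the measurable space matters here: \<open>sigma\<close> carries the zero measure.\<close>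

definition P2_borel :: "'a::euclidean_space measure measure" where
  "P2_borel = sigma P2 {U. W2_open U}"

text \<open>
  The integral of \<open>f ln f\<close> over \<open>\<Omega>\<close> is taken as the difference of the integrals of its
  positive and negative parts (recall that \<open>ennreal\<close> truncates negative reals to 0, and that
  \<open>0 * ln 0 = 0\<close>). The value may be \<open>\<infinity>\<close>; the negative part has finite integral
  whenever \<open>\<rho> \<in> P2\<close>, so no \<open>\<infinity> - \<infinity>\<close> arises there.
\<close>

definition Ent :: "'a::euclidean_space set \<Rightarrow> 'a measure \<Rightarrow> ereal" where
  "Ent \<Omega> \<rho> =
     (if absolutely_continuous lborel \<rho> \<and> emeasure \<rho> \<Omega> = 1
      then let f = (\<lambda>x. enn2real (RN_deriv lborel \<rho> x)) in
           enn2ereal (\<integral>\<^sup>+ x\<in>\<Omega>. ennreal (f x * ln (f x)) \<partial>lborel) -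
           enn2ereal (\<integral>\<^sup>+ x\<in>\<Omega>. ennreal (- (f x * ln (f x))) \<partial>lborel)
      else \<infinity>)"

definition bar_functional ::
    "real \<Rightarrow> 'a::euclidean_space set \<Rightarrow> 'a measure measure \<Rightarrow> 'a measure \<Rightarrow> ereal" where
  "bar_functional l \<Omega> P \<rho> =
     ereal (1/2) * enn2ereal (\<integral>\<^sup>+ \<nu>. W2_sq \<rho> \<nu> \<partial>P) + ereal l * Ent \<Omega> \<rho>"

text \<open>
  Existence and uniqueness of the minimizer are the well-posedness of the barycenter; the
  predicate asks for minimality only, and the barycenter is the one measure satisfying it.
\<close>

definition is_entropic_barycenter ::
    "real \<Rightarrow> 'a::euclidean_space set \<Rightarrow> 'a measure measure \<Rightarrow> 'a measure \<Rightarrow> bool" where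
  "is_entropic_barycenter l \<Omega> P \<rho> \<longleftrightarrow>
     \<rho> \<in> P2 \<and> (\<forall>\<rho>'\<in>P2. bar_functional l \<Omega> P \<rho> \<le> bar_functional l \<Omega> P \<rho>')"

end

theory Submission imports Defs begin

text \<open>
  Let \<open>s x\<close> be the conditional mean of
  \<open>norm y\<close> given \<open>x\<close> under the \<open>P\<close>-average of optimal couplings of \<open>\<rho>\<close> and \<open>\<nu>\<close>. Taking the mass of a
  set \<open>B\<close> away and spreading it uniformly over \<open>K = \<Omega> \<inter> ball 0 r\<close> changes the transport cost at \<open>x\<close> by
  at most \<open>r\<^sup>2 - (norm x)\<^sup>2 + 2 * (norm x + r) * s x\<close>, which is at most \<open>- (norm x)\<^sup>2 / 3\<close> where
  \<open>norm x > 3 * (r + s x)\<close>. Minimality then forces the density of \<open>\<rho>\<close> to be at most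
  \<open>8 / measure lborel K * exp (- (norm x)\<^sup>2 / (6 * l))\<close> there, and a Gaussian integral bounds that part
  of the moment. Elsewhere \<open>norm x powr p \<le> 6 powr p / 2 * (r powr p + s x powr p)\<close>, and
  \<open>s\<close> is controlled by Jensen's inequality.

  Averaging the couplings would need a measurable selection and the existence of optimal plans. Both
  are avoided by a Hahn--Banach extension of \<open>P\<close>-integration to arbitrary dominated functions of \<open>\<nu>\<close> and of
  an index \<open>n\<close>, chosen to agree with the lower integral, which is what \<open>nn_integral\<close> computes, at
  \<open>W2_sq \<rho>\<close>; in particular \<open>W2_sq \<rho>\<close> need not be known to be measurable.
\<close>

section \<open>Sublinear and linear functionals\<close>

text \<open>Two inequalities are wanted of the functional \<open>L\<close>: at the cost of a
  competitor it must be at least the lower integral, at the cost of \<open>\<rho>\<close> at most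
  the lower integral. The first holds for every linear functional below the upper integral; the
  second may fail, and is secured by prescribing the value of \<open>L\<close> at that single
  function. The index \<open>n\<close> stands for couplings that are optimal up to
  \<open>1 / Suc n\<close>.

  The constants: the factor 1/2 in the functional turns the gain \<open>(norm x)\<^sup>2 / 3\<close>
  into \<open>(norm x)\<^sup>2 / 6\<close>, hence \<open>6 * l\<close> in the Gaussian. As
  \<open>3 * (r + s x)\<close> is six times a midpoint, convexity of the power gives
  \<open>6 powr p / 2\<close>. With \<open>z = (d + p) / 2\<close> the Gaussian moment contributes
  \<open>8 * z * (6 * l) powr z * Gamma z\<close>, and \<open>16 * z \<le> 16 powr z\<close> absorbs
  the factors into \<open>(96 * l) powr z / 2\<close>. On the whole space
  \<open>r = sqrt (96 * l)\<close> makes the volumes cancel, and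
  \<open>6 powr p * (96 * l) powr (p / 2)\<close> is \<open>(3456 * l) powr (p / 2)\<close>.\<close>

definition fun_subspace :: "('i \<Rightarrow> real) set \<Rightarrow> bool" where
  "fun_subspace V \<longleftrightarrow> (\<lambda>_. 0) \<in> V \<and> (\<forall>f\<in>V. \<forall>g\<in>V. (\<lambda>i. f i + g i) \<in> V) \<and>
     (\<forall>f\<in>V. \<forall>t. (\<lambda>i. t * f i) \<in> V)"

definition sublinear_on :: "('i \<Rightarrow> real) set \<Rightarrow> (('i \<Rightarrow> real) \<Rightarrow> real) \<Rightarrow> bool" where
  "sublinear_on V p \<longleftrightarrow> (\<forall>f\<in>V. \<forall>g\<in>V. p (\<lambda>i. f i + g i) \<le> p f + p g) \<and>
     (\<forall>f\<in>V. \<forall>t\<ge>0. p (\<lambda>i. t * f i) = t * p f)"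

definition linear_functional_on :: "('i \<Rightarrow> real) set \<Rightarrow> (('i \<Rightarrow> real) \<Rightarrow> real) \<Rightarrow> bool" where
  "linear_functional_on V L \<longleftrightarrow> (\<forall>f\<in>V. \<forall>g\<in>V. L (\<lambda>i. f i + g i) = L f + L g) \<and>
     (\<forall>f\<in>V. \<forall>t. L (\<lambda>i. t * f i) = t * L f)"

lemma fun_subspaceD:
  assumes "fun_subspace V"
  shows "(\<lambda>_. 0) \<in> V" "f \<in> V \<Longrightarrow> g \<in> V \<Longrightarrow> (\<lambda>i. f i + g i) \<in> V"
    "f \<in> V \<Longrightarrow> (\<lambda>i. t * f i) \<in> V" "f \<in> V \<Longrightarrow> (\<lambda>i. - f i) \<in> V"
proof -
  show "(\<lambda>_. 0) \<in> V" "f \<in> V \<Longrightarrow> g \<in> V \<Longrightarrow> (\<lambda>i. f i + g i) \<in> V"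
    and scale: "f \<in> V \<Longrightarrow> (\<lambda>i. t * f i) \<in> V" for t
    using assms unfolding fun_subspace_def by auto
  show "f \<in> V \<Longrightarrow> (\<lambda>i. - f i) \<in> V" using scale[of "-1"] by simp
qed

lemma sublinear_onD:
  assumes "sublinear_on V p"
  shows "f \<in> V \<Longrightarrow> g \<in> V \<Longrightarrow> p (\<lambda>i. f i + g i) \<le> p f + p g"
    "f \<in> V \<Longrightarrow> 0 \<le> t \<Longrightarrow> p (\<lambda>i. t * f i) = t * p f"
  using assms unfolding sublinear_on_def by auto

lemma sublinear_on_zero:
  assumes "fun_subspace V" "sublinear_on V p"
  shows "p (\<lambda>_. 0) = 0"
  using sublinear_onD(2)[OF assms(2) fun_subspaceD(1)[OF assms(1)], of 0] by simp

lemma sublinear_on_minus: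
  assumes "fun_subspace V" "sublinear_on V p" "f \<in> V"
  shows "- p (\<lambda>i. - f i) \<le> p f"
  using sublinear_onD(1)[OF assms(2) assms(3) fun_subspaceD(4)[OF assms(1,3)]]
    sublinear_on_zero[OF assms(1,2)] by simp

lemma linear_functional_onD:
  assumes "linear_functional_on V L"
  shows "f \<in> V \<Longrightarrow> g \<in> V \<Longrightarrow> L (\<lambda>i. f i + g i) = L f + L g"
    "f \<in> V \<Longrightarrow> L (\<lambda>i. t * f i) = t * L f"
  using assms by (auto simp: linear_functional_on_def)

lemma linear_functional_on_zero:
  assumes "fun_subspace V" "linear_functional_on V L"
  shows "L (\<lambda>_. 0) = 0"
  using linear_functional_onD(2)[OF assms(2) fun_subspaceD(1)[OF assms(1)], of 0] by simp

lemma linear_functional_on_diff: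
  assumes V: "fun_subspace V" and L: "linear_functional_on V L" and f: "f \<in> V" and g: "g \<in> V"
  shows "(\<lambda>i. f i - g i) \<in> V" "L (\<lambda>i. f i - g i) = L f - L g"
proof -
  show "(\<lambda>i. f i - g i) \<in> V"
    using fun_subspaceD(2)[OF V f fun_subspaceD(4)[OF V g]] by simp
  show "L (\<lambda>i. f i - g i) = L f - L g"
    using linear_functional_onD(1)[OF L f fun_subspaceD(3)[OF V g, of "-1"]]
      linear_functional_onD(2)[OF L g, of "-1"] by simp
qed

lemma linear_functional_on_sum:
  assumes V: "fun_subspace V" and L: "linear_functional_on V L"
    and "finite J" and f: "\<And>j. j \<in> J \<Longrightarrow> f j \<in> V"
  shows "(\<lambda>i. \<Sum>j\<in>J. f j i) \<in> V \<and> L (\<lambda>i. \<Sum>j\<in>J. f j i) = (\<Sum>j\<in>J. L (f j))"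
  using assms(3) f
proof (induction J rule: finite_induct)
  case empty
  then show ?case using V L by (auto simp: linear_functional_on_zero intro: fun_subspaceD)
next
  case (insert j J)
  then show ?case
    using linear_functional_onD(1)[OF L, of "f j" "\<lambda>i. \<Sum>j\<in>J. f j i"] fun_subspaceD(2)[OF V, of "f j" "\<lambda>i. \<Sum>j\<in>J. f j i"]
    by auto
qed

text \<open>The witness is the largest sublinear functional below \<open>p\<close> with value at
  most \<open>- p y\<close> at \<open>- y\<close>: any such \<open>q\<close> satisfies
  \<open>q f \<le> q (f + t y) + t q (- y) \<le> p (f + t y) - t p y\<close>. It closes the gap
  between \<open>p y\<close> and \<open>- p (- y)\<close> in the single direction
  \<open>y\<close>.\<close>

lemma sublinear_on_descend:
  assumes V: "fun_subspace V" and p: "sublinear_on V p" and y: "y \<in> V"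
  obtains p' where "sublinear_on V p'" "\<And>f. f \<in> V \<Longrightarrow> p' f \<le> p f" "p' (\<lambda>i. - y i) \<le> - p y"
proof -
  define S where "S f = {p (\<lambda>i. f i + t * y i) - t * p y | t. 0 \<le> t}" for f
  define p' where "p' f = Inf (S f)" for f
  \<comment> \<open>A bound independent of \<open>t\<close>, so that the infimum is finite; it comes
    from writing \<open>t y\<close> as the sum of \<open>f + t y\<close> and
    \<open>- f\<close>.\<close>
  have lb: "- p (\<lambda>i. - f i) \<le> z" if f: "f \<in> V" and z: "z \<in> S f" for f z
  proof -
    obtain t where t: "0 \<le> t" "z = p (\<lambda>i. f i + t * y i) - t * p y" using z unfolding S_def by auto
    have "p (\<lambda>i. (f i + t * y i) + (- f i)) \<le> p (\<lambda>i. f i + t * y i) + p (\<lambda>i. - f i)"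
      by (rule sublinear_onD(1)[OF p]) (use f y V in \<open>auto intro: fun_subspaceD\<close>)
    moreover have "p (\<lambda>i. (f i + t * y i) + (- f i)) = t * p y"
      using sublinear_onD(2)[OF p y t(1)] by simp
    ultimately show ?thesis using t by simp
  qed
  have ne: "S f \<noteq> {}" for f unfolding S_def by auto
  have bdd: "bdd_below (S f)" if "f \<in> V" for f using lb[OF that] by (auto simp: bdd_below_def)
  have le: "p' f \<le> p (\<lambda>i. f i + t * y i) - t * p y" if "f \<in> V" "0 \<le> t" for f t
    unfolding p'_def using that by (intro cInf_lower bdd) (auto simp: S_def)
  have ge: "c \<le> p' f" if "\<And>t. 0 \<le> t \<Longrightarrow> c \<le> p (\<lambda>i. f i + t * y i) - t * p y" for c f
    unfolding p'_def using that by (intro cInf_greatest ne) (auto simp: S_def)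
  have sub: "p' (\<lambda>i. f i + g i) \<le> p' f + p' g" if f: "f \<in> V" and g: "g \<in> V" for f g
  proof -
    have *: "p' (\<lambda>i. f i + g i) \<le> (p (\<lambda>i. f i + s * y i) - s * p y) + (p (\<lambda>i. g i + t * y i) - t * p y)"
      if "0 \<le> s" "0 \<le> t" for s t
    proof -
      have "p' (\<lambda>i. f i + g i) \<le> p (\<lambda>i. (f i + g i) + (s + t) * y i) - (s + t) * p y"
        by (rule le) (use f g V that in \<open>auto intro: fun_subspaceD\<close>)
      also have "p (\<lambda>i. (f i + g i) + (s + t) * y i) = p (\<lambda>i. (f i + s * y i) + (g i + t * y i))"
        by (rule arg_cong[of _ _ p]) (auto simp: algebra_simps)
      also have "\<dots> \<le> p (\<lambda>i. f i + s * y i) + p (\<lambda>i. g i + t * y i)"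
        by (rule sublinear_onD(1)[OF p]) (use f g y V in \<open>auto intro: fun_subspaceD\<close>)
      finally show ?thesis by (simp add: algebra_simps)
    qed
    have "p' (\<lambda>i. f i + g i) - p' g \<le> p' f"
    proof (rule ge)
      fix s :: real assume s: "0 \<le> s"
      have "p' (\<lambda>i. f i + g i) - (p (\<lambda>i. f i + s * y i) - s * p y) \<le> p' g"
        by (rule ge) (use *[OF s] in \<open>simp add: algebra_simps\<close>)
      then show "p' (\<lambda>i. f i + g i) - p' g \<le> p (\<lambda>i. f i + s * y i) - s * p y" by simp
    qed
    then show ?thesis by simp
  qed
  have half: "c * p' f \<le> p' (\<lambda>i. c * f i)" if f: "f \<in> V" and c: "0 < c" for f c
  proof (rule ge)
    fix t :: real assume t: "0 \<le> t"
    have "p (\<lambda>i. c * f i + t * y i) = p (\<lambda>i. c * (f i + (t / c) * y i))"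
      using c by (simp add: algebra_simps)
    also have "\<dots> = c * p (\<lambda>i. f i + (t / c) * y i)"
      by (rule sublinear_onD(2)[OF p fun_subspaceD(2)[OF V f fun_subspaceD(3)[OF V y]]]) (use c in simp)
    finally have e: "p (\<lambda>i. c * f i + t * y i) - t * p y = c * (p (\<lambda>i. f i + (t / c) * y i) - (t / c) * p y)"
      using c by (simp add: algebra_simps)
    show "c * p' f \<le> p (\<lambda>i. c * f i + t * y i) - t * p y"
      unfolding e using le[OF f, of "t / c"] t c by (intro mult_left_mono) auto
  qed
  have hom: "p' (\<lambda>i. c * f i) = c * p' f" if f: "f \<in> V" and c: "0 \<le> c" for f c
  proof (cases "c = 0")
    case True
    have "p' (\<lambda>i. 0) \<le> p (\<lambda>i. 0 + 0 * y i) - 0 * p y"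
      by (rule le) (use V in \<open>auto intro: fun_subspaceD\<close>)
    moreover have "0 \<le> p' (\<lambda>i. 0)"
      by (rule ge) (use sublinear_onD(2)[OF p y] in simp)
    ultimately show ?thesis using True sublinear_on_zero[OF V p] by simp
  next
    case False
    then have c: "0 < c" using c by simp
    have "inverse c * p' (\<lambda>i. c * f i) \<le> p' (\<lambda>i. inverse c * (c * f i))"
      by (rule half) (use f V c in \<open>auto intro: fun_subspaceD\<close>)
    also have "(\<lambda>i. inverse c * (c * f i)) = f" using c by auto
    finally have "p' (\<lambda>i. c * f i) \<le> c * p' f" using c by (simp add: field_simps)
    with half[OF f c] show ?thesis by simp
  qed
  show thesis
  proof
    show "sublinear_on V p'" unfolding sublinear_on_def using sub hom by auto
    show "p' f \<le> p f" if "f \<in> V" for f using le[OF that, of 0] by simp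
    show "p' (\<lambda>i. - y i) \<le> - p y"
      using le[OF fun_subspaceD(4)[OF V y], of 1] sublinear_on_zero[OF V p] by simp
  qed
qed

text \<open>Zorn's lemma gives a minimal sublinear functional, and minimality against
  the descent step forces it to be odd, hence linear.\<close>

theorem sublinear_on_dominates_linear:
  assumes V: "fun_subspace V" and q: "sublinear_on V q"
  obtains L where "linear_functional_on V L" "\<And>f. f \<in> V \<Longrightarrow> L f \<le> q f"
proof -
  \<comment> \<open>The value 0 outside \<open>V\<close> makes members of \<open>A\<close> that
    agree on \<open>V\<close> equal, so that minimality yields an equation between
    functionals.\<close>
  define A where "A = {p. sublinear_on V p \<and> (\<forall>f\<in>V. p f \<le> q f) \<and> (\<forall>f. f \<notin> V \<longrightarrow> p f = 0)}"
  \<comment> \<open>The order is reversed, so that a maximal element in Zorn's lemma is a minimal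
    functional.\<close>
  define R :: "(('a \<Rightarrow> real) \<Rightarrow> real) \<Rightarrow> (('a \<Rightarrow> real) \<Rightarrow> real) \<Rightarrow> bool" where "R a b \<longleftrightarrow> b \<le> a" for a b
  have restr: "(\<lambda>f. if f \<in> V then p f else 0) \<in> A"
    if "sublinear_on V p" "\<And>f. f \<in> V \<Longrightarrow> p f \<le> q f" for p
    using that V unfolding A_def sublinear_on_def by (auto intro: fun_subspaceD)
  have "\<exists>m\<in>A. \<forall>a\<in>A. R m a \<longrightarrow> a = m"
  proof (rule predicate_Zorn)
    show "partial_order_on A (relation_of R A)"
      by (rule partial_order_on_relation_ofI) (auto simp: R_def)
    fix C assume C: "C \<in> Chains (relation_of R A)"
    then have CA: "C \<subseteq> A" by (rule Chains_relation_of)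
    have comp: "a \<le> b \<or> b \<le> a" if "a \<in> C" "b \<in> C" for a b
      using C that unfolding Chains_def relation_of_def R_def by auto
    show "\<exists>u\<in>A. \<forall>a\<in>C. R a u"
    proof (cases "C = {}")
      case True
      then show ?thesis using restr[OF q] by auto
    next
      case False
      define u where "u f = (INF p\<in>C. p f)" for f
      have sl: "sublinear_on V p" if "p \<in> C" for p using that CA by (auto simp: A_def)
      \<comment> \<open>All members of the chain share this lower bound, so their pointwise infimum
        is a genuine real infimum.\<close>
      have lb: "- q (\<lambda>i. - f i) \<le> p f" if "p \<in> C" "f \<in> V" for p f
      proof -
        have "p (\<lambda>i. - f i) \<le> q (\<lambda>i. - f i)"
          using that CA fun_subspaceD(4)[OF V that(2)] by (auto simp: A_def)
        then show ?thesis using sublinear_on_minus[OF V sl[OF that(1)] that(2)] by simp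
      qed
      have le: "u f \<le> p f" if "p \<in> C" "f \<in> V" for p f
        unfolding u_def using that lb[OF _ that(2)]
        by (intro cINF_lower) (auto simp: bdd_below_def)
      have ge: "c \<le> u f" if "\<And>p. p \<in> C \<Longrightarrow> c \<le> p f" for c f
        unfolding u_def using False that by (intro cINF_greatest)
      have sub: "u (\<lambda>i. f i + g i) \<le> u f + u g" if f: "f \<in> V" and g: "g \<in> V" for f g
      proof -
        have *: "u (\<lambda>i. f i + g i) \<le> p1 f + p2 g" if p12: "p1 \<in> C" "p2 \<in> C" for p1 p2
        proof -
          \<comment> \<open>Different functionals may be nearly optimal at \<open>f\<close> and at
            \<open>g\<close>; in a chain the smaller of the two serves both.\<close>
          obtain p where pC: "p \<in> C" "p \<le> p1" "p \<le> p2" using comp[OF p12] p12 by auto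
          have "u (\<lambda>i. f i + g i) \<le> p (\<lambda>i. f i + g i)"
            using pC f g V by (intro le) (auto intro: fun_subspaceD)
          also have "\<dots> \<le> p f + p g" by (rule sublinear_onD(1)[OF sl[OF pC(1)] f g])
          also have "\<dots> \<le> p1 f + p2 g" using pC by (intro add_mono) (auto simp: le_fun_def)
          finally show ?thesis .
        qed
        have "u (\<lambda>i. f i + g i) - u g \<le> u f"
        proof (rule ge)
          fix p1 assume p1: "p1 \<in> C"
          have "u (\<lambda>i. f i + g i) - p1 f \<le> u g"
            by (rule ge) (use *[OF p1] in \<open>simp add: algebra_simps\<close>)
          then show "u (\<lambda>i. f i + g i) - u g \<le> p1 f" by simp
        qed
        then show ?thesis by simp
      qed
      have hom: "u (\<lambda>i. t * f i) = t * u f" if f: "f \<in> V" and t: "0 \<le> t" for f t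
      proof (rule antisym)
        show "t * u f \<le> u (\<lambda>i. t * f i)"
        proof (rule ge)
          fix p assume p: "p \<in> C"
          show "t * u f \<le> p (\<lambda>i. t * f i)"
            unfolding sublinear_onD(2)[OF sl[OF p] f t] using le[OF p f] t by (rule mult_left_mono)
        qed
        show "u (\<lambda>i. t * f i) \<le> t * u f"
        proof (cases "t = 0")
          case True
          obtain p where "p \<in> C" using False by auto
          then have "u (\<lambda>i. 0) \<le> p (\<lambda>i. 0)" using V by (intro le) (auto intro: fun_subspaceD)
          then show ?thesis using sublinear_on_zero[OF V sl[OF \<open>p \<in> C\<close>]] True by simp
        next
          case False
          then have t: "0 < t" using t by simp
          have "u (\<lambda>i. t * f i) / t \<le> u f"
          proof (rule ge)
            fix p assume p: "p \<in> C"
            have "u (\<lambda>i. t * f i) \<le> p (\<lambda>i. t * f i)"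
              using p f V by (intro le) (auto intro: fun_subspaceD)
            also have "\<dots> = t * p f" using sublinear_onD(2)[OF sl[OF p] f] t by simp
            finally show "u (\<lambda>i. t * f i) / t \<le> p f" using t by (simp add: field_simps)
          qed
          then show ?thesis using t by (simp add: field_simps)
        qed
      qed
      have "sublinear_on V u" unfolding sublinear_on_def using sub hom by auto
      moreover have "u f \<le> q f" if "f \<in> V" for f
        using le[OF _ that] CA False that by (force simp: A_def)
      ultimately have uA: "(\<lambda>f. if f \<in> V then u f else 0) \<in> A" by (rule restr)
      have "R a (\<lambda>f. if f \<in> V then u f else 0)" if "a \<in> C" for a
        using that CA le[OF that] by (auto simp: R_def le_fun_def A_def)
      then show ?thesis using uA by blast
    qed
  qed
  then obtain L where L: "L \<in> A" and min: "\<And>a. a \<in> A \<Longrightarrow> a \<le> L \<Longrightarrow> a = L"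
    unfolding R_def by blast
  have sl: "sublinear_on V L" and Lq: "\<And>f. f \<in> V \<Longrightarrow> L f \<le> q f" using L by (auto simp: A_def)
  have odd: "L (\<lambda>i. - f i) = - L f" if f: "f \<in> V" for f
  proof -
    obtain p' where p': "sublinear_on V p'" "\<And>f. f \<in> V \<Longrightarrow> p' f \<le> L f" "p' (\<lambda>i. - f i) \<le> - L f"
      using sublinear_on_descend[OF V sl f] by blast
    let ?p = "\<lambda>f. if f \<in> V then p' f else 0"
    have "?p \<in> A" using p' Lq by (intro restr) (auto intro: order_trans)
    moreover have "?p \<le> L" using p' L by (auto simp: le_fun_def A_def)
    ultimately have "?p = L" by (rule min)
    then have "?p (\<lambda>i. - f i) = L (\<lambda>i. - f i)" by (rule fun_cong)
    then have "L (\<lambda>i. - f i) \<le> - L f" using p'(3) fun_subspaceD(4)[OF V f] by simp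
    then show ?thesis using sublinear_on_minus[OF V sl f] by simp
  qed
  have add: "L (\<lambda>i. f i + g i) = L f + L g" if f: "f \<in> V" and g: "g \<in> V" for f g
  proof -
    have "L (\<lambda>i. (- f i) + (- g i)) \<le> - L f - L g"
      using sublinear_onD(1)[OF sl fun_subspaceD(4)[OF V f] fun_subspaceD(4)[OF V g]]
      by (simp add: odd[OF f] odd[OF g])
    moreover have "L (\<lambda>i. (- f i) + (- g i)) = - L (\<lambda>i. f i + g i)"
      using odd[OF fun_subspaceD(2)[OF V f g]] by simp
    ultimately show ?thesis using sublinear_onD(1)[OF sl f g] by simp
  qed
  have scale: "L (\<lambda>i. t * f i) = t * L f" if f: "f \<in> V" for f t
  proof (cases "0 \<le> t")
    case True
    then show ?thesis by (rule sublinear_onD(2)[OF sl f])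
  next
    case False
    then have "L (\<lambda>i. (-t) * (- f i)) = (-t) * L (\<lambda>i. - f i)"
      by (intro sublinear_onD(2)[OF sl fun_subspaceD(4)[OF V f]]) auto
    then show ?thesis by (simp add: odd[OF f])
  qed
  show thesis by (rule that[OF _ Lq]) (simp_all add: linear_functional_on_def add scale)
qed

text \<open>One descent step at \<open>y\<close> is made before passing to a linear minorant. The
  minorant then has value at most \<open>- q y\<close> at \<open>- y\<close>, which by linearity
  says that it is at least \<open>q y\<close> at \<open>y\<close>.\<close>

theorem sublinear_on_attained_by_linear:
  assumes V: "fun_subspace V" and q: "sublinear_on V q" and y: "y \<in> V"
  obtains L where "linear_functional_on V L" "\<And>f. f \<in> V \<Longrightarrow> L f \<le> q f" "L y = q y"
proof -
  obtain p' where p': "sublinear_on V p'" "\<And>f. f \<in> V \<Longrightarrow> p' f \<le> q f" "p' (\<lambda>i. - y i) \<le> - q y"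
    using sublinear_on_descend[OF V q y] by blast
  obtain L where L: "linear_functional_on V L" "\<And>f. f \<in> V \<Longrightarrow> L f \<le> p' f"
    using sublinear_on_dominates_linear[OF V p'(1)] by blast
  have "L (\<lambda>i. (-1) * y i) = - L y" using L(1) y unfolding linear_functional_on_def by (metis mult_minus1)
  then have "q y \<le> L y" using L(2)[OF fun_subspaceD(4)[OF V y]] p'(3) by simp
  moreover have "L f \<le> q f" if "f \<in> V" for f using L(2) p'(2) that by (meson order_trans)
  ultimately show thesis using that[OF L(1)] y by (meson antisym)
qed

section \<open>An integral for functions that need not be measurable\<close>

definition dominated_by :: "'a measure \<Rightarrow> ('a \<Rightarrow> real) \<Rightarrow> ('a \<times> nat \<Rightarrow> real) set" where
  "dominated_by M w = {f. \<exists>C. \<forall>x\<in>space M. \<forall>n. \<bar>f (x, n)\<bar> \<le> C * w x}"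

lemma fun_subspace_dominated_by: "fun_subspace (dominated_by M w)"
  unfolding fun_subspace_def
proof (intro conjI ballI allI)
  show "(\<lambda>_. 0) \<in> dominated_by M w" by (auto simp: dominated_by_def intro!: exI[of _ 0])
next
  fix f g assume "f \<in> dominated_by M w" "g \<in> dominated_by M w"
  then obtain C D where "\<forall>x\<in>space M. \<forall>n. \<bar>f (x, n)\<bar> \<le> C * w x" "\<forall>x\<in>space M. \<forall>n. \<bar>g (x, n)\<bar> \<le> D * w x"
    unfolding dominated_by_def by blast
  then have "\<forall>x\<in>space M. \<forall>n. \<bar>f (x, n) + g (x, n)\<bar> \<le> (C + D) * w x"
    by (auto simp: algebra_simps intro!: order_trans[OF abs_triangle_ineq] add_mono)
  then show "(\<lambda>i. f i + g i) \<in> dominated_by M w" unfolding dominated_by_def by blast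
next
  fix f t assume "f \<in> dominated_by M w"
  then obtain C where "\<forall>x\<in>space M. \<forall>n. \<bar>f (x, n)\<bar> \<le> C * w x" unfolding dominated_by_def by blast
  then have "\<forall>x\<in>space M. \<forall>n. \<bar>t * f (x, n)\<bar> \<le> (\<bar>t\<bar> * C) * w x"
    by (auto simp: abs_mult mult.assoc intro!: mult_left_mono)
  then show "(\<lambda>i. t * f i) \<in> dominated_by M w" unfolding dominated_by_def by blast
qed

text \<open>A linear extension of the integral to functions that need not be measurable and may
  depend on an index \<open>n\<close>; errors that vanish as \<open>n \<rightarrow> \<infinity>\<close> are invisible to it.
  At the prescribed \<open>f0\<close> it takes the value of the lower integral.\<close>

theorem exists_generalized_integral:
  fixes M :: "'a measure" and w f0 :: "'a \<Rightarrow> real"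
  assumes w: "integrable M w"
    and f0: "(\<lambda>(x, n). f0 x) \<in> dominated_by M w"
  obtains L where "linear_functional_on (dominated_by M w) L"
    "\<And>f g N. f \<in> dominated_by M w \<Longrightarrow> integrable M g \<Longrightarrow> AE x in M. \<forall>n\<ge>N. f (x, n) \<le> g x \<Longrightarrow>
       L f \<le> integral\<^sup>L M g"
    "\<And>c. (\<And>g. integrable M g \<Longrightarrow> AE x in M. g x \<le> f0 x \<Longrightarrow> integral\<^sup>L M g \<le> c) \<Longrightarrow>
       L (\<lambda>(x, n). f0 x) \<le> c"
proof -
  let ?V = "dominated_by M w"
  note V = fun_subspace_dominated_by[of M w]
  \<comment> \<open>\<open>q\<close> is the upper integral. A majorant has to dominate only from
    some \<open>N\<close> on, with the same \<open>N\<close> for almost all \<open>x\<close>; this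
    is what makes vanishing errors invisible.\<close>
  define adm where "adm f g \<longleftrightarrow> integrable M g \<and> (\<exists>N::nat. AE x in M. \<forall>n\<ge>N. f (x, n) \<le> g x)"
    for f :: "'a \<times> nat \<Rightarrow> real" and g
  define q where "q f = Inf {integral\<^sup>L M g | g. adm f g}" for f
  have lb: "\<exists>c. \<forall>g. adm f g \<longrightarrow> c \<le> integral\<^sup>L M g" if "f \<in> ?V" for f
  proof -
    from that obtain C where C: "\<And>x n. x \<in> space M \<Longrightarrow> \<bar>f (x, n)\<bar> \<le> C * w x"
      unfolding dominated_by_def by blast
    have "integral\<^sup>L M (\<lambda>x. - C * w x) \<le> integral\<^sup>L M g" if "adm f g" for g
    proof -
      from that obtain N :: nat where g: "integrable M g" and N: "AE x in M. \<forall>n\<ge>N. f (x, n) \<le> g x"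
        unfolding adm_def by blast
      have "AE x in M. - C * w x \<le> g x"
        using N AE_space
      proof eventually_elim
        case (elim x)
        then show ?case using C[of x N] by force
      qed
      then show ?thesis using w g by (intro integral_mono_AE) auto
    qed
    then show ?thesis by blast
  qed
  have ne: "{integral\<^sup>L M g | g. adm f g} \<noteq> {}" if "f \<in> ?V" for f
  proof -
    from that obtain C where C: "\<And>x n. x \<in> space M \<Longrightarrow> \<bar>f (x, n)\<bar> \<le> C * w x"
      unfolding dominated_by_def by blast
    have "adm f (\<lambda>x. C * w x)"
      unfolding adm_def using w C by (auto intro!: exI[of _ 0] AE_I2 dest: abs_le_D1)
    then show ?thesis by blast
  qed
  have le: "q f \<le> integral\<^sup>L M g" if "f \<in> ?V" "adm f g" for f g
    unfolding q_def using lb[OF that(1)] that by (intro cInf_lower) (auto simp: bdd_below_def)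
  have ge: "c \<le> q f" if "f \<in> ?V" "\<And>g. adm f g \<Longrightarrow> c \<le> integral\<^sup>L M g" for c f
    unfolding q_def using that ne[OF that(1)] by (intro cInf_greatest) auto
  have sub: "q (\<lambda>i. f i + g i) \<le> q f + q g" if f: "f \<in> ?V" and g: "g \<in> ?V" for f g
  proof -
    have *: "q (\<lambda>i. f i + g i) \<le> integral\<^sup>L M f' + integral\<^sup>L M g'" if "adm f f'" "adm g g'" for f' g'
    proof -
      from that obtain N N' :: nat where
        h: "integrable M f'" "integrable M g'"
          "AE x in M. \<forall>n\<ge>N. f (x, n) \<le> f' x" "AE x in M. \<forall>n\<ge>N'. g (x, n) \<le> g' x"
        unfolding adm_def by blast
      have "AE x in M. \<forall>n\<ge>max N N'. f (x, n) + g (x, n) \<le> f' x + g' x"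
        using h(3,4) by eventually_elim (auto intro!: add_mono)
      then have "adm (\<lambda>i. f i + g i) (\<lambda>x. f' x + g' x)" unfolding adm_def using h by blast
      then show ?thesis using le[OF fun_subspaceD(2)[OF V f g]] h by fastforce
    qed
    have "q (\<lambda>i. f i + g i) - q g \<le> q f"
    proof (rule ge[OF f])
      fix f' assume f': "adm f f'"
      have "q (\<lambda>i. f i + g i) - integral\<^sup>L M f' \<le> q g"
        by (rule ge[OF g]) (use *[OF f'] in \<open>simp add: algebra_simps\<close>)
      then show "q (\<lambda>i. f i + g i) - q g \<le> integral\<^sup>L M f'" by simp
    qed
    then show ?thesis by simp
  qed
  have half: "q (\<lambda>i. t * f i) \<le> t * q f" if f: "f \<in> ?V" and t: "0 < t" for f t
  proof -
    have "q (\<lambda>i. t * f i) / t \<le> q f"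
    proof (rule ge[OF f])
      fix g assume "adm f g"
      then obtain N :: nat where g: "integrable M g" "AE x in M. \<forall>n\<ge>N. f (x, n) \<le> g x"
        unfolding adm_def by blast
      have "AE x in M. \<forall>n\<ge>N. t * f (x, n) \<le> t * g x"
        using g(2) by eventually_elim (use t in auto)
      then have "adm (\<lambda>i. t * f i) (\<lambda>x. t * g x)" unfolding adm_def using g(1) by auto
      from le[OF fun_subspaceD(3)[OF V f] this] show "q (\<lambda>i. t * f i) / t \<le> integral\<^sup>L M g"
        using t g(1) by (simp add: field_simps)
    qed
    then show ?thesis using t by (simp add: field_simps)
  qed
  have hom: "q (\<lambda>i. t * f i) = t * q f" if f: "f \<in> ?V" and t: "0 \<le> t" for f t
  proof (cases "t = 0")
    case True
    have V0: "(\<lambda>i. 0) \<in> ?V" using V by (rule fun_subspaceD)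
    have "q (\<lambda>i. 0) \<le> integral\<^sup>L M (\<lambda>x. 0)" by (rule le[OF V0]) (auto simp: adm_def)
    moreover have "0 \<le> q (\<lambda>i. 0)"
      by (rule ge[OF V0]) (auto simp: adm_def intro!: integral_nonneg_AE)
    ultimately show ?thesis using True by simp
  next
    case False
    then have t: "0 < t" using t by simp
    have "q (\<lambda>i. inverse t * (t * f i)) \<le> inverse t * q (\<lambda>i. t * f i)"
      by (rule half[OF fun_subspaceD(3)[OF V f]]) (use t in simp)
    also have "(\<lambda>i. inverse t * (t * f i)) = f" using t by auto
    finally have "t * q f \<le> q (\<lambda>i. t * f i)" using t by (simp add: field_simps)
    with half[OF f t] show ?thesis by simp
  qed
  have q: "sublinear_on ?V q" unfolding sublinear_on_def using sub hom by blast
  \<comment> \<open>The value is prescribed at \<open>- f0\<close>: \<open>q\<close> is an upper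
    integral, so \<open>- q (- f0)\<close> is the lower integral of \<open>f0\<close>.\<close>
  let ?f0 = "\<lambda>(x, n). f0 x" and ?mf0 = "\<lambda>i. - (\<lambda>(x, n). f0 x) i"
  obtain L where L: "linear_functional_on ?V L" "\<And>f. f \<in> ?V \<Longrightarrow> L f \<le> q f" "L ?mf0 = q ?mf0"
    using sublinear_on_attained_by_linear[OF V q fun_subspaceD(4)[OF V f0]] by blast
  show thesis
  proof (rule that[OF L(1)])
    fix f g and N :: nat
    assume "f \<in> ?V" "integrable M g" "AE x in M. \<forall>n\<ge>N. f (x, n) \<le> g x"
    then show "L f \<le> integral\<^sup>L M g" using L(2)[of f] le[of f g] unfolding adm_def by force
  next
    fix c assume c: "\<And>g. integrable M g \<Longrightarrow> AE x in M. g x \<le> f0 x \<Longrightarrow> integral\<^sup>L M g \<le> c"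
    have "- c \<le> q ?mf0"
    proof (rule ge[OF fun_subspaceD(4)[OF V f0]])
      fix g assume "adm ?mf0 g"
      then obtain N :: nat where g: "integrable M g" "AE x in M. \<forall>n\<ge>N. - f0 x \<le> g x"
        unfolding adm_def by auto
      have "AE x in M. - g x \<le> f0 x" using g(2) by eventually_elim force
      then show "- c \<le> integral\<^sup>L M g" using c[of "\<lambda>x. - g x"] g(1) by simp
    qed
    moreover have "L (\<lambda>i. (-1) * ?f0 i) = (-1) * L ?f0"
      using L(1) f0 unfolding linear_functional_on_def by blast
    ultimately show "L ?f0 \<le> c" using L(3) by simp
  qed
qed

section \<open>Densities of functionals on bounded functions\<close>

definition bounded_measurable :: "'a measure \<Rightarrow> ('a \<Rightarrow> real) set" where
  "bounded_measurable M = {f \<in> borel_measurable M. \<exists>C. \<forall>x\<in>space M. \<bar>f x\<bar> \<le> C}"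

lemma bounded_measurableI:
  "f \<in> borel_measurable M \<Longrightarrow> (\<And>x. x \<in> space M \<Longrightarrow> \<bar>f x\<bar> \<le> C) \<Longrightarrow> f \<in> bounded_measurable M"
  by (auto simp: bounded_measurable_def)

lemma indicator_bounded_measurable: "A \<in> sets M \<Longrightarrow> indicator A \<in> bounded_measurable M"
  by (rule bounded_measurableI[of _ _ 1]) (auto simp: indicator_def)

lemma fun_subspace_bounded_measurable: "fun_subspace (bounded_measurable M)"
  unfolding fun_subspace_def
proof (intro conjI ballI allI)
  show "(\<lambda>_. 0) \<in> bounded_measurable M" by (rule bounded_measurableI[of _ _ 0]) auto
next
  fix f g assume "f \<in> bounded_measurable M" "g \<in> bounded_measurable M"
  then obtain C D where "f \<in> borel_measurable M" "g \<in> borel_measurable M"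
    "\<And>x. x \<in> space M \<Longrightarrow> \<bar>f x\<bar> \<le> C" "\<And>x. x \<in> space M \<Longrightarrow> \<bar>g x\<bar> \<le> D"
    unfolding bounded_measurable_def by blast
  then show "(\<lambda>i. f i + g i) \<in> bounded_measurable M"
    by (intro bounded_measurableI[of _ _ "C + D"]) (auto intro!: order_trans[OF abs_triangle_ineq] add_mono)
next
  fix f t assume "f \<in> bounded_measurable M"
  then obtain C where "f \<in> borel_measurable M" "\<And>x. x \<in> space M \<Longrightarrow> \<bar>f x\<bar> \<le> C"
    unfolding bounded_measurable_def by blast
  then show "(\<lambda>i. t * f i) \<in> bounded_measurable M"
    by (intro bounded_measurableI[of _ _ "\<bar>t\<bar> * C"]) (auto simp: abs_mult intro!: mult_left_mono)
qed

text \<open>The sum counts the integers from 1 to \<open>J\<close> that do not exceed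
  \<open>t\<close>, so it is the floor of \<open>t\<close>. It serves to approximate a bounded
  function uniformly by a combination of indicators.\<close>

lemma sum_indicator_near:
  fixes t :: real
  assumes "0 \<le> t" "t \<le> real J"
  shows "\<bar>t - (\<Sum>j\<in>{1..J}. indicator {j. real j \<le> t} j)\<bar> \<le> 1"
proof -
  have "(\<Sum>j\<in>{1..J}. indicator {j. real j \<le> t} j) = (real (card {j\<in>{1..J}. real j \<le> t}))"
    by (simp add: indicator_def sum.If_cases Int_def)
  also have "{j\<in>{1..J}. real j \<le> t} = {1..nat \<lfloor>t\<rfloor>}"
    using assms by (auto simp: le_nat_iff le_floor_iff) 
  finally show ?thesis using assms by (simp) linarith
qed

text \<open>The values on indicators form a finitely additive set function. The bound with free
  \<open>k\<close> plays the part of uniform integrability: choosing \<open>k\<close> large first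
  and the measure of the set small afterwards gives both countable additivity and absolute
  continuity. Radon-Nikodym then supplies \<open>s\<close>, and uniform approximation extends the
  formula from indicators to bounded functions.\<close>

theorem (in finite_measure) bounded_functional_density:
  assumes L: "linear_functional_on (bounded_measurable M) L"
    and nonneg: "\<And>f. f \<in> bounded_measurable M \<Longrightarrow> (\<And>x. x \<in> space M \<Longrightarrow> 0 \<le> f x) \<Longrightarrow> 0 \<le> L f"
    and bound: "\<And>f k. f \<in> bounded_measurable M \<Longrightarrow> (\<And>x. x \<in> space M \<Longrightarrow> 0 \<le> f x \<and> f x \<le> 1) \<Longrightarrow> 0 < k \<Longrightarrow>
        L f \<le> k * integral\<^sup>L M f + C / k"
  obtains s where "s \<in> borel_measurable M" "\<And>x. 0 \<le> s x" "integrable M s"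
    "\<And>f. f \<in> bounded_measurable M \<Longrightarrow> L f = (\<integral>x. f x * s x \<partial>M)"
proof -
  let ?V = "bounded_measurable M"
  note V = fun_subspace_bounded_measurable[of M]
  let ?I = "\<lambda>A. indicator A :: 'a \<Rightarrow> real"
  have I0: "0 \<le> L (?I A)" if "A \<in> sets M" for A
    by (rule nonneg[OF indicator_bounded_measurable[OF that]]) auto
  have bI: "L (?I A) \<le> k * measure M A + C / k" if "A \<in> sets M" "0 < k" for A k
    using bound[OF indicator_bounded_measurable[OF that(1)] _ that(2)] that(1)
    by (simp add: indicator_le_1 sets.Int_space_eq2)
  define \<sigma> where "\<sigma> = measure_of (space M) (sets M) (\<lambda>A. ennreal (L (?I A)))"
  have sets_\<sigma>: "sets \<sigma> = sets M" by (simp add: \<sigma>_def)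
  have ad: "additive (sets M) (\<lambda>A. ennreal (L (?I A)))"
  unfolding additive_def
  proof (intro ballI impI)
    fix A B assume AB: "A \<in> sets M" "B \<in> sets M" "A \<inter> B = {}"
    have "?I (A \<union> B) = (\<lambda>x. ?I A x + ?I B x)" using AB(3) by (auto simp: indicator_def fun_eq_iff)
    then have "L (?I (A \<union> B)) = L (?I A) + L (?I B)"
      using linear_functional_onD(1)[OF L] AB indicator_bounded_measurable by metis
    then show "ennreal (L (?I (A \<union> B))) = ennreal (L (?I A)) + ennreal (L (?I B))"
      using I0 AB by simp
  qed
  have "?I {} = (\<lambda>_. 0)" by auto
  then have pos: "positive (sets M) (\<lambda>A. ennreal (L (?I A)))"
    using linear_functional_on_zero[OF V L] by (simp add: positive_def)
  have "countably_additive (sets M) (\<lambda>A. ennreal (L (?I A)))"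
  proof (rule sets.empty_continuous_imp_countably_additive[OF pos ad])
    show "\<forall>A\<in>sets M. ennreal (L (?I A)) \<noteq> \<infinity>" by simp
    fix A :: "nat \<Rightarrow> 'a set" assume A: "range A \<subseteq> sets M" "decseq A" "(\<Inter>i. A i) = {}"
    have m0: "(\<lambda>i. measure M (A i)) \<longlonglongrightarrow> 0" using finite_Lim_measure_decseq[OF A(1,2)] A(3) by simp
    have "(\<lambda>i. L (?I (A i))) \<longlonglongrightarrow> 0"
    proof (rule LIMSEQ_I)
      fix e :: real assume e: "0 < e"
      \<comment> \<open>First \<open>k\<close> brings \<open>C / k\<close> below
        \<open>e / 2\<close>, then \<open>n\<close> brings \<open>k * measure M (A n)\<close> below
        \<open>e / 2\<close>. Adding 1 keeps \<open>k\<close> positive when \<open>C\<close> is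
        0.\<close>
      define k where "k = 2 * (\<bar>C\<bar> + 1) / e"
      have k: "0 < k" using e by (simp add: k_def)
      have Ck: "C / k < e / 2" using e by (simp add: k_def field_simps abs_if)
      obtain n0 where n0: "\<And>n. n \<ge> n0 \<Longrightarrow> norm (measure M (A n) - 0) < e / 2 / k"
        using LIMSEQ_D[OF m0, of "e / 2 / k"] e k by auto
      have "norm (L (?I (A n)) - 0) < e" if "n \<ge> n0" for n
      proof -
        have "k * measure M (A n) < e / 2" using n0[OF that] k by (simp add: field_simps)
        moreover have An: "A n \<in> sets M" using A by auto
        ultimately show ?thesis
          using I0[OF An] bI[OF An k] Ck unfolding real_norm_def by linarith
      qed
      then show "\<exists>n0. \<forall>n\<ge>n0. norm (L (?I (A n)) - 0) < e" by blast
    qed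
    then show "(\<lambda>i. ennreal (L (?I (A i)))) \<longlonglongrightarrow> 0" using tendsto_ennrealI by fastforce
  qed
  then have em: "emeasure \<sigma> A = ennreal (L (?I A))" if "A \<in> sets M" for A
    unfolding \<sigma>_def using that pos
    by (intro emeasure_measure_of_sigma) (auto intro: sets.sigma_algebra_axioms)
  have ac: "absolutely_continuous M \<sigma>"
    unfolding absolutely_continuous_def
  proof
    fix A assume A: "A \<in> null_sets M"
    then have As: "A \<in> sets M" and m: "measure M A = 0" by (auto simp: measure_def)
    have "L (?I A) \<le> 0"
    proof (rule field_le_epsilon)
      fix e :: real assume e: "0 < e"
      have "L (?I A) \<le> C / ((\<bar>C\<bar> + 1) / e)" using bI[OF As, of "(\<bar>C\<bar> + 1) / e"] e m by auto
      also have "\<dots> \<le> e" using e by (simp add: field_simps abs_if)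
      finally show "L (?I A) \<le> 0 + e" by simp
    qed
    then show "A \<in> null_sets \<sigma>" using em[OF As] As sets_\<sigma> by (auto simp: null_sets_def ennreal_neg)
  qed
  obtain h where h: "h \<in> borel_measurable M" "density M h = \<sigma>"
    using Radon_Nikodym[OF ac sets_\<sigma>] by blast
  define s where "s x = enn2real (h x)" for x
  have sm[measurable]: "s \<in> borel_measurable M" unfolding s_def using h(1) by measurable
  have s0: "0 \<le> s x" for x by (simp add: s_def)
  have "(\<integral>\<^sup>+x. h x \<partial>M) = emeasure \<sigma> (space M)"
    using h by (simp add: h(2)[symmetric] emeasure_density cong: nn_integral_cong)
  then have "(\<integral>\<^sup>+x. h x \<partial>M) \<noteq> \<infinity>" using em[of "space M"] by simp
  from nn_integral_PInf_AE[OF h(1) this] have hs: "AE x in M. h x = ennreal (s x)"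
    by eventually_elim (simp add: s_def less_top)
  have nnI: "(\<integral>\<^sup>+x. ennreal (?I A x * s x) \<partial>M) = ennreal (L (?I A))" if A: "A \<in> sets M" for A
  proof -
    have "(\<integral>\<^sup>+x. ennreal (?I A x * s x) \<partial>M) = (\<integral>\<^sup>+x. h x * indicator A x \<partial>M)"
      by (rule nn_integral_cong_AE) (use hs in \<open>eventually_elim; auto simp: indicator_def\<close>)
    also have "\<dots> = emeasure \<sigma> A" using h A by (simp add: h(2)[symmetric] emeasure_density)
    finally show ?thesis using em[OF A] by simp
  qed
  have s_int: "integrable M s"
  proof (rule integrableI_nonneg)
    have "(\<integral>\<^sup>+x. ennreal (s x) \<partial>M) = (\<integral>\<^sup>+x. ennreal (?I (space M) x * s x) \<partial>M)"
      by (rule nn_integral_cong) auto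
    then show "(\<integral>\<^sup>+x. ennreal (s x) \<partial>M) < \<infinity>" using nnI[of "space M"] by simp
  qed (auto simp: s0)
  have fs_int: "integrable M (\<lambda>x. f x * s x)" if "f \<in> ?V" for f
  proof -
    from that obtain D where D: "f \<in> borel_measurable M" "\<And>x. x \<in> space M \<Longrightarrow> \<bar>f x\<bar> \<le> D"
      by (auto simp: bounded_measurable_def)
    show ?thesis
      by (rule Bochner_Integration.integrable_bound[of M "\<lambda>x. D * s x"])
        (use s_int D s0 in \<open>auto intro!: AE_I2 simp: abs_mult intro: mult_mono\<close>,
         smt (verit, ccfv_threshold) mult_right_mono s0)
  qed
  \<comment> \<open>The defect \<open>E\<close> is linear, vanishes on indicators and is bounded in
    the supremum norm by the constant \<open>K\<close>, so it vanishes on uniform limits of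
    combinations of indicators.\<close>
  define E where "E f = L f - (\<integral>x. f x * s x \<partial>M)" for f
  have E: "linear_functional_on ?V E"
    unfolding linear_functional_on_def E_def
    using linear_functional_onD[OF L] fs_int
    by (auto simp: distrib_right mult.assoc right_diff_distrib)
  have EI: "E (?I A) = 0" if A: "A \<in> sets M" for A
    unfolding E_def using nnI[OF A] I0[OF A] s0
    by (subst integral_eq_nn_integral) (use A in auto)
  define K where "K = L (\<lambda>_. 1) + integral\<^sup>L M s"
  have one: "(\<lambda>_. c) \<in> ?V" for c by (rule bounded_measurableI[of _ _ "\<bar>c\<bar>"]) auto
  have K0: "0 \<le> K" unfolding K_def using nonneg[OF one, of 1] s0 by (auto intro!: add_nonneg_nonneg)
  have L1: "L (\<lambda>_. c) = c * L (\<lambda>_. 1)" for c using linear_functional_onD(2)[OF L one, of c 1] by simp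
  have Ebound: "\<bar>E f\<bar> \<le> K * d" if f: "f \<in> ?V" and d: "\<And>x. x \<in> space M \<Longrightarrow> \<bar>f x\<bar> \<le> d" for f d
  proof -
    have "0 \<le> L (\<lambda>x. d - f x)"
      by (rule nonneg[OF linear_functional_on_diff(1)[OF V L one f]]) (use d in force)
    then have 1: "L f \<le> d * L (\<lambda>_. 1)" using linear_functional_on_diff(2)[OF V L one f, of d] L1[of d] by simp
    have "0 \<le> L (\<lambda>x. f x - (- d))"
      by (rule nonneg[OF linear_functional_on_diff(1)[OF V L f one]]) (use d in force)
    then have 2: "- d * L (\<lambda>_. 1) \<le> L f" using linear_functional_on_diff(2)[OF V L f one, of "-d"] L1[of "-d"] by simp
    have 3: "(\<integral>x. f x * s x \<partial>M) \<le> (\<integral>x. d * s x \<partial>M)"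
      by (rule integral_mono[OF fs_int[OF f] fs_int[OF one]]) (use d s0 in \<open>force intro!: mult_right_mono\<close>)
    have 4: "(\<integral>x. (- d) * s x \<partial>M) \<le> (\<integral>x. f x * s x \<partial>M)"
      by (rule integral_mono[OF fs_int[OF one] fs_int[OF f]]) (rule mult_right_mono, use d s0 in force, rule s0)
    show ?thesis using 1 2 3 4 unfolding E_def K_def abs_le_iff by (simp add: algebra_simps)
  qed
  have Enn: "E f = 0" if f: "f \<in> ?V" and f0: "\<And>x. x \<in> space M \<Longrightarrow> 0 \<le> f x" for f
  proof -
    from f obtain D where fm[measurable]: "f \<in> borel_measurable M" and D: "\<And>x. x \<in> space M \<Longrightarrow> \<bar>f x\<bar> \<le> D"
      by (auto simp: bounded_measurable_def)
    have "\<bar>E f\<bar> \<le> K * (1 / real (Suc n))" for n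
    proof -
      let ?n = "real (Suc n)"
      \<comment> \<open>\<open>J\<close> is large enough for \<open>g\<close> to be the floor of
        \<open>?n * f x\<close>, divided by \<open>?n\<close>, written as a sum over the level sets
        \<open>A j\<close>.\<close>
      define J where "J = nat \<lceil>?n * \<bar>D\<bar>\<rceil>"
      define A where "A j = {x\<in>space M. real j \<le> ?n * f x}" for j :: nat
      have As: "A j \<in> sets M" for j unfolding A_def by measurable
      define g where "g x = (\<Sum>j\<in>{1..J}. (1 / ?n) * ?I (A j) x)" for x
      have hV: "(\<lambda>x. (1 / ?n) * ?I (A j) x) \<in> ?V" for j
        by (rule fun_subspaceD(3)[OF V indicator_bounded_measurable[OF As]])
      have Eh: "E (\<lambda>x. (1 / ?n) * ?I (A j) x) = 0" for j
        unfolding linear_functional_onD(2)[OF E indicator_bounded_measurable[OF As]] EI[OF As] by simp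
      have "g \<in> ?V \<and> E g = (\<Sum>j\<in>{1..J}. E (\<lambda>x. (1 / ?n) * ?I (A j) x))"
        unfolding g_def[abs_def]
        by (rule linear_functional_on_sum[OF V E _ hV]) simp
      then have gV: "g \<in> ?V" and Eg: "E g = 0" unfolding Eh by simp_all
      have "\<bar>f x - g x\<bar> \<le> 1 / ?n" if x: "x \<in> space M" for x
      proof -
        have "?n * f x \<le> real J"
          unfolding J_def using D[OF x] f0[OF x] by (intro order_trans[OF _ real_nat_ceiling_ge]) (auto intro!: mult_left_mono)
        then have "\<bar>?n * f x - (\<Sum>j\<in>{1..J}. indicator {j. real j \<le> ?n * f x} j)\<bar> \<le> 1"
          using f0[OF x] by (intro sum_indicator_near) auto
        moreover have "(\<Sum>j\<in>{1..J}. indicator {j. real j \<le> ?n * f x} j) = ?n * g x"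
          unfolding g_def sum_distrib_left using x by (intro sum.cong) (auto simp: A_def indicator_def)
        moreover have "?n * \<bar>f x - g x\<bar> = \<bar>?n * (f x - g x)\<bar>" by (simp only: abs_mult abs_of_nat)
        ultimately have "?n * \<bar>f x - g x\<bar> \<le> 1" by (simp only: right_diff_distrib)
        then show ?thesis by (simp add: field_simps)
      qed
      then have "\<bar>E (\<lambda>x. f x - g x)\<bar> \<le> K * (1 / ?n)"
        by (rule Ebound[OF linear_functional_on_diff(1)[OF V E f gV]])
      then show ?thesis using linear_functional_on_diff(2)[OF V E f gV] Eg by simp
    qed
    moreover have "(\<lambda>n. K * (1 / real (Suc n))) \<longlonglongrightarrow> K * 0"
      using tendsto_mult[OF tendsto_const LIMSEQ_inverse_real_of_nat, of K] by (simp only: inverse_eq_divide)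
    ultimately have "\<bar>E f\<bar> \<le> K * 0" by (intro LIMSEQ_le_const) auto
    then show ?thesis by simp
  qed
  show thesis
  proof (rule that[OF sm s0 s_int])
    fix f assume f: "f \<in> ?V"
    then obtain D where D: "\<And>x. x \<in> space M \<Longrightarrow> \<bar>f x\<bar> \<le> D" by (auto simp: bounded_measurable_def)
    have "E (\<lambda>x. f x + \<bar>D\<bar>) = 0" by (rule Enn[OF fun_subspaceD(2)[OF V f one]]) (use D in force)
    moreover have "E (\<lambda>_. \<bar>D\<bar>) = 0" by (rule Enn[OF one]) auto
    ultimately have "E f = 0" using linear_functional_onD(1)[OF E f one, of "\<bar>D\<bar>"] by simp
    then show "L f = (\<integral>x. f x * s x \<partial>M)" by (simp add: E_def)
  qed
qed

section \<open>Powers, the Gamma function and Gaussian moments\<close>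

lemma powr_above_tangent:
  fixes a b p :: real
  assumes "1 \<le> p" "0 \<le> a" "0 \<le> b"
  shows "a powr p + p * a powr (p - 1) * (b - a) \<le> b powr p"
proof (cases "a = 0 \<or> b = 0")
  case True
  show ?thesis
  proof (cases "a = 0")
    \<comment> \<open>Since \<open>0 powr 0\<close> is 0, the expression for the tangent at 0 is
      horizontal even for \<open>p = 1\<close>, and it is still a lower bound.\<close>
    case True
    then show ?thesis by simp
  next
    case False
    then have "a powr (p - 1) * a = a powr p" using assms by (simp add: powr_mult_base mult.commute)
    then have "p * a powr (p - 1) * a \<ge> a powr p"
      using assms by (simp add: mult.assoc mult_le_cancel_right1)
    then show ?thesis using True False by simp
  qed
next
  case False
  then have ab: "0 < a" "0 < b" using assms by auto
  have "(p * a powr (p - 1)) * (b - a) \<le> b powr p - a powr p"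
    by (rule convex_on_imp_above_tangent[OF powr_convex[OF assms(1)]])
       (use ab in \<open>auto intro!: derivative_eq_intros simp: interior_open DERIV_subset\<close>)
  then show ?thesis by simp
qed

text \<open>Tangents at the midpoint: their linear terms cancel when the inequalities for
  \<open>a\<close> and \<open>b\<close> are added, and \<open>3 * (a + b)\<close> is six times the
  midpoint.\<close>

lemma powr_sum_le:
  fixes a b p :: real
  assumes "1 \<le> p" "0 \<le> a" "0 \<le> b"
  shows "(3 * (a + b)) powr p \<le> 6 powr p / 2 * (a powr p + b powr p)"
proof -
  let ?m = "(a + b) / 2"
  have "?m powr p + p * ?m powr (p - 1) * (a - ?m) + (?m powr p + p * ?m powr (p - 1) * (b - ?m))
      \<le> a powr p + b powr p"
    using assms by (intro add_mono powr_above_tangent) auto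
  moreover have "p * ?m powr (p - 1) * (a - ?m) + p * ?m powr (p - 1) * (b - ?m) = 0"
    by (simp add: field_simps)
  ultimately have m: "2 * ?m powr p \<le> a powr p + b powr p" by linarith
  have "3 * (a + b) = 6 * ?m" by (simp add: field_simps)
  then have "(3 * (a + b)) powr p = (6 * ?m) powr p" by (rule arg_cong)
  also have "\<dots> = 6 powr p * ?m powr p" using assms by (intro powr_mult) 
  also have "\<dots> \<le> 6 powr p * ((a powr p + b powr p) / 2)" using m by (intro mult_left_mono) auto
  finally show ?thesis by simp
qed

text \<open>Log-convexity in two ways. For \<open>z \<le> 2\<close> the point 3/2 is the midpoint of
  \<open>z\<close> and \<open>3 - z\<close>, where \<open>Gamma (3 - z) \<le> 1\<close>, so
  \<open>Gamma z\<close> is at least the square of \<open>Gamma (3/2)\<close>, which is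
  \<open>pi / 4\<close>. For \<open>z > 2\<close> the point 2 lies between 1 and \<open>z\<close>,
  with weight \<open>1 / (z - 1)\<close> on \<open>z\<close>, and
  \<open>Gamma 1 = Gamma 2 = 1\<close>. The bound is used for the constant on the whole
  space.\<close>

lemma Gamma_real_ge:
  fixes z :: real
  assumes z: "1 \<le> z"
  shows "3 / 4 \<le> Gamma z"
proof -
  have conv: "ln (Gamma ((1 - t) * x + t * y)) \<le> (1 - t) * ln (Gamma x) + t * ln (Gamma y)"
    if "0 \<le> t" "t \<le> 1" "0 < x" "0 < y" for x y t :: real
    using convex_onD[OF log_convex_Gamma_real, of t x y] that by (simp add: o_def)
  have G2: "Gamma (2::real) = 1" using Gamma_fact[of 1, where 'a=real] by simp
  have pos: "0 < Gamma z" using z by (intro Gamma_real_pos) auto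
  show ?thesis
  proof (cases "z \<le> 2")
    case True
    have 1: "ln (Gamma (3 - z)) \<le> 0"
      using conv[of "2 - z" 1 2] z True G2 by (simp add: algebra_simps)
    have "(1/2 :: real) \<notin> \<int>\<^sub>\<le>\<^sub>0" by (auto elim!: nonpos_Ints_cases)
    from Gamma_plus1[OF this] have "Gamma (3/2 :: real) = sqrt pi / 2"
      by (simp add: Gamma_one_half_real)
    then have g: "Gamma (3/2 :: real) = sqrt pi / 2" by simp
    have e: "(1 - 1/2) * z + 1/2 * (3 - z) = 3/2" by (simp add: field_simps)
    have "ln (Gamma ((1 - 1/2) * z + 1/2 * (3 - z))) \<le> (1 - 1/2) * ln (Gamma z) + 1/2 * ln (Gamma (3 - z))"
      by (rule conv) (use z True in auto)
    then have "ln (sqrt pi / 2) \<le> (1 - 1/2) * ln (Gamma z) + 1/2 * ln (Gamma (3 - z))"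
      unfolding e g .
    then have "2 * ln (sqrt pi / 2) \<le> ln (Gamma z)" using 1 by simp
    moreover have "2 * ln (sqrt pi / 2) = ln ((sqrt pi / 2)\<^sup>2)" by (simp add: ln_realpow)
    moreover have "(sqrt pi / 2)\<^sup>2 = pi / 4" by (simp add: power_divide)
    ultimately have "ln (pi / 4) \<le> ln (Gamma z)" by simp
    then have "pi / 4 \<le> Gamma z" using pos pi_gt_zero by simp
    then show ?thesis using pi_gt3 by simp
  next
    case False
    define s where "s = 1 / (z - 1)"
    have s: "0 < s" "s \<le> 1" "s * (z - 1) = 1" using False by (auto simp: s_def)
    then have e: "(1 - s) * 1 + s * z = 2" by (simp add: algebra_simps)
    have "ln (Gamma ((1 - s) * 1 + s * z)) \<le> (1 - s) * ln (Gamma 1) + s * ln (Gamma z)"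
      by (rule conv) (use s z in auto)
    then have "0 \<le> s * ln (Gamma z)" unfolding e using G2 by simp
    then have "0 \<le> ln (Gamma z)" using s by (simp add: zero_le_mult_iff)
    then show ?thesis using pos by (simp add: ln_ge_zero_iff)
  qed
qed

text \<open>This absorbs the factor \<open>z\<close> of \<open>Gamma (z + 1) = z * Gamma z\<close>,
  together with the 8 of the density bound, into the base of a power. It holds because
  \<open>ln 16 \<ge> 1\<close> and \<open>exp x \<ge> 1 + x\<close>.\<close>

lemma sixteen_times_le_16_powr:
  fixes z :: real
  assumes "1 \<le> z"
  shows "16 * z \<le> 16 powr z"
proof -
  have "exp 1 \<le> (16 :: real)" using exp_le by simp
  then have l: "1 \<le> ln (16 :: real)" by (subst ln_ge_iff) auto
  have "z \<le> 1 + (z - 1) * ln 16" using mult_left_mono[OF l, of "z - 1"] assms by simp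
  also have "\<dots> \<le> exp ((z - 1) * ln 16)" by (rule exp_ge_add_one_self)
  also have "\<dots> = 16 powr (z - 1)" by (simp add: powr_def)
  finally have "16 * z \<le> 16 * 16 powr (z - 1)" by simp
  also have "\<dots> = 16 powr z" by (simp add: powr_diff)
  finally show ?thesis .
qed

lemma nn_integral_exp_tail:
  fixes a c :: real
  assumes c: "0 < c"
  shows "(\<integral>\<^sup>+t. ennreal (exp (- t / c) / c) * indicator {a..} t \<partial>lborel) = ennreal (exp (- a / c))"
proof -
  have "((\<lambda>t. - exp (- t / c)) \<longlongrightarrow> - 0) at_top"
  proof (intro tendsto_minus filterlim_compose[OF exp_at_bot])
    have "filterlim (\<lambda>t. (1 / c) * t) at_top at_top"
      using c by (intro filterlim_tendsto_pos_mult_at_top[OF tendsto_const]) (auto simp: filterlim_ident)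
    then have "filterlim (\<lambda>t. - ((1 / c) * t)) at_bot at_top" by (simp add: filterlim_uminus_at_bot)
    then show "filterlim (\<lambda>t. - t / c) at_bot at_top" by simp
  qed
  then have "(\<integral>\<^sup>+t. ennreal (exp (- t / c) / c) * indicator {a..} t \<partial>lborel) = ennreal (0 - (- exp (- a / c)))"
    using c by (intro nn_integral_FTC_atLeast) (auto intro!: derivative_eq_intros)
  then show ?thesis by simp
qed

text \<open>Layer cake: \<open>exp (- r\<^sup>2 / c)\<close> is the integral of \<open>exp (- t / c) / c\<close> over \<open>t \<ge> r\<^sup>2\<close>,
  so only the volumes of balls are needed, not polar coordinates.\<close>

lemma nn_integral_norm_powr_gauss_le:
  fixes c p :: real
  assumes c: "0 < c" and p: "0 \<le> p"
  shows "(\<integral>\<^sup>+x. ennreal (norm (x::'a::euclidean_space) powr p * exp (- (norm x)\<^sup>2 / c)) \<partial>lborel)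
    \<le> emeasure lborel (ball (0::'a) 1) *
       ennreal (c powr ((real DIM('a) + p) / 2) * Gamma ((real DIM('a) + p) / 2 + 1))"
proof -
  define d where "d = real DIM('a)"
  define z where "z = (d + p) / 2"
  define V where "V = unit_ball_vol d"
  have V0: "0 \<le> V" by (simp add: V_def d_def)
  have z0: "0 < z" using p DIM_positive[where 'a='a] by (simp add: z_def d_def add_pos_nonneg)
  have "(\<integral>\<^sup>+(x::'a). ennreal (norm x powr p * exp (- (norm x)\<^sup>2 / c)) \<partial>lborel)
    \<le> (\<integral>\<^sup>+(x::'a). \<integral>\<^sup>+t. ennreal (t powr (p / 2) * exp (- t / c) / c) * indicator {(norm x)\<^sup>2..} t \<partial>lborel \<partial>lborel)"
  proof (rule nn_integral_mono)
    fix x :: 'a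
    have "ennreal (norm x powr p * exp (- (norm x)\<^sup>2 / c))
      = ennreal (norm x powr p) * (\<integral>\<^sup>+t. ennreal (exp (- t / c) / c) * indicator {(norm x)\<^sup>2..} t \<partial>lborel)"
      using nn_integral_exp_tail[OF c, of "(norm x)\<^sup>2"] by (simp add: ennreal_mult)
    also have "\<dots> = (\<integral>\<^sup>+t. ennreal (norm x powr p) * (ennreal (exp (- t / c) / c) * indicator {(norm x)\<^sup>2..} t) \<partial>lborel)"
      by (rule nn_integral_cmult[symmetric]) measurable
    \<comment> \<open>On the range \<open>t \<ge> (norm x)\<^sup>2\<close> the factor
      \<open>norm x powr p\<close> is at most \<open>t powr (p / 2)\<close>. Afterwards
      \<open>x\<close> occurs only in the condition that it lies in a ball of radius
      \<open>sqrt t\<close>; compared with the exact value this costs the factor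
      \<open>(d + p) / d\<close>.\<close>
    also have "\<dots> \<le> (\<integral>\<^sup>+t. ennreal (t powr (p / 2) * exp (- t / c) / c) * indicator {(norm x)\<^sup>2..} t \<partial>lborel)"
    proof (rule nn_integral_mono)
      fix t :: real
      have "norm x powr p \<le> t powr (p / 2)" if "(norm x)\<^sup>2 \<le> t"
      proof -
        have "norm x powr p = (norm x powr 2) powr (p / 2)" by (simp add: powr_powr del: powr_numeral)
        also have "\<dots> \<le> t powr (p / 2)" using that p by (intro powr_mono2) auto
        finally show ?thesis .
      qed
      then show "ennreal (norm x powr p) * (ennreal (exp (- t / c) / c) * indicator {(norm x)\<^sup>2..} t)
        \<le> ennreal (t powr (p / 2) * exp (- t / c) / c) * indicator {(norm x)\<^sup>2..} t"
        using c by (auto simp: indicator_def ennreal_mult[symmetric] intro!: ennreal_leI divide_right_mono mult_right_mono)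
    qed
    finally show "ennreal (norm x powr p * exp (- (norm x)\<^sup>2 / c))
      \<le> (\<integral>\<^sup>+t. ennreal (t powr (p / 2) * exp (- t / c) / c) * indicator {(norm x)\<^sup>2..} t \<partial>lborel)" .
  qed
  also have "\<dots> = (\<integral>\<^sup>+t. \<integral>\<^sup>+(x::'a). ennreal (t powr (p / 2) * exp (- t / c) / c) * indicator {(norm x)\<^sup>2..} t \<partial>lborel \<partial>lborel)"
  proof (rule lborel_pair.Fubini'[symmetric])
    have "(\<lambda>(x :: 'a, t). ennreal (t powr (p / 2) * exp (- t / c) / c) * indicator {(norm x)\<^sup>2..} t)
      = (\<lambda>(x, t). ennreal (t powr (p / 2) * exp (- t / c) / c) * indicator {q. (norm (fst q))\<^sup>2 \<le> snd q} (x, t))"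
      by (auto simp: indicator_def)
    also have "\<dots> \<in> borel_measurable (lborel \<Otimes>\<^sub>M lborel)" by measurable
    finally show "(\<lambda>(x :: 'a, t). ennreal (t powr (p / 2) * exp (- t / c) / c) * indicator {(norm x)\<^sup>2..} t)
       \<in> borel_measurable (lborel \<Otimes>\<^sub>M lborel)" .
  qed
  also have "\<dots> = (\<integral>\<^sup>+t. ennreal V * ennreal (indicator {0..} t * (t powr z * exp (- t / c) / c)) \<partial>lborel)"
  proof (rule nn_integral_cong)
    fix t :: real
    have "(\<integral>\<^sup>+(x::'a). ennreal (t powr (p / 2) * exp (- t / c) / c) * indicator {(norm x)\<^sup>2..} t \<partial>lborel)
      = (\<integral>\<^sup>+(x::'a). ennreal (t powr (p / 2) * exp (- t / c) / c) * indicator {x. (norm x)\<^sup>2 \<le> t} x \<partial>lborel)"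
      by (intro nn_integral_cong) (auto simp: indicator_def)
    also have "\<dots> = ennreal (t powr (p / 2) * exp (- t / c) / c) * emeasure lborel {x::'a. (norm x)\<^sup>2 \<le> t}"
      by (rule nn_integral_cmult_indicator) measurable
    also have "\<dots> = ennreal V * ennreal (indicator {0..} t * (t powr z * exp (- t / c) / c))"
    proof (cases "0 \<le> t")
      case True
      have "{x::'a. (norm x)\<^sup>2 \<le> t} = cball 0 (sqrt t)"
        using True by (auto simp: real_le_rsqrt dest: real_sqrt_le_mono intro: order_trans)
          (metis norm_ge_zero real_sqrt_ge_0_iff real_sqrt_pow2 power_mono)
      moreover have "sqrt t ^ DIM('a) = t powr (d / 2)" if "t > 0"
        using that by (simp add: powr_half_sqrt[symmetric] powr_powr powr_realpow[symmetric] d_def)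
      moreover have "t powr z = t powr (p / 2) * t powr (d / 2)"
        by (simp add: z_def powr_add[symmetric] add_divide_distrib add.commute)
      ultimately show ?thesis
        using True V0 c emeasure_cball[of "sqrt t" "0::'a"]
        by (cases "t = 0") (auto simp: V_def d_def ennreal_mult[symmetric] mult_ac)
    next
      case False
      then have "{x::'a. (norm x)\<^sup>2 \<le> t} = {}" by (auto simp: not_le intro: less_le_trans)
      then show ?thesis using False by simp
    qed
    finally show "(\<integral>\<^sup>+(x::'a). ennreal (t powr (p / 2) * exp (- t / c) / c) * indicator {(norm x)\<^sup>2..} t \<partial>lborel)
      = ennreal V * ennreal (indicator {0..} t * (t powr z * exp (- t / c) / c))" .
  qed
  also have "\<dots> = ennreal V * (\<integral>\<^sup>+t. ennreal (indicator {0..} t * (t powr z * exp (- t / c) / c)) \<partial>lborel)"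
    by (rule nn_integral_cmult) measurable
  also have "(\<integral>\<^sup>+t. ennreal (indicator {0..} t * (t powr z * exp (- t / c) / c)) \<partial>lborel)
    = ennreal \<bar>c\<bar> * (\<integral>\<^sup>+t. ennreal (indicator {0..} (0 + c * t) * ((0 + c * t) powr z * exp (- (0 + c * t) / c) / c)) \<partial>lborel)"
    by (rule nn_integral_real_affine) (use c in auto)
  also have "\<dots> = ennreal c * (\<integral>\<^sup>+t. ennreal (c powr z / c) * ennreal (indicator {0..} t * t powr (z + 1 - 1) / exp t) \<partial>lborel)"
    using c by (intro arg_cong2[where f="(*)"] nn_integral_cong)
      (auto simp: indicator_def zero_le_mult_iff powr_mult ennreal_mult[symmetric] exp_minus field_simps)
  also have "\<dots> = ennreal c * (ennreal (c powr z / c) * (\<integral>\<^sup>+t. ennreal (indicator {0..} t * t powr (z + 1 - 1) / exp t) \<partial>lborel))"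
    by (subst nn_integral_cmult) auto
  also have "(\<integral>\<^sup>+t. ennreal (indicator {0..} t * t powr (z + 1 - 1) / exp t) \<partial>lborel) = ennreal (Gamma (z + 1))"
    using Gamma_conv_nn_integral_real[of "z + 1"] z0 by simp
  also have "ennreal c * (ennreal (c powr z / c) * ennreal (Gamma (z + 1))) = ennreal (c powr z * Gamma (z + 1))"
    using c z0 by (simp add: ennreal_mult[symmetric] Gamma_real_nonneg)
  also have "ennreal V = emeasure lborel (ball (0::'a) 1)"
    using emeasure_ball[of 1 "0::'a"] by (simp add: V_def d_def)
  finally show ?thesis by (simp add: z_def d_def)
qed

section \<open>Couplings and moments\<close>

lemma couplingsD:
  assumes "\<gamma> \<in> couplings \<mu> \<nu>"
  shows "prob_space \<gamma>" "sets \<gamma> = sets (borel \<Otimes>\<^sub>M borel)"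
    "distr \<gamma> borel fst = \<mu>" "distr \<gamma> borel snd = \<nu>"
  using assms by (auto simp: couplings_def)

lemma measurable_coupling:
  assumes "\<gamma> \<in> couplings \<mu> \<nu>"
  shows "measurable \<gamma> N = measurable (borel \<Otimes>\<^sub>M borel) N"
  by (rule measurable_cong_sets) (simp_all add: couplingsD[OF assms])

lemma nn_integral_coupling_fst:
  assumes \<gamma>: "\<gamma> \<in> couplings \<mu> \<nu>" and f: "f \<in> borel_measurable borel"
  shows "(\<integral>\<^sup>+q. f (fst q) \<partial>\<gamma>) = (\<integral>\<^sup>+x. f x \<partial>\<mu>)"
  unfolding couplingsD(3)[OF \<gamma>, symmetric] using f
  by (subst nn_integral_distr) (auto simp: measurable_coupling[OF \<gamma>])

lemma nn_integral_coupling_snd: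
  assumes \<gamma>: "\<gamma> \<in> couplings \<mu> \<nu>" and f: "f \<in> borel_measurable borel"
  shows "(\<integral>\<^sup>+q. f (snd q) \<partial>\<gamma>) = (\<integral>\<^sup>+y. f y \<partial>\<nu>)"
  unfolding couplingsD(4)[OF \<gamma>, symmetric] using f
  by (subst nn_integral_distr) (auto simp: measurable_coupling[OF \<gamma>])

lemma P2D:
  assumes "\<mu> \<in> P2"
  shows "prob_space \<mu>" "sets \<mu> = sets borel" "space \<mu> = UNIV" "moment 2 \<mu> < \<infinity>"
  using assms sets_eq_imp_space_eq[of \<mu> borel] by (auto simp: P2_def)

lemma moment_2: "moment 2 \<mu> = (\<integral>\<^sup>+x. ennreal ((norm x)\<^sup>2) \<partial>\<mu>)"
  by (simp add: moment_def)

lemma norm_diff_sq_le: "(norm (x - y))\<^sup>2 \<le> 2 * (norm x)\<^sup>2 + 2 * (norm y)\<^sup>2"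
proof -
  have "(norm (x - y))\<^sup>2 \<le> (norm x + norm y)\<^sup>2" by (intro power_mono norm_triangle_ineq4) auto
  also have "\<dots> \<le> 2 * (norm x)\<^sup>2 + 2 * (norm y)\<^sup>2"
    using sum_squares_bound[of "norm x" "norm y"] by (simp add: power2_sum)
  finally show ?thesis .
qed

lemma coupling_cost_le:
  assumes \<gamma>: "\<gamma> \<in> couplings \<mu> \<nu>"
  shows "(\<integral>\<^sup>+ (x, y). ennreal ((norm (x - y))\<^sup>2) \<partial>\<gamma>) \<le> 2 * moment 2 \<mu> + 2 * moment 2 \<nu>"
proof -
  have "(\<integral>\<^sup>+ (x, y). ennreal ((norm (x - y))\<^sup>2) \<partial>\<gamma>)
    \<le> (\<integral>\<^sup>+ q. 2 * ennreal ((norm (fst q))\<^sup>2) + 2 * ennreal ((norm (snd q))\<^sup>2) \<partial>\<gamma>)"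
    by (rule nn_integral_mono)
      (auto simp: ennreal_mult'[symmetric] ennreal_plus[symmetric] norm_diff_sq_le
         simp del: ennreal_plus simp flip: ennreal_numeral intro!: ennreal_leI)
  also have "\<dots> = 2 * (\<integral>\<^sup>+ q. ennreal ((norm (fst q))\<^sup>2) \<partial>\<gamma>) + 2 * (\<integral>\<^sup>+ q. ennreal ((norm (snd q))\<^sup>2) \<partial>\<gamma>)"
    by (simp add: nn_integral_add nn_integral_cmult measurable_coupling[OF \<gamma>])
  also have "(\<integral>\<^sup>+ q. ennreal ((norm (fst q))\<^sup>2) \<partial>\<gamma>) = moment 2 \<mu>"
    unfolding moment_2 by (rule nn_integral_coupling_fst[OF \<gamma>]) measurable
  also have "(\<integral>\<^sup>+ q. ennreal ((norm (snd q))\<^sup>2) \<partial>\<gamma>) = moment 2 \<nu>"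
    unfolding moment_2 by (rule nn_integral_coupling_snd[OF \<gamma>]) measurable
  finally show ?thesis .
qed

lemma product_coupling:
  assumes \<mu>: "\<mu> \<in> P2" and \<nu>: "\<nu> \<in> P2"
  shows "\<mu> \<Otimes>\<^sub>M \<nu> \<in> couplings \<mu> \<nu>"
proof -
  interpret A: prob_space \<mu> by (rule P2D[OF \<mu>])
  interpret B: prob_space \<nu> by (rule P2D[OF \<nu>])
  interpret pair_prob_space \<mu> \<nu> ..
  have s: "sets (\<mu> \<Otimes>\<^sub>M \<nu>) = sets (borel \<Otimes>\<^sub>M borel)"
    by (intro sets_pair_measure_cong P2D \<mu> \<nu>)
  have "distr (\<mu> \<Otimes>\<^sub>M \<nu>) borel fst = \<mu>"
  proof (rule measure_eqI)
    fix A assume "A \<in> sets (distr (\<mu> \<Otimes>\<^sub>M \<nu>) borel fst)"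
    then have A: "A \<in> sets \<mu>" "A \<in> sets borel" using P2D[OF \<mu>] by auto
    have "fst -` A \<inter> space (\<mu> \<Otimes>\<^sub>M \<nu>) = A \<times> space \<nu>"
      by (auto simp: space_pair_measure P2D[OF \<mu>])
    then show "emeasure (distr (\<mu> \<Otimes>\<^sub>M \<nu>) borel fst) A = emeasure \<mu> A"
      using A B.emeasure_space_1 by (subst emeasure_distr)
        (auto simp: B.emeasure_pair_measure_Times measurable_cong_sets[OF s refl])
  qed (simp add: P2D[OF \<mu>])
  moreover have "distr (\<mu> \<Otimes>\<^sub>M \<nu>) borel snd = \<nu>"
  proof (rule measure_eqI)
    fix A assume "A \<in> sets (distr (\<mu> \<Otimes>\<^sub>M \<nu>) borel snd)"
    then have A: "A \<in> sets \<nu>" "A \<in> sets borel" using P2D[OF \<nu>] by auto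
    have "snd -` A \<inter> space (\<mu> \<Otimes>\<^sub>M \<nu>) = space \<mu> \<times> A"
      by (auto simp: space_pair_measure P2D[OF \<nu>])
    then show "emeasure (distr (\<mu> \<Otimes>\<^sub>M \<nu>) borel snd) A = emeasure \<nu> A"
      using A A.emeasure_space_1 by (subst emeasure_distr)
        (auto simp: B.emeasure_pair_measure_Times measurable_cong_sets[OF s refl])
  qed (simp add: P2D[OF \<nu>])
  ultimately show ?thesis unfolding couplings_def using s prob_space_axioms by auto
qed

lemma W2_sq_le_moments:
  assumes "\<mu> \<in> P2" "\<nu> \<in> P2"
  shows "W2_sq \<mu> \<nu> \<le> 2 * moment 2 \<mu> + 2 * moment 2 \<nu>"
  unfolding W2_sq_def
  by (rule INF_lower2[OF product_coupling[OF assms]]) (rule coupling_cost_le[OF product_coupling[OF assms]])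

lemma W2_sq_finite:
  assumes "\<mu> \<in> P2" "\<nu> \<in> P2"
  shows "W2_sq \<mu> \<nu> < \<infinity>"
proof -
  have "2 * moment 2 \<mu> + 2 * moment 2 \<nu> < \<infinity>"
    using P2D(4)[OF assms(1)] P2D(4)[OF assms(2)] by (simp add: ennreal_mult_less_top)
  then show ?thesis using W2_sq_le_moments[OF assms] by (rule le_less_trans[rotated])
qed

text \<open>Boundedness makes the integral finite, so a strict inequality leaves room
  \<open>\<eta>\<close>. A coupling of cost below \<open>e\<^sup>2\<close> moves the integral by at
  most \<open>\<eta>\<close>: the term \<open>L * norm (x - y)\<close> is bounded by
  \<open>\<eta> / 2\<close> plus a multiple of \<open>(norm (x - y))\<^sup>2\<close>, which keeps
  the estimate in terms of the squared cost. It provides the Borel sets from which measurability of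
  moments follows.\<close>

lemma W2_open_lipschitz_superlevel:
  fixes \<phi> :: "'a::euclidean_space \<Rightarrow> real"
  assumes m[measurable]: "\<phi> \<in> borel_measurable borel"
    and \<phi>0: "\<And>x. 0 \<le> \<phi> x" and \<phi>C: "\<And>x. \<phi> x \<le> C"
    and L: "0 \<le> L" "\<And>x y. \<phi> x - \<phi> y \<le> L * norm (x - y)"
  shows "W2_open {\<nu>\<in>P2. c < (\<integral>\<^sup>+x. ennreal (\<phi> x) \<partial>\<nu>)}"
  unfolding W2_open_def
proof (intro conjI ballI)
  fix \<mu> :: "'a measure" assume "\<mu> \<in> {\<nu>\<in>P2. c < (\<integral>\<^sup>+x. ennreal (\<phi> x) \<partial>\<nu>)}"
  then have \<mu>: "\<mu> \<in> P2" and c: "c < (\<integral>\<^sup>+x. ennreal (\<phi> x) \<partial>\<mu>)" by auto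
  obtain \<eta> :: real where \<eta>: "0 < \<eta>" and c\<eta>: "c + ennreal \<eta> < (\<integral>\<^sup>+x. ennreal (\<phi> x) \<partial>\<mu>)"
  proof -
    interpret prob_space \<mu> by (rule P2D[OF \<mu>])
    have "(\<integral>\<^sup>+x. ennreal (\<phi> x) \<partial>\<mu>) \<le> (\<integral>\<^sup>+x. ennreal C \<partial>\<mu>)" by (intro nn_integral_mono ennreal_leI \<phi>C)
    also have "\<dots> < \<infinity>" by (simp add: emeasure_space_1)
    finally obtain I where I: "0 \<le> I" "(\<integral>\<^sup>+x. ennreal (\<phi> x) \<partial>\<mu>) = ennreal I" by (auto simp: less_top_ennreal)
    then obtain c' where c': "0 \<le> c'" "c = ennreal c'" using c by (cases c) auto
    then have "c' < I" using c I by (simp add: ennreal_less_iff)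
    then show thesis using that[of "(I - c') / 2"] I c'
      by (simp add: ennreal_plus[symmetric] ennreal_less_iff field_simps del: ennreal_plus)
  qed
  define e where "e = \<eta> / (L + 1)"
  have e: "0 < e" using \<eta> L by (simp add: e_def)
  have Le: "L * e \<le> \<eta>" using \<eta> L by (simp add: e_def field_simps)
  have "c < (\<integral>\<^sup>+x. ennreal (\<phi> x) \<partial>\<nu>)" if \<nu>: "\<nu> \<in> P2" and W: "W2 \<mu> \<nu> < e" for \<nu>
  proof -
    interpret prob_space \<nu> by (rule P2D[OF \<nu>])
    have "W2_sq \<mu> \<nu> = ennreal ((W2 \<mu> \<nu>)\<^sup>2)"
      using W2_sq_finite[OF \<mu> \<nu>] by (simp add: W2_def)
    also have "\<dots> < ennreal (e\<^sup>2)"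
      using power_strict_mono[OF W, of 2] e by (intro ennreal_lessI) (auto simp: W2_def)
    finally obtain \<gamma> where \<gamma>: "\<gamma> \<in> couplings \<mu> \<nu>"
      and cost: "(\<integral>\<^sup>+ (x, y). ennreal ((norm (x - y))\<^sup>2) \<partial>\<gamma>) < ennreal (e\<^sup>2)"
      unfolding W2_sq_def by (auto simp: INF_less_iff)
    note [measurable_cong] = couplingsD(2)[OF \<gamma>]
    interpret \<gamma>: prob_space \<gamma> by (rule couplingsD[OF \<gamma>])
    have pt: "\<phi> x \<le> \<phi> y + \<eta> / 2 + L\<^sup>2 / (2 * \<eta>) * (norm (x - y))\<^sup>2" for x y
    proof -
      have "2 * \<eta> * (L * norm (x - y)) \<le> \<eta>\<^sup>2 + (L * norm (x - y))\<^sup>2"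
        using sum_squares_bound[of \<eta> "L * norm (x - y)"] by simp
      then have "L * norm (x - y) \<le> \<eta> / 2 + L\<^sup>2 / (2 * \<eta>) * (norm (x - y))\<^sup>2"
        using \<eta> by (simp add: field_simps power2_eq_square)
      then show ?thesis using L(2)[of x y] by simp
    qed
    have "(\<integral>\<^sup>+x. ennreal (\<phi> x) \<partial>\<mu>) = (\<integral>\<^sup>+q. ennreal (\<phi> (fst q)) \<partial>\<gamma>)"
      by (rule nn_integral_coupling_fst[OF \<gamma>, symmetric]) measurable
    also have "\<dots> \<le> (\<integral>\<^sup>+q. (ennreal (\<phi> (snd q)) + ennreal (\<eta> / 2)) +
        ennreal (L\<^sup>2 / (2 * \<eta>)) * (case q of (x, y) \<Rightarrow> ennreal ((norm (x - y))\<^sup>2)) \<partial>\<gamma>)"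
      using pt \<phi>0 \<eta> by (intro nn_integral_mono)
        (auto simp: ennreal_mult'[symmetric] ennreal_plus[symmetric] simp del: ennreal_plus intro!: ennreal_leI)
    also have "\<dots> = ((\<integral>\<^sup>+q. ennreal (\<phi> (snd q)) \<partial>\<gamma>) + ennreal (\<eta> / 2)) +
        ennreal (L\<^sup>2 / (2 * \<eta>)) * (\<integral>\<^sup>+ (x, y). ennreal ((norm (x - y))\<^sup>2) \<partial>\<gamma>)"
      by (simp add: nn_integral_add nn_integral_cmult \<gamma>.emeasure_space_1)
    also have "(\<integral>\<^sup>+q. ennreal (\<phi> (snd q)) \<partial>\<gamma>) = (\<integral>\<^sup>+x. ennreal (\<phi> x) \<partial>\<nu>)"
      by (rule nn_integral_coupling_snd[OF \<gamma>]) measurable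
    also have "ennreal (L\<^sup>2 / (2 * \<eta>)) * (\<integral>\<^sup>+ (x, y). ennreal ((norm (x - y))\<^sup>2) \<partial>\<gamma>)
      \<le> ennreal (L\<^sup>2 / (2 * \<eta>)) * ennreal (e\<^sup>2)"
      using cost by (intro mult_left_mono) auto
    also have "\<dots> \<le> ennreal (\<eta> / 2)"
    proof -
      have "(L * e)\<^sup>2 \<le> \<eta>\<^sup>2" using Le L e by (intro power_mono) auto
      then have "L\<^sup>2 / (2 * \<eta>) * e\<^sup>2 \<le> \<eta> / 2" using \<eta> by (simp add: field_simps power2_eq_square)
      then show ?thesis using \<eta> by (simp add: ennreal_mult[symmetric] ennreal_leI)
    qed
    finally have "(\<integral>\<^sup>+x. ennreal (\<phi> x) \<partial>\<mu>) \<le> (\<integral>\<^sup>+x. ennreal (\<phi> x) \<partial>\<nu>) + ennreal \<eta>"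
      using \<eta> by (simp add: add.assoc ennreal_plus[symmetric] del: ennreal_plus)
    with c\<eta> have "c + ennreal \<eta> < (\<integral>\<^sup>+x. ennreal (\<phi> x) \<partial>\<nu>) + ennreal \<eta>" by (rule less_le_trans)
    then have "ennreal \<eta> + c < ennreal \<eta> + (\<integral>\<^sup>+x. ennreal (\<phi> x) \<partial>\<nu>)" by (simp only: add.commute)
    then show ?thesis by (simp add: ennreal_add_left_cancel_less)
  qed
  then show "\<exists>e>0. \<forall>\<nu>\<in>P2. W2 \<mu> \<nu> < e \<longrightarrow> \<nu> \<in> {\<nu>\<in>P2. c < (\<integral>\<^sup>+x. ennreal (\<phi> x) \<partial>\<nu>)}"
    using e by auto
qed auto

lemma space_P2_borel: "space P2_borel = P2"
  by (auto simp: P2_borel_def W2_open_def intro!: space_measure_of)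

lemma W2_open_in_sets: "W2_open U \<Longrightarrow> U \<in> sets P2_borel"
  unfolding P2_borel_def
  by (subst sets_measure_of) (auto simp: W2_open_def)

text \<open>Truncating the norm at \<open>k\<close> makes its power bounded and, as
  \<open>p \<ge> 1\<close>, Lipschitz with constant \<open>p * real k powr (p - 1)\<close>. The
  truncated moments have open superlevel sets, and the moment is their supremum.\<close>

lemma moment_measurable:
  fixes p :: real
  assumes p: "1 \<le> p"
  shows "(moment p :: 'a::euclidean_space measure \<Rightarrow> ennreal) \<in> borel_measurable P2_borel"
proof -
  define \<phi> where "\<phi> k x = min (norm x) (real k) powr p" for k :: nat and x :: 'a
  have \<phi>_m[measurable]: "\<phi> k \<in> borel_measurable borel" for k unfolding \<phi>_def by measurable
  have "W2_open {\<nu>\<in>P2. c < (\<integral>\<^sup>+x. ennreal (\<phi> k x) \<partial>\<nu>)}" for k c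
  proof (rule W2_open_lipschitz_superlevel[of _ "real k powr p" "p * real k powr (p - 1)"])
    show "\<phi> k x \<le> real k powr p" for x unfolding \<phi>_def using p by (intro powr_mono2) auto
    fix x y :: 'a
    let ?a = "min (norm x) (real k)" and ?b = "min (norm y) (real k)"
    show "\<phi> k x - \<phi> k y \<le> p * real k powr (p - 1) * norm (x - y)"
    proof (cases "?b \<le> ?a")
      case True
      have "\<phi> k x - \<phi> k y \<le> p * ?a powr (p - 1) * (?a - ?b)"
        using powr_above_tangent[OF p, of ?a ?b] by (simp add: \<phi>_def algebra_simps)
      also have "\<dots> \<le> p * real k powr (p - 1) * norm (x - y)"
      proof (intro mult_mono mult_left_mono powr_mono2)
        show "?a - ?b \<le> norm (x - y)"
          using True norm_triangle_ineq2[of x y] norm_ge_zero[of "x - y"]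
          by (simp add: min_def split: if_splits)
      qed (use True p in auto)
      finally show ?thesis .
    next
      case False
      then have "\<phi> k x \<le> \<phi> k y" unfolding \<phi>_def using p by (intro powr_mono2) auto
      moreover have "0 \<le> p * real k powr (p - 1) * norm (x - y)" using p by simp
      ultimately show ?thesis by linarith
    qed
  qed (use p in \<open>auto simp: \<phi>_def\<close>)
  then have m: "(\<lambda>\<nu>. \<integral>\<^sup>+x. ennreal (\<phi> k x) \<partial>\<nu>) \<in> borel_measurable P2_borel" for k
    by (intro borel_measurableI_greater) (auto simp: space_P2_borel intro: W2_open_in_sets)
  have "moment p \<nu> = (SUP k. \<integral>\<^sup>+x. ennreal (\<phi> k x) \<partial>\<nu>)" if \<nu>: "\<nu> \<in> P2" for \<nu> :: "'a measure"
  proof -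
    have "(SUP k. ennreal (\<phi> k x)) = ennreal (norm x powr p)" for x
    proof (rule antisym)
      show "(SUP k. ennreal (\<phi> k x)) \<le> ennreal (norm x powr p)"
        unfolding \<phi>_def using p by (intro SUP_least ennreal_leI powr_mono2) auto
      obtain k :: nat where "norm x \<le> real k" using real_arch_simple by blast
      then have "\<phi> k x = norm x powr p" by (simp add: \<phi>_def min_absorb1)
      then show "ennreal (norm x powr p) \<le> (SUP k. ennreal (\<phi> k x))" by (metis SUP_upper UNIV_I)
    qed
    then have "moment p \<nu> = (\<integral>\<^sup>+x. (SUP k. ennreal (\<phi> k x)) \<partial>\<nu>)" by (simp add: moment_def)
    also have "\<dots> = (SUP k. \<integral>\<^sup>+x. ennreal (\<phi> k x) \<partial>\<nu>)"
    proof (rule nn_integral_monotone_convergence_SUP)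
      show "incseq (\<lambda>k x. ennreal (\<phi> k x))"
        using p by (auto simp: incseq_def le_fun_def \<phi>_def intro!: ennreal_leI powr_mono2)
      show "(\<lambda>x. ennreal (\<phi> k x)) \<in> borel_measurable \<nu>" for k
        by (simp add: measurable_cong_sets[OF P2D(2)[OF \<nu>] refl])
    qed
    finally show ?thesis .
  qed
  then have "(moment p :: 'a measure \<Rightarrow> ennreal) \<in> borel_measurable P2_borel \<longleftrightarrow>
      (\<lambda>\<nu>::'a measure. SUP k. \<integral>\<^sup>+x. ennreal (\<phi> k x) \<partial>\<nu>) \<in> borel_measurable P2_borel"
    by (intro measurable_cong) (simp add: space_P2_borel)
  then show ?thesis using m by simp
qed

section \<open>Entropy\<close>

text \<open>Young's inequality for the entropy function and the exponential. With
  \<open>a = (norm x)\<^sup>2\<close> it bounds the negative part of the entropy by the second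
  moment and a Gaussian integral.\<close>

lemma neg_entropy_le:
  fixes f a :: real
  assumes "0 \<le> f"
  shows "- (f * ln f) \<le> f * a + exp (- a)"
proof (cases "f = 0")
  case False
  then have f: "0 < f" using assms by simp
  have "ln (exp (- a) / f) \<le> exp (- a) / f - 1" using f by (intro ln_le_minus_one) simp
  then have "- a - ln f \<le> exp (- a) / f - 1" using f by (simp add: ln_div)
  then have "f * (- a - ln f) \<le> f * (exp (- a) / f - 1)" using f by (intro mult_left_mono) auto
  then show ?thesis using f by (simp add: algebra_simps)
qed simp

lemma nn_integral_gauss_finite:
  "(\<integral>\<^sup>+x. ennreal (exp (- (norm (x::'a::euclidean_space))\<^sup>2)) \<partial>lborel) < \<infinity>"
proof -
  have "(\<integral>\<^sup>+x. ennreal (exp (- (norm (x::'a))\<^sup>2)) \<partial>lborel)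
    = (\<integral>\<^sup>+x. ennreal (norm (x::'a) powr 0 * exp (- (norm x)\<^sup>2 / 1)) \<partial>lborel)"
    \<comment> \<open>The integrands differ at the origin, where \<open>0 powr 0\<close> is
      0.\<close>
    by (rule nn_integral_cong_AE) (use AE_lborel_singleton[of "0::'a"] in \<open>eventually_elim; simp\<close>)
  also have "\<dots> \<le> emeasure lborel (ball (0::'a) 1) *
       ennreal (1 powr ((real DIM('a) + 0) / 2) * Gamma ((real DIM('a) + 0) / 2 + 1))"
    by (rule nn_integral_norm_powr_gauss_le) auto
  also have "\<dots> < \<infinity>" using emeasure_ball[of 1 "0::'a"] by (simp add: ennreal_mult_less_top)
  finally show ?thesis .
qed

text \<open>An integrable majorant controls only the positive part. If the integral of the negative
  part is infinite, the entropy is minus infinity and the bound is trivial; otherwise the two parts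
  combine into one real integral.\<close>

lemma Ent_le:
  fixes f G :: "'a::euclidean_space \<Rightarrow> real"
  assumes f[measurable]: "f \<in> borel_measurable borel" and f0: "\<And>x. 0 \<le> f x"
    and \<rho>: "\<rho> = density lborel f" and \<Omega>[measurable]: "\<Omega> \<in> sets borel" and one: "emeasure \<rho> \<Omega> = 1"
    and G: "integrable lborel G" and le: "\<And>x. x \<in> \<Omega> \<Longrightarrow> f x * ln (f x) \<le> G x" and G0: "\<And>x. x \<notin> \<Omega> \<Longrightarrow> G x = 0"
  shows "Ent \<Omega> \<rho> \<le> ereal (integral\<^sup>L lborel G)"
proof -
  define g where "g x = indicator \<Omega> x * (f x * ln (f x))" for x
  have g_m[measurable]: "g \<in> borel_measurable borel" unfolding g_def by measurable
  have gG: "g x \<le> G x" for x using le[of x] G0[of x] by (auto simp: g_def indicator_def)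
  have ac: "absolutely_continuous lborel \<rho>" unfolding \<rho> by (rule absolutely_continuousI_density) simp
  have "AE x in lborel. ennreal (f x) = RN_deriv lborel \<rho> x"
    by (rule sigma_finite_measure.RN_deriv_unique[OF sigma_finite_lborel]) (simp_all add: \<rho>)
  then have RN: "AE x in lborel. enn2real (RN_deriv lborel \<rho> x) = f x"
    by eventually_elim (metis enn2real_ennreal f0)
  have P: "(\<integral>\<^sup>+x\<in>\<Omega>. ennreal (enn2real (RN_deriv lborel \<rho> x) * ln (enn2real (RN_deriv lborel \<rho> x))) \<partial>lborel)
      = (\<integral>\<^sup>+x. ennreal (g x) \<partial>lborel)"
    by (rule nn_integral_cong_AE) (use RN in \<open>eventually_elim; simp add: g_def indicator_def\<close>)
  have N: "(\<integral>\<^sup>+x\<in>\<Omega>. ennreal (- (enn2real (RN_deriv lborel \<rho> x) * ln (enn2real (RN_deriv lborel \<rho> x)))) \<partial>lborel)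
      = (\<integral>\<^sup>+x. ennreal (- g x) \<partial>lborel)"
    by (rule nn_integral_cong_AE) (use RN in \<open>eventually_elim; simp add: g_def indicator_def\<close>)
  have E: "Ent \<Omega> \<rho> = enn2ereal (\<integral>\<^sup>+x. ennreal (g x) \<partial>lborel) - enn2ereal (\<integral>\<^sup>+x. ennreal (- g x) \<partial>lborel)"
    unfolding Ent_def Let_def using ac one by (simp only: P N) simp
  have "(\<integral>\<^sup>+x. ennreal (g x) \<partial>lborel) \<le> (\<integral>\<^sup>+x. ennreal \<bar>G x\<bar> \<partial>lborel)"
    by (intro nn_integral_mono ennreal_leI) (use gG in \<open>force intro: order_trans[OF _ abs_ge_self]\<close>)
  also have "\<dots> < \<infinity>" using G by (simp add: integrable_iff_bounded)
  finally have Pf: "(\<integral>\<^sup>+x. ennreal (g x) \<partial>lborel) < \<infinity>" .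
  show ?thesis
  proof (cases "(\<integral>\<^sup>+x. ennreal (- g x) \<partial>lborel) = \<infinity>")
    case True
    obtain c where c: "0 \<le> c" "(\<integral>\<^sup>+x. ennreal (g x) \<partial>lborel) = ennreal c" using Pf by (auto simp: less_top_ennreal)
    show ?thesis unfolding E True c by (simp add: c)
  next
    case False
    then have gi: "integrable lborel g" using Pf by (intro real_integrable_def[THEN iffD2]) (auto simp: less_top)
    obtain c where c: "0 \<le> c" "(\<integral>\<^sup>+x. ennreal (g x) \<partial>lborel) = ennreal c" using Pf by (auto simp: less_top_ennreal)
    obtain d where d: "0 \<le> d" "(\<integral>\<^sup>+x. ennreal (- g x) \<partial>lborel) = ennreal d"
      using False by (auto simp: less_top less_top_ennreal)
    have "integral\<^sup>L lborel g = c - d"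
      unfolding real_lebesgue_integral_def[OF gi] c(2) d(2) using c d by simp
    then have "Ent \<Omega> \<rho> = ereal (integral\<^sup>L lborel g)" unfolding E c(2) d(2) using c d by simp
    also have "\<dots> \<le> ereal (integral\<^sup>L lborel G)" using gi G gG by (simp add: integral_mono)
    finally show ?thesis .
  qed
qed

text \<open>The assumption excludes plus infinity; it is the finite second moment that excludes
  minus infinity, through \<open>neg_entropy_le\<close> with
  \<open>a = (norm x)\<^sup>2\<close>.\<close>

lemma Ent_finiteD:
  fixes \<rho> :: "'a::euclidean_space measure"
  assumes \<rho>: "\<rho> \<in> P2" and fin: "Ent \<Omega> \<rho> < \<infinity>" and \<Omega>[measurable]: "\<Omega> \<in> sets borel"
  obtains f where "f \<in> borel_measurable borel" "\<And>x. 0 \<le> f x" "\<rho> = density lborel (\<lambda>x. ennreal (f x))"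
    "emeasure \<rho> \<Omega> = 1" "integrable lborel (\<lambda>x. indicator \<Omega> x * (f x * ln (f x)))"
    "Ent \<Omega> \<rho> = ereal (\<integral>x. indicator \<Omega> x * (f x * ln (f x)) \<partial>lborel)"
proof -
  interpret prob_space \<rho> by (rule P2D[OF \<rho>])
  have ac: "absolutely_continuous lborel \<rho>" and one: "emeasure \<rho> \<Omega> = 1"
    using fin by (auto simp: Ent_def split: if_splits)
  define f where "f x = enn2real (RN_deriv lborel \<rho> x)" for x
  have f_m[measurable]: "f \<in> borel_measurable borel" unfolding f_def by simp
  have f0: "0 \<le> f x" for x by (simp add: f_def)
  have s: "sets \<rho> = sets lborel" using P2D[OF \<rho>] by simp
  have "AE x in lborel. RN_deriv lborel \<rho> x \<noteq> \<infinity>"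
    by (rule sigma_finite_measure.RN_deriv_finite[OF sigma_finite_lborel _ ac s]) (rule sigma_finite_measure_axioms)
  then have "AE x in lborel. RN_deriv lborel \<rho> x = ennreal (f x)"
    by eventually_elim (simp add: f_def less_top)
  then have "density lborel (RN_deriv lborel \<rho>) = density lborel (\<lambda>x. ennreal (f x))"
    by (intro density_cong) auto
  then have \<rho>f: "\<rho> = density lborel (\<lambda>x. ennreal (f x))" using sigma_finite_measure.density_RN_deriv[OF sigma_finite_lborel ac s] by simp
  define g where "g x = indicator \<Omega> x * (f x * ln (f x))" for x
  have g_m[measurable]: "g \<in> borel_measurable borel" unfolding g_def by measurable
  have P: "(\<integral>\<^sup>+x\<in>\<Omega>. ennreal (f x * ln (f x)) \<partial>lborel) = (\<integral>\<^sup>+x. ennreal (g x) \<partial>lborel)"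
    and N: "(\<integral>\<^sup>+x\<in>\<Omega>. ennreal (- (f x * ln (f x))) \<partial>lborel) = (\<integral>\<^sup>+x. ennreal (- g x) \<partial>lborel)"
    by (auto intro!: nn_integral_cong simp: g_def indicator_def)
  have E: "Ent \<Omega> \<rho> = enn2ereal (\<integral>\<^sup>+x. ennreal (g x) \<partial>lborel) - enn2ereal (\<integral>\<^sup>+x. ennreal (- g x) \<partial>lborel)"
    unfolding Ent_def Let_def f_def[symmetric] using ac one by (simp only: P N) simp
  have "(\<integral>\<^sup>+x. ennreal (- g x) \<partial>lborel) \<le>
      (\<integral>\<^sup>+x. ennreal (f x) * ennreal ((norm x)\<^sup>2) + ennreal (exp (- (norm x)\<^sup>2)) \<partial>lborel)"
    using f0 neg_entropy_le[OF f0]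
    by (intro nn_integral_mono)
      (auto simp: g_def indicator_def ennreal_mult[symmetric] ennreal_plus[symmetric] simp del: ennreal_plus intro!: ennreal_leI)
  also have "\<dots> = moment 2 \<rho> + (\<integral>\<^sup>+x. ennreal (exp (- (norm (x::'a))\<^sup>2)) \<partial>lborel)"
    by (simp add: nn_integral_add moment_2 \<rho>f nn_integral_density)
  also have "\<dots> < \<infinity>" using P2D(4)[OF \<rho>] nn_integral_gauss_finite[where 'a='a] by simp
  finally obtain d where d: "0 \<le> d" "(\<integral>\<^sup>+x. ennreal (- g x) \<partial>lborel) = ennreal d" by (auto simp: less_top_ennreal)
  have "(\<integral>\<^sup>+x. ennreal (g x) \<partial>lborel) \<noteq> \<infinity>" using fin unfolding E d by (auto simp: d(1))
  then obtain c where c: "0 \<le> c" "(\<integral>\<^sup>+x. ennreal (g x) \<partial>lborel) = ennreal c"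
    by (auto simp: less_top less_top_ennreal)
  have gi: "integrable lborel g" by (intro real_integrable_def[THEN iffD2]) (auto simp: c d)
  have "integral\<^sup>L lborel g = c - d"
    unfolding real_lebesgue_integral_def[OF gi] c(2) d(2) using c d by simp
  then have "Ent \<Omega> \<rho> = ereal (integral\<^sup>L lborel g)" unfolding E c(2) d(2) using c d by simp
  then show thesis using that[of f] f0 \<rho>f one gi by (simp add: g_def[abs_def])
qed

section \<open>Resampling\<close>

text \<open>For probability measures this is the law of \<open>x\<close> drawn from
  \<open>\<rho>\<close> and replaced, if it falls in \<open>B\<close>, by an independent draw from
  \<open>u\<close>. As an image of a product it has total mass 1 without any normalization, and the
  same replacement can be applied to couplings.\<close>

definition resample :: "'a measure \<Rightarrow> 'a set \<Rightarrow> 'a measure \<Rightarrow> 'a::euclidean_space measure" where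
  "resample \<rho> B u = distr (\<rho> \<Otimes>\<^sub>M u) borel (\<lambda>(x, x'). if x \<in> B then x' else x)"

lemma nn_integral_resample:
  assumes \<rho>: "sets \<rho> = sets borel" and u: "prob_space u" "sets u = sets borel"
    and B[measurable]: "B \<in> sets borel" and g[measurable]: "g \<in> borel_measurable borel"
  shows "(\<integral>\<^sup>+x. g x \<partial>resample \<rho> B u) = (\<integral>\<^sup>+x. (if x \<in> B then \<integral>\<^sup>+x'. g x' \<partial>u else g x) \<partial>\<rho>)"
proof -
  interpret u: prob_space u by fact
  note [measurable_cong] = \<rho> u(2)
  have "(\<integral>\<^sup>+x. g x \<partial>resample \<rho> B u) = (\<integral>\<^sup>+q. g (if fst q \<in> B then snd q else fst q) \<partial>(\<rho> \<Otimes>\<^sub>M u))"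
    unfolding resample_def by (subst nn_integral_distr) (auto simp: case_prod_beta)
  also have "\<dots> = (\<integral>\<^sup>+x. \<integral>\<^sup>+x'. g (if x \<in> B then x' else x) \<partial>u \<partial>\<rho>)"
    by (subst u.nn_integral_fst[symmetric]) (auto cong: if_cong)
  also have "\<dots> = (\<integral>\<^sup>+x. (if x \<in> B then \<integral>\<^sup>+x'. g x' \<partial>u else g x) \<partial>\<rho>)"
    by (intro nn_integral_cong) (auto simp: u.emeasure_space_1)
  finally show ?thesis .
qed

lemma prob_space_resample:
  assumes "prob_space \<rho>" "sets \<rho> = sets borel" "prob_space u" "sets u = sets borel" "B \<in> sets borel"
  shows "prob_space (resample \<rho> B u)"
proof -
  interpret A: prob_space \<rho> by fact
  interpret B: prob_space u by fact
  interpret pair_prob_space \<rho> u ..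
  note [measurable_cong] = assms(2,4) and [measurable] = assms(5)
  show ?thesis unfolding resample_def by (rule prob_space_distr) measurable
qed

lemma resample_in_P2:
  assumes \<rho>: "\<rho> \<in> P2" and u: "u \<in> P2" and B[measurable]: "B \<in> sets borel"
  shows "resample \<rho> B u \<in> P2"
proof -
  have "moment 2 (resample \<rho> B u) = (\<integral>\<^sup>+x. (if x \<in> B then moment 2 u else ennreal ((norm x)\<^sup>2)) \<partial>\<rho>)"
    unfolding moment_2 using P2D[OF \<rho>] P2D[OF u] by (intro nn_integral_resample) auto
  also have "\<dots> \<le> (\<integral>\<^sup>+x. moment 2 u + ennreal ((norm x)\<^sup>2) \<partial>\<rho>)" by (intro nn_integral_mono) auto
  also have "\<dots> = moment 2 u + moment 2 \<rho>"
    using prob_space.emeasure_space_1[OF P2D(1)[OF \<rho>]]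
    by (simp add: nn_integral_add moment_2[of \<rho>] measurable_cong_sets[OF P2D(2)[OF \<rho>] refl])
  also have "\<dots> < \<infinity>" using P2D(4)[OF \<rho>] P2D(4)[OF u] by simp
  finally show ?thesis
    using prob_space_resample[OF P2D(1,2)[OF \<rho>] P2D(1,2)[OF u] B] by (auto simp: P2_def resample_def)
qed

text \<open>Replacing the first component of \<open>\<gamma>\<close> by the independent draw from
  \<open>u\<close>, whenever it lies in \<open>B\<close>, and leaving the second alone gives a
  coupling of the resampled measure and \<open>\<nu>\<close>, whose cost is the right-hand
  side.\<close>

lemma W2_sq_resample_le:
  assumes \<rho>: "\<rho> \<in> P2" and u: "u \<in> P2" and B[measurable]: "B \<in> sets borel"
    and \<gamma>: "\<gamma> \<in> couplings \<rho> \<nu>"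
  shows "W2_sq (resample \<rho> B u) \<nu> \<le>
    (\<integral>\<^sup>+(x, y). (if x \<in> B then \<integral>\<^sup>+x'. ennreal ((norm (x' - y))\<^sup>2) \<partial>u else ennreal ((norm (x - y))\<^sup>2)) \<partial>\<gamma>)"
proof -
  interpret u: prob_space u by (rule P2D[OF u])
  interpret \<gamma>: prob_space \<gamma> by (rule couplingsD[OF \<gamma>])
  interpret gu: pair_prob_space \<gamma> u ..
  note [measurable_cong] = couplingsD(2)[OF \<gamma>] P2D(2)[OF u]
  define T where "T = (\<lambda>p. (if fst (fst p) \<in> B then snd p else fst (fst p), snd (fst p) :: 'a))"
  have T[measurable]: "T \<in> (borel \<Otimes>\<^sub>M borel) \<Otimes>\<^sub>M borel \<rightarrow>\<^sub>M borel \<Otimes>\<^sub>M borel"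
    unfolding T_def by measurable
  define \<gamma>' where "\<gamma>' = distr (\<gamma> \<Otimes>\<^sub>M u) (borel \<Otimes>\<^sub>M borel) T"
  have T'[measurable]: "T \<in> \<gamma> \<Otimes>\<^sub>M u \<rightarrow>\<^sub>M borel \<Otimes>\<^sub>M borel" by measurable
  have int: "(\<integral>\<^sup>+q. g q \<partial>\<gamma>') = (\<integral>\<^sup>+q. \<integral>\<^sup>+x'. g (T (q, x')) \<partial>u \<partial>\<gamma>)"
    if g[measurable]: "g \<in> borel_measurable (borel \<Otimes>\<^sub>M borel)" for g :: "'a \<times> 'a \<Rightarrow> ennreal"
  proof -
    have "(\<lambda>p. g (T p)) \<in> borel_measurable (\<gamma> \<Otimes>\<^sub>M u)" by measurable
    from u.nn_integral_fst[OF this] show ?thesis unfolding \<gamma>'_def using g by (simp add: nn_integral_distr)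
  qed
  have "distr \<gamma>' borel fst = resample \<rho> B u"
  proof (rule measure_eqI)
    fix A assume "A \<in> sets (distr \<gamma>' borel fst)"
    then have A[measurable]: "A \<in> sets borel" by simp
    have "emeasure (distr \<gamma>' borel fst) A = (\<integral>\<^sup>+q. indicator A (fst q) \<partial>\<gamma>')"
      by (subst nn_integral_indicator[symmetric], simp, subst nn_integral_distr) (auto simp: \<gamma>'_def)
    also have "\<dots> = (\<integral>\<^sup>+q. \<integral>\<^sup>+x'. indicator A (fst (T (q, x'))) \<partial>u \<partial>\<gamma>)" by (rule int) measurable
    also have "\<dots> = (\<integral>\<^sup>+q. (if fst q \<in> B then \<integral>\<^sup>+x'. indicator A x' \<partial>u else indicator A (fst q)) \<partial>\<gamma>)"
      by (intro nn_integral_cong) (auto simp: T_def case_prod_beta u.emeasure_space_1 cong del: if_cong)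
    also have "\<dots> = (\<integral>\<^sup>+x. (if x \<in> B then \<integral>\<^sup>+x'. indicator A x' \<partial>u else indicator A x) \<partial>\<rho>)"
      by (rule nn_integral_coupling_fst[OF \<gamma>]) measurable
    also have "\<dots> = (\<integral>\<^sup>+x. indicator A x \<partial>resample \<rho> B u)"
      using P2D[OF \<rho>] P2D[OF u] by (intro nn_integral_resample[symmetric]) auto
    also have "\<dots> = emeasure (resample \<rho> B u) A" by (simp add: resample_def)
    finally show "emeasure (distr \<gamma>' borel fst) A = emeasure (resample \<rho> B u) A" .
  qed (simp add: resample_def)
  moreover have "distr \<gamma>' borel snd = \<nu>"
  proof (rule measure_eqI)
    show "sets (distr \<gamma>' borel snd) = sets \<nu>"
      using couplingsD(4)[OF \<gamma>] by (metis sets_distr)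
    fix A assume "A \<in> sets (distr \<gamma>' borel snd)"
    then have A[measurable]: "A \<in> sets borel" by simp
    have "emeasure (distr \<gamma>' borel snd) A = (\<integral>\<^sup>+q. indicator A (snd q) \<partial>\<gamma>')"
      by (subst nn_integral_indicator[symmetric], simp, subst nn_integral_distr) (auto simp: \<gamma>'_def)
    also have "\<dots> = (\<integral>\<^sup>+q. \<integral>\<^sup>+x'. indicator A (snd (T (q, x'))) \<partial>u \<partial>\<gamma>)" by (rule int) measurable
    also have "\<dots> = (\<integral>\<^sup>+q. indicator A (snd q) \<partial>\<gamma>)"
      by (intro nn_integral_cong) (auto simp: T_def case_prod_beta u.emeasure_space_1)
    also have "\<dots> = (\<integral>\<^sup>+y. indicator A y \<partial>\<nu>)" by (rule nn_integral_coupling_snd[OF \<gamma>]) measurable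
    also have "\<dots> = emeasure \<nu> A" using couplingsD(4)[OF \<gamma>] A by (intro nn_integral_indicator) (metis sets_distr)
    finally show "emeasure (distr \<gamma>' borel snd) A = emeasure \<nu> A" .
  qed
  ultimately have "\<gamma>' \<in> couplings (resample \<rho> B u) \<nu>"
    using gu.prob_space_distr[OF T'] by (simp add: couplings_def \<gamma>'_def)
  then have "W2_sq (resample \<rho> B u) \<nu> \<le> (\<integral>\<^sup>+(x, y). ennreal ((norm (x - y))\<^sup>2) \<partial>\<gamma>')"
    unfolding W2_sq_def by (rule INF_lower)
  also have "\<dots> = (\<integral>\<^sup>+q. \<integral>\<^sup>+x'. (case T (q, x') of (x, y) \<Rightarrow> ennreal ((norm (x - y))\<^sup>2)) \<partial>u \<partial>\<gamma>)"
    by (rule int) measurable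
  also have "\<dots> = (\<integral>\<^sup>+(x, y). (if x \<in> B then \<integral>\<^sup>+x'. ennreal ((norm (x' - y))\<^sup>2) \<partial>u else ennreal ((norm (x - y))\<^sup>2)) \<partial>\<gamma>)"
    by (intro nn_integral_cong) (auto simp: T_def case_prod_beta u.emeasure_space_1)
  finally show ?thesis .
qed

lemma uniform_measure_density:
  assumes K[measurable]: "K \<in> sets lborel" and pos: "0 < measure lborel K" and fin: "emeasure lborel K < \<infinity>"
  shows "uniform_measure lborel K = density lborel (\<lambda>x. ennreal (indicator K x / measure lborel K))"
proof -
  have "emeasure lborel K = ennreal (measure lborel K)"
    using fin by (simp add: emeasure_eq_ennreal_measure less_top)
  then have "indicator K x / emeasure lborel K = ennreal (indicator K x / measure lborel K)" for x
    using pos by (simp add: divide_ennreal[symmetric] indicator_def)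
  then show ?thesis by (simp add: uniform_measure_def)
qed

lemma uniform_measure_in_P2:
  assumes K[measurable]: "K \<in> sets borel" and pos: "0 < measure lborel K" and r: "K \<subseteq> ball (0::'a::euclidean_space) r"
  shows "uniform_measure lborel K \<in> P2"
    "(\<integral>\<^sup>+x. ennreal ((norm (x - y))\<^sup>2) \<partial>uniform_measure lborel K) \<le> ennreal ((r + norm y)\<^sup>2)"
proof -
  have Kpos: "emeasure lborel K \<noteq> 0" using pos by (auto simp: measure_def)
  have Kfin: "emeasure lborel K \<noteq> \<infinity>" using pos by (auto simp: measure_def)
  interpret u: prob_space "uniform_measure lborel K"
    by (rule prob_space_uniform_measure[OF Kpos Kfin])
  have bound: "(\<integral>\<^sup>+x. ennreal ((norm (x - y))\<^sup>2) \<partial>uniform_measure lborel K) \<le> ennreal ((r + norm y)\<^sup>2)" for y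
  proof -
    have "AE x in uniform_measure lborel K. x \<in> K"
      using AE_uniform_measureI[of K lborel "\<lambda>x. x \<in> K"] by simp
    then have "(\<integral>\<^sup>+x. ennreal ((norm (x - y))\<^sup>2) \<partial>uniform_measure lborel K)
      \<le> (\<integral>\<^sup>+x. ennreal ((r + norm y)\<^sup>2) \<partial>uniform_measure lborel K)"
    proof (intro nn_integral_mono_AE, eventually_elim)
      case (elim x)
      then have "norm (x - y) \<le> r + norm y" using r norm_triangle_ineq4[of x y] by auto
      then show ?case by (intro ennreal_leI power_mono) auto
    qed
    then show ?thesis using u.emeasure_space_1 by simp
  qed
  then show "(\<integral>\<^sup>+x. ennreal ((norm (x - y))\<^sup>2) \<partial>uniform_measure lborel K) \<le> ennreal ((r + norm y)\<^sup>2)" .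
  have "moment 2 (uniform_measure lborel K) < \<infinity>"
    unfolding moment_2 using bound[of 0] by (auto intro: le_less_trans)
  then show "uniform_measure lborel K \<in> P2" using u.prob_space_axioms by (simp add: P2_def)
qed

lemma resample_density:
  fixes f :: "'a::euclidean_space \<Rightarrow> real"
  assumes f[measurable]: "f \<in> borel_measurable borel" and f0: "\<And>x. 0 \<le> f x"
    and \<rho>: "\<rho> = density lborel (\<lambda>x. ennreal (f x))" and p: "prob_space \<rho>"
    and K[measurable]: "K \<in> sets borel" and pos: "0 < measure lborel K"
    and B[measurable]: "B \<in> sets borel"
  shows "resample \<rho> B (uniform_measure lborel K) =
    density lborel (\<lambda>x. ennreal (f x * indicator (- B) x + measure \<rho> B / measure lborel K * indicator K x))"
    (is "?l = ?r")
proof (rule measure_eqI)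
  interpret prob_space \<rho> by fact
  have Kpos: "emeasure lborel K \<noteq> 0" using pos by (auto simp: measure_def)
  have Kfin: "emeasure lborel K \<noteq> \<infinity>" using pos by (auto simp: measure_def)
  let ?u = "uniform_measure lborel K"
  interpret u: prob_space ?u by (rule prob_space_uniform_measure[OF Kpos Kfin])
  fix A assume "A \<in> sets ?l"
  then have A[measurable]: "A \<in> sets borel" by (simp add: resample_def)
  have "emeasure ?l A = (\<integral>\<^sup>+x. indicator A x \<partial>?l)" by (simp add: resample_def)
  also have "\<dots> = (\<integral>\<^sup>+x. (if x \<in> B then \<integral>\<^sup>+x'. indicator A x' \<partial>?u else indicator A x) \<partial>\<rho>)"
    by (rule nn_integral_resample) (auto simp: \<rho> u.prob_space_axioms)
  also have "(\<integral>\<^sup>+x'. indicator A x' \<partial>?u) = emeasure ?u A" by (rule nn_integral_indicator) simp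
  also have "(\<integral>\<^sup>+x. (if x \<in> B then emeasure ?u A else indicator A x) \<partial>\<rho>)
    = (\<integral>\<^sup>+x. emeasure ?u A * indicator B x + indicator (A - B) x \<partial>\<rho>)"
    by (intro nn_integral_cong) (auto simp: indicator_def)
  also have "\<dots> = emeasure ?u A * emeasure \<rho> B + emeasure \<rho> (A - B)"
    by (subst nn_integral_add) (auto simp: nn_integral_cmult_indicator \<rho>)
  also have "emeasure \<rho> (A - B) = (\<integral>\<^sup>+x. ennreal (f x * indicator (- B) x) * indicator A x \<partial>lborel)"
    unfolding \<rho> by (subst emeasure_density) (auto intro!: nn_integral_cong simp: indicator_def)
  also have "emeasure ?u A * emeasure \<rho> B = (\<integral>\<^sup>+x. ennreal (measure \<rho> B / measure lborel K * indicator K x) * indicator A x \<partial>lborel)"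
  proof -
    have "emeasure ?u A = (\<integral>\<^sup>+x. ennreal (indicator K x / measure lborel K) * indicator A x \<partial>lborel)"
      using uniform_measure_density[of K] pos Kfin by (simp add: emeasure_density less_top)
    then have "emeasure ?u A * emeasure \<rho> B = (\<integral>\<^sup>+x. ennreal (measure \<rho> B) * (ennreal (indicator K x / measure lborel K) * indicator A x) \<partial>lborel)"
      by (subst nn_integral_cmult) (auto simp: emeasure_eq_measure mult.commute)
    also have "\<dots> = (\<integral>\<^sup>+x. ennreal (measure \<rho> B / measure lborel K * indicator K x) * indicator A x \<partial>lborel)"
      by (intro nn_integral_cong) (auto simp: indicator_def ennreal_mult[symmetric])
    finally show ?thesis .
  qed
  also have "(\<integral>\<^sup>+x. ennreal (measure \<rho> B / measure lborel K * indicator K x) * indicator A x \<partial>lborel) +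
      (\<integral>\<^sup>+x. ennreal (f x * indicator (- B) x) * indicator A x \<partial>lborel)
    = (\<integral>\<^sup>+x. ennreal (f x * indicator (- B) x + measure \<rho> B / measure lborel K * indicator K x) * indicator A x \<partial>lborel)"
    using f0 by (subst nn_integral_add[symmetric])
      (auto intro!: nn_integral_cong simp: indicator_def)
  also have "\<dots> = emeasure ?r A" by (simp add: emeasure_density)
  finally show "emeasure ?l A = emeasure ?r A" .
qed (simp add: resample_def)

section \<open>Averaged couplings\<close>

text \<open>\<open>s\<close> plays the role of the conditional expectation of \<open>norm y\<close> given \<open>x\<close> under an average over
  \<open>P\<close> of optimal couplings of \<open>\<rho>\<close> and \<open>\<nu>\<close>; no such average is constructed.\<close>

theorem exists_averaged_coupling_norm:
  fixes \<rho> :: "'a::euclidean_space measure" and P :: "'a measure measure"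
  assumes \<rho>: "\<rho> \<in> P2" and P: "prob_space P" "sets P = sets P2_borel"
    and m2: "(\<integral>\<^sup>+\<nu>. moment 2 \<nu> \<partial>P) < \<infinity>"
  obtains s where "s \<in> borel_measurable borel" "\<And>x. 0 \<le> s x"
    "\<And>p. 1 \<le> p \<Longrightarrow> (\<integral>\<^sup>+x. ennreal (s x powr p) \<partial>\<rho>) \<le> (\<integral>\<^sup>+\<nu>. moment p \<nu> \<partial>P)"
    "\<And>B R r u. B \<in> sets borel \<Longrightarrow> B \<subseteq> ball 0 R \<Longrightarrow> u \<in> P2 \<Longrightarrow> 0 \<le> r \<Longrightarrow>
       (\<And>y. (\<integral>\<^sup>+x. ennreal ((norm (x - y))\<^sup>2) \<partial>u) \<le> ennreal ((r + norm y)\<^sup>2)) \<Longrightarrow>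
       enn2real (\<integral>\<^sup>+\<nu>. W2_sq (resample \<rho> B u) \<nu> \<partial>P) \<le> enn2real (\<integral>\<^sup>+\<nu>. W2_sq \<rho> \<nu> \<partial>P) +
         (\<integral>x. indicator B x * (r\<^sup>2 - (norm x)\<^sup>2) \<partial>\<rho>) + (\<integral>x. 2 * indicator B x * (norm x + r) * s x \<partial>\<rho>)"
proof -
  interpret P: prob_space P by fact
  interpret \<rho>: prob_space \<rho> by (rule P2D[OF \<rho>])
  note [measurable_cong] = P2D(2)[OF \<rho>]
  have spP: "space P = P2" using sets_eq_imp_space_eq[OF P(2)] by (simp add: space_P2_borel)
  have mom_m: "moment p \<in> borel_measurable P" if "1 \<le> p" for p
    using moment_measurable[OF that] measurable_cong_sets[OF P(2) refl] by blast
  define m where "m \<nu> = enn2real (moment 2 \<nu>)" for \<nu> :: "'a measure"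
  have m: "moment 2 \<nu> = ennreal (m \<nu>)" if "\<nu> \<in> P2" for \<nu>
    using P2D(4)[OF that] by (simp add: m_def)
  have m0: "0 \<le> m \<nu>" for \<nu> by (simp add: m_def)
  have m_m[measurable]: "m \<in> borel_measurable P" using mom_m[of 2] unfolding m_def by measurable
  have m_int: "integrable P m"
  proof (rule integrableI_nonneg)
    have "(\<integral>\<^sup>+\<nu>. ennreal (m \<nu>) \<partial>P) = (\<integral>\<^sup>+\<nu>. moment 2 \<nu> \<partial>P)"
      by (rule nn_integral_cong) (simp add: m spP)
    then show "(\<integral>\<^sup>+\<nu>. ennreal (m \<nu>) \<partial>P) < \<infinity>" using m2 by simp
  qed (auto simp: m0)
  \<comment> \<open>The summand 1 lets \<open>w\<close> dominate constants, such as the term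
    \<open>2 * m \<mu>\<close> in the bound on the cost, and first moments.\<close>
  define w where "w \<nu> = 1 + m \<nu>" for \<nu>
  have w: "integrable P w" unfolding w_def using m_int by simp
  have w1: "1 \<le> w \<nu>" "m \<nu> \<le> w \<nu>" for \<nu> using m0[of \<nu>] by (auto simp: w_def)
  let ?V = "dominated_by P w"
  note V = fun_subspace_dominated_by[of P w]
  have VI: "f \<in> ?V" if "\<And>\<nu> n. \<nu> \<in> P2 \<Longrightarrow> \<bar>f (\<nu>, n)\<bar> \<le> C * w \<nu>" for f C
    unfolding dominated_by_def using that by (auto simp: spP)

  \<comment> \<open>The transport cost as a dominated real function\<close>
  define W where "W \<mu> \<nu> = enn2real (W2_sq \<mu> \<nu>)" for \<mu> \<nu> :: "'a measure"
  have W: "W2_sq \<mu> \<nu> = ennreal (W \<mu> \<nu>)" if "\<mu> \<in> P2" "\<nu> \<in> P2" for \<mu> \<nu>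
    using W2_sq_finite[OF that] by (simp add: W_def)
  have W0: "0 \<le> W \<mu> \<nu>" for \<mu> \<nu> by (simp add: W_def)
  have Wle: "W \<mu> \<nu> \<le> 2 * m \<mu> + 2 * m \<nu>" if "\<mu> \<in> P2" "\<nu> \<in> P2" for \<mu> \<nu>
  proof -
    have "ennreal (W \<mu> \<nu>) \<le> ennreal (2 * m \<mu> + 2 * m \<nu>)"
      using W2_sq_le_moments[OF that] m0[of \<mu>] m0[of \<nu>]
      by (simp add: W[OF that] m[OF that(1)] m[OF that(2)] ennreal_mult)
    then show ?thesis using m0[of \<mu>] m0[of \<nu>] by (subst (asm) ennreal_le_iff) auto
  qed
  have WV: "(\<lambda>(\<nu>, n). W \<mu> \<nu>) \<in> ?V" if "\<mu> \<in> P2" for \<mu>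
  proof (rule VI)
    fix \<nu> :: "'a measure" and n :: nat assume "\<nu> \<in> P2"
    then have "W \<mu> \<nu> \<le> 2 * m \<mu> + 2 * m \<nu>" by (rule Wle[OF that])
    also have "\<dots> \<le> (2 * m \<mu> + 2) * w \<nu>"
      using m0[of \<mu>] m0[of \<nu>] by (simp add: w_def algebra_simps)
    finally show "\<bar>(\<lambda>(\<nu>, n). W \<mu> \<nu>) (\<nu>, n)\<bar> \<le> (2 * m \<mu> + 2) * w \<nu>" using W0 by simp
  qed
  have WP: "(\<integral>\<^sup>+\<nu>. W2_sq \<mu> \<nu> \<partial>P) = (\<integral>\<^sup>+\<nu>. ennreal (W \<mu> \<nu>) \<partial>P)" if "\<mu> \<in> P2" for \<mu>
    by (rule nn_integral_cong) (simp add: spP W that)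
  have Wfin: "(\<integral>\<^sup>+\<nu>. ennreal (W \<mu> \<nu>) \<partial>P) < \<infinity>" if "\<mu> \<in> P2" for \<mu>
  proof -
    have "(\<integral>\<^sup>+\<nu>. ennreal (W \<mu> \<nu>) \<partial>P) \<le> (\<integral>\<^sup>+\<nu>. ennreal (2 * m \<mu> + 2 * m \<nu>) \<partial>P)"
      by (intro nn_integral_mono ennreal_leI Wle that) (simp add: spP)
    also have "\<dots> < \<infinity>"
      using integrable_iff_bounded[of P "\<lambda>\<nu>. 2 * m \<mu> + 2 * m \<nu>"] m_int m0 by simp
    finally show ?thesis .
  qed

  \<comment> \<open>The generalized integral of the transport cost\<close>
  obtain L where L: "linear_functional_on ?V L"
    and L_le: "\<And>f g N. f \<in> ?V \<Longrightarrow> integrable P g \<Longrightarrow> AE \<nu> in P. \<forall>n\<ge>N. f (\<nu>, n) \<le> g \<nu> \<Longrightarrow>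
       L f \<le> integral\<^sup>L P g"
    and L_W: "\<And>c. (\<And>g. integrable P g \<Longrightarrow> AE \<nu> in P. g \<nu> \<le> W \<rho> \<nu> \<Longrightarrow> integral\<^sup>L P g \<le> c) \<Longrightarrow>
       L (\<lambda>(\<nu>, n). W \<rho> \<nu>) \<le> c"
    using exists_generalized_integral[OF w WV[OF \<rho>]] by blast
  \<comment> \<open>Here the prescribed value is used: it is at most any common bound of the
    integrals of integrable minorants, and monotonicity of \<open>nn_integral\<close>, valid without
    measurability, provides such a bound.\<close>
  have L_upper: "L (\<lambda>(\<nu>, n). W \<rho> \<nu>) \<le> enn2real (\<integral>\<^sup>+\<nu>. W2_sq \<rho> \<nu> \<partial>P)"
  proof (rule L_W)
    fix g assume g: "integrable P g" and le: "AE \<nu> in P. g \<nu> \<le> W \<rho> \<nu>"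
    have "integral\<^sup>L P g \<le> enn2real (\<integral>\<^sup>+\<nu>. ennreal (g \<nu>) \<partial>P)"
      using real_lebesgue_integral_def[OF g] by simp
    also have "\<dots> \<le> enn2real (\<integral>\<^sup>+\<nu>. ennreal (W \<rho> \<nu>) \<partial>P)"
      by (rule enn2real_mono[OF nn_integral_mono_AE]) (use le Wfin[OF \<rho>] in \<open>auto intro: ennreal_leI\<close>)
    finally show "integral\<^sup>L P g \<le> enn2real (\<integral>\<^sup>+\<nu>. W2_sq \<rho> \<nu> \<partial>P)" by (simp add: WP[OF \<rho>])
  qed
  \<comment> \<open>By definition \<open>nn_integral\<close> is a supremum over simple functions
    below \<open>W \<mu>\<close>, and a minorant \<open>g\<close> gives the integrable majorant
    \<open>- g\<close> of \<open>- W \<mu>\<close>. Domination of \<open>L\<close> by the upper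
    integral suffices, so this works for every \<open>\<mu>\<close> in \<open>P2\<close>.\<close>
  have L_lower: "enn2real (\<integral>\<^sup>+\<nu>. W2_sq \<mu> \<nu> \<partial>P) \<le> L (\<lambda>(\<nu>, n). W \<mu> \<nu>)" if \<mu>: "\<mu> \<in> P2" for \<mu>
  proof -
    have simp_le: "integral\<^sup>S P g \<le> ennreal (L (\<lambda>(\<nu>, n). W \<mu> \<nu>)) \<and> 0 \<le> L (\<lambda>(\<nu>, n). W \<mu> \<nu>)"
      if g: "simple_function P g" "g \<le> (\<lambda>\<nu>. ennreal (W \<mu> \<nu>))" for g
    proof -
      have g_m[measurable]: "g \<in> borel_measurable P" by (rule borel_measurable_simple_function[OF g(1)])
      have gle: "g \<nu> \<le> ennreal (W \<mu> \<nu>)" for \<nu> using g(2) by (simp add: le_fun_def)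
      then have gr: "g \<nu> = ennreal (enn2real (g \<nu>))" for \<nu>
        by (metis ennreal_enn2real ennreal_less_top le_less_trans)
      have gW: "enn2real (g \<nu>) \<le> W \<mu> \<nu>" for \<nu> using gle[of \<nu>] W0 by (subst (asm) gr) simp
      have nn: "(\<integral>\<^sup>+\<nu>. ennreal (enn2real (g \<nu>)) \<partial>P) = integral\<^sup>S P g"
        using nn_integral_eq_simple_integral[OF g(1)] gr by simp
      have "(\<integral>\<^sup>+\<nu>. ennreal (enn2real (g \<nu>)) \<partial>P) \<le> (\<integral>\<^sup>+\<nu>. ennreal (W \<mu> \<nu>) \<partial>P)"
        by (intro nn_integral_mono ennreal_leI gW)
      then have gi: "integrable P (\<lambda>\<nu>. enn2real (g \<nu>))"
        using Wfin[OF \<mu>] by (intro integrableI_nonneg) (auto intro: le_less_trans)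
      have "L (\<lambda>i. (-1) * (\<lambda>(\<nu>, n). W \<mu> \<nu>) i) \<le> integral\<^sup>L P (\<lambda>\<nu>. - enn2real (g \<nu>))"
        by (rule L_le[of _ _ 0, OF fun_subspaceD(3)[OF V WV[OF \<mu>]]]) (use gi gW in auto)
      then have "(\<integral>\<nu>. enn2real (g \<nu>) \<partial>P) \<le> L (\<lambda>(\<nu>, n). W \<mu> \<nu>)"
        using linear_functional_onD(2)[OF L WV[OF \<mu>], of "-1"] by simp
      moreover from this have "0 \<le> L (\<lambda>(\<nu>, n). W \<mu> \<nu>)"
        by (rule order_trans[OF integral_nonneg_AE, rotated]) simp
      ultimately show ?thesis unfolding nn[symmetric] nn_integral_eq_integral[OF gi, simplified]
        by (auto intro: ennreal_leI)
    qed
    have "(\<integral>\<^sup>+\<nu>. ennreal (W \<mu> \<nu>) \<partial>P) \<le> ennreal (L (\<lambda>(\<nu>, n). W \<mu> \<nu>))"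
      unfolding nn_integral_def using simp_le by (auto intro!: SUP_least)
    moreover have "0 \<le> L (\<lambda>(\<nu>, n). W \<mu> \<nu>)"
      using simp_le[of "\<lambda>_. 0"] by (auto simp: le_fun_def)
    ultimately show ?thesis unfolding WP[OF \<mu>] by (metis enn2real_ennreal enn2real_mono ennreal_less_top)
  qed

  \<comment> \<open>Near-optimal couplings\<close>
  have "\<exists>\<gamma>\<in>couplings \<rho> \<nu>. (\<integral>\<^sup>+ (x, y). ennreal ((norm (x - y))\<^sup>2) \<partial>\<gamma>) < ennreal (W \<rho> \<nu> + 1 / Suc n)"
    if "\<nu> \<in> P2" for \<nu> and n :: nat
  proof -
    have "W2_sq \<rho> \<nu> < ennreal (W \<rho> \<nu> + 1 / Suc n)"
      unfolding W[OF \<rho> that] using W0[of \<rho> \<nu>] by (intro ennreal_lessI) (auto intro: add_nonneg_pos)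
    then show ?thesis unfolding W2_sq_def by (simp add: INF_less_iff)
  qed
  \<comment> \<open>A choice for each \<open>\<nu>\<close> and \<open>n\<close> separately, with no
    measurability in \<open>\<nu>\<close>; \<open>L\<close> accepts the resulting integrals as they
    are.\<close>
  then obtain G where G: "\<And>\<nu> n. \<nu> \<in> P2 \<Longrightarrow> G \<nu> n \<in> couplings \<rho> \<nu>"
    and G_cost: "\<And>\<nu> n. \<nu> \<in> P2 \<Longrightarrow>
      (\<integral>\<^sup>+ (x, y). ennreal ((norm (x - y))\<^sup>2) \<partial>G \<nu> n) < ennreal (W \<rho> \<nu> + 1 / Suc n)"
    by metis
  have G_int_snd2: "integrable (G \<nu> n) (\<lambda>q. (norm (snd q))\<^sup>2)" "(\<integral>q. (norm (snd q))\<^sup>2 \<partial>G \<nu> n) = m \<nu>"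
    if \<nu>: "\<nu> \<in> P2" for \<nu> n
  proof -
    note \<gamma> = G[OF \<nu>, of n]
    have e: "(\<integral>\<^sup>+q. ennreal ((norm (snd q))\<^sup>2) \<partial>G \<nu> n) = ennreal (m \<nu>)"
      using nn_integral_coupling_snd[OF \<gamma>, of "\<lambda>y. ennreal ((norm y)\<^sup>2)"] m[OF \<nu>] by (simp add: moment_2)
    have meas: "(\<lambda>q. (norm (snd q))\<^sup>2) \<in> borel_measurable (G \<nu> n)"
      unfolding measurable_coupling[OF \<gamma>] by measurable
    show "integrable (G \<nu> n) (\<lambda>q. (norm (snd q))\<^sup>2)"
      using e meas by (intro integrableI_nonneg) auto
    show "(\<integral>q. (norm (snd q))\<^sup>2 \<partial>G \<nu> n) = m \<nu>"
      using e meas m0 by (subst integral_eq_nn_integral) auto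
  qed
  have G_int_fst: "integrable (G \<nu> n) (\<lambda>q. f (fst q))" "(\<integral>q. f (fst q) \<partial>G \<nu> n) = integral\<^sup>L \<rho> f"
    if \<nu>: "\<nu> \<in> P2" and f: "integrable \<rho> f" for \<nu> n and f :: "'a \<Rightarrow> real"
  proof -
    note \<gamma> = G[OF \<nu>, of n]
    have fst: "fst \<in> G \<nu> n \<rightarrow>\<^sub>M borel" unfolding measurable_coupling[OF \<gamma>] by simp
    have fb: "f \<in> borel_measurable borel" using f by measurable
    show "integrable (G \<nu> n) (\<lambda>q. f (fst q))"
      using f unfolding couplingsD(3)[OF \<gamma>, symmetric] by (subst (asm) integrable_distr_eq[OF fst fb])
    show "(\<integral>q. f (fst q) \<partial>G \<nu> n) = integral\<^sup>L \<rho> f"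
      unfolding couplingsD(3)[OF \<gamma>, symmetric] by (subst integral_distr[OF fst fb]) simp
  qed

  \<comment> \<open>The density \<open>s\<close>\<close>
  let ?BM = "bounded_measurable \<rho>"
  have BM_int: "integrable \<rho> f" if f: "f \<in> ?BM" for f
  proof -
    obtain C where "f \<in> borel_measurable \<rho>" "\<And>x. \<bar>f x\<bar> \<le> C"
      using f P2D(3)[OF \<rho>] by (auto simp: bounded_measurable_def)
    then show ?thesis by (intro \<rho>.integrable_const_bound[of _ C]) auto
  qed
  \<comment> \<open>\<open>L (J \<psi>)\<close> stands for the integral of
    \<open>\<psi> x * norm y\<close> against the averaged coupling.\<close>
  define J where "J \<psi> = (\<lambda>(\<nu>, n). if \<nu> \<in> P2 then \<integral>q. \<psi> (fst q) * norm (snd q) \<partial>G \<nu> n else 0)"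
    for \<psi> :: "'a \<Rightarrow> real"
  have y_int: "integrable (G \<nu> n) (\<lambda>q. norm (snd q))" and y_le: "(\<integral>q. norm (snd q) \<partial>G \<nu> n) \<le> w \<nu>"
    if \<nu>: "\<nu> \<in> P2" for \<nu> n
  proof -
    interpret \<gamma>: prob_space "G \<nu> n" by (rule couplingsD[OF G[OF \<nu>]])
    have le: "norm (snd q) \<le> 1 + (norm (snd q))\<^sup>2" for q :: "'a \<times> 'a"
    proof -
      have "2 * norm (snd q) \<le> 1 + (norm (snd q))\<^sup>2"
        using sum_squares_bound[of 1 "norm (snd q)"] by simp
      then show ?thesis using norm_ge_zero[of "snd q"] by linarith
    qed
    show i: "integrable (G \<nu> n) (\<lambda>q. norm (snd q))"
      by (rule Bochner_Integration.integrable_bound[of _ "\<lambda>q. 1 + (norm (snd q))\<^sup>2"])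
        (use G_int_snd2[OF \<nu>] le in \<open>auto simp: measurable_coupling[OF G[OF \<nu>]]\<close>)
    have "(\<integral>q. norm (snd q) \<partial>G \<nu> n) \<le> (\<integral>q. 1 + (norm (snd q))\<^sup>2 \<partial>G \<nu> n)"
      using G_int_snd2(1)[OF \<nu>] by (intro integral_mono i le) auto
    also have "\<dots> = w \<nu>" using G_int_snd2[OF \<nu>] by (simp add: w_def \<gamma>.prob_space)
    finally show "(\<integral>q. norm (snd q) \<partial>G \<nu> n) \<le> w \<nu>" .
  qed
  have \<psi>y_int: "integrable (G \<nu> n) (\<lambda>q. \<psi> (fst q) * norm (snd q))"
    if \<nu>: "\<nu> \<in> P2" and \<psi>: "\<psi> \<in> ?BM" for \<nu> n \<psi>
  proof -
    obtain C where [measurable]: "\<psi> \<in> borel_measurable \<rho>" and C: "\<And>x. \<bar>\<psi> x\<bar> \<le> C"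
      using \<psi> P2D(3)[OF \<rho>] by (auto simp: bounded_measurable_def)
    show ?thesis
      by (rule Bochner_Integration.integrable_bound[of _ "\<lambda>q. C * norm (snd q)"])
        (use y_int[OF \<nu>] C order_trans[OF abs_ge_zero C] in
          \<open>auto simp: measurable_coupling[OF G[OF \<nu>]] abs_mult intro!: mult_right_mono\<close>)
  qed
  have JV: "J \<psi> \<in> ?V" if \<psi>: "\<psi> \<in> ?BM" for \<psi>
  proof -
    obtain C where C: "\<And>x. \<bar>\<psi> x\<bar> \<le> C"
      using \<psi> P2D(3)[OF \<rho>] by (auto simp: bounded_measurable_def)
    have C0: "0 \<le> C" using order_trans[OF abs_ge_zero C] .
    show ?thesis
    proof (rule VI)
      fix \<nu> :: "'a measure" and n :: nat assume \<nu>: "\<nu> \<in> P2"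
      have "\<bar>J \<psi> (\<nu>, n)\<bar> \<le> (\<integral>q. \<bar>\<psi> (fst q) * norm (snd q)\<bar> \<partial>G \<nu> n)"
        using \<nu> by (simp add: J_def)
      also have "\<dots> \<le> (\<integral>q. C * norm (snd q) \<partial>G \<nu> n)"
        by (rule integral_mono[OF integrable_abs[OF \<psi>y_int[OF \<nu> \<psi>]]])
          (use y_int[OF \<nu>] C in \<open>auto simp: abs_mult intro!: mult_right_mono\<close>)
      also have "\<dots> \<le> C * w \<nu>" using y_le[OF \<nu>] C0 by (simp add: mult_left_mono)
      finally show "\<bar>J \<psi> (\<nu>, n)\<bar> \<le> C * w \<nu>" .
    qed
  qed
  have LJ: "linear_functional_on ?BM (\<lambda>\<psi>. L (J \<psi>))"
    unfolding linear_functional_on_def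
  proof (intro conjI ballI allI)
    fix f g assume f: "f \<in> ?BM" and g: "g \<in> ?BM"
    have "J (\<lambda>x. f x + g x) = (\<lambda>i. J f i + J g i)"
      using \<psi>y_int[OF _ f] \<psi>y_int[OF _ g] by (auto simp: J_def fun_eq_iff distrib_right)
    then show "L (J (\<lambda>x. f x + g x)) = L (J f) + L (J g)"
      using linear_functional_onD(1)[OF L JV[OF f] JV[OF g]] by simp
  next
    fix f t assume f: "f \<in> ?BM"
    have "J (\<lambda>x. t * f x) = (\<lambda>i. t * J f i)"
      by (auto simp: J_def fun_eq_iff mult.assoc)
    then show "L (J (\<lambda>x. t * f x)) = t * L (J f)"
      using linear_functional_onD(2)[OF L JV[OF f]] by simp
  qed
  obtain s where s_m: "s \<in> borel_measurable \<rho>" and s0: "\<And>x. 0 \<le> s x" and s_int: "integrable \<rho> s"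
    and s: "\<And>\<psi>. \<psi> \<in> ?BM \<Longrightarrow> L (J \<psi>) = (\<integral>x. \<psi> x * s x \<partial>\<rho>)"
  proof (rule \<rho>.bounded_functional_density[OF LJ, where C = "integral\<^sup>L P w"])
    fix f assume f: "f \<in> ?BM" and f0: "\<And>x. x \<in> space \<rho> \<Longrightarrow> 0 \<le> f x"
    have "0 \<le> J f i" for i
      using f0 P2D(3)[OF \<rho>] by (cases i) (auto simp: J_def intro!: integral_nonneg_AE)
    then have "L (\<lambda>i. (-1) * J f i) \<le> integral\<^sup>L P (\<lambda>_. 0)"
      by (intro L_le[of _ _ 0, OF fun_subspaceD(3)[OF V JV[OF f]]]) auto
    then show "0 \<le> L (J f)" using linear_functional_onD(2)[OF L JV[OF f], of "-1"] by simp
  next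
    fix f and k :: real
    assume f: "f \<in> ?BM" and f01: "\<And>x. x \<in> space \<rho> \<Longrightarrow> 0 \<le> f x \<and> f x \<le> 1" and k: "0 < k"
    have "J f (\<nu>, n) \<le> k * integral\<^sup>L \<rho> f + w \<nu> / k" if \<nu>: "\<nu> \<in> P2" for \<nu> n
    proof -
      \<comment> \<open>Split at \<open>norm y = k\<close>: below it \<open>norm y \<le> k\<close>,
        above it \<open>norm y \<le> (norm y)\<^sup>2 / k\<close>. The second moments thus supply
        the bound with free \<open>k\<close> required for a density.\<close>
      have pt: "f (fst q) * norm (snd q) \<le> k * f (fst q) + (norm (snd q))\<^sup>2 / k" for q :: "'a \<times> 'a"
      proof (cases "norm (snd q) \<le> k")
        case True
        then have "f (fst q) * norm (snd q) \<le> f (fst q) * k"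
          using f01[of "fst q"] P2D(3)[OF \<rho>] by (intro mult_left_mono) auto
        moreover have "0 \<le> (norm (snd q))\<^sup>2 / k" using k by simp
        ultimately show ?thesis by (simp add: mult.commute)
      next
        case False
        have "f (fst q) * norm (snd q) \<le> 1 * norm (snd q)"
          using f01[of "fst q"] P2D(3)[OF \<rho>] by (intro mult_right_mono) auto
        also have "\<dots> \<le> (norm (snd q))\<^sup>2 / k"
          using False k by (simp add: power2_eq_square field_simps mult_right_mono)
        finally have "f (fst q) * norm (snd q) \<le> (norm (snd q))\<^sup>2 / k" .
        moreover have "0 \<le> k * f (fst q)" using f01[of "fst q"] P2D(3)[OF \<rho>] k by simp
        ultimately show ?thesis by simp
      qed
      have "J f (\<nu>, n) = (\<integral>q. f (fst q) * norm (snd q) \<partial>G \<nu> n)" using \<nu> by (simp add: J_def)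
      also have "\<dots> \<le> (\<integral>q. k * f (fst q) + (norm (snd q))\<^sup>2 / k \<partial>G \<nu> n)"
        by (rule integral_mono[OF \<psi>y_int[OF \<nu> f] _ pt])
          (use G_int_fst(1)[OF \<nu> BM_int[OF f]] G_int_snd2(1)[OF \<nu>] in simp)
      also have "\<dots> = k * integral\<^sup>L \<rho> f + m \<nu> / k"
        using G_int_fst[OF \<nu> BM_int[OF f]] G_int_snd2[OF \<nu>] by simp
      also have "\<dots> \<le> k * integral\<^sup>L \<rho> f + w \<nu> / k" using w1 k by (simp add: divide_right_mono)
      finally show ?thesis .
    qed
    then have "L (J f) \<le> integral\<^sup>L P (\<lambda>\<nu>. k * integral\<^sup>L \<rho> f + w \<nu> / k)"
      using w by (intro L_le[of _ _ 0, OF JV[OF f]]) (auto simp: spP intro!: AE_I2)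
    then show "L (J f) \<le> k * integral\<^sup>L \<rho> f + integral\<^sup>L P w / k"
      using w by (simp add: P.prob_space)
  qed blast
  note [measurable] = s_m
  show thesis
  proof (rule that[OF _ s0])
    show "s \<in> borel_measurable borel" using s_m measurable_cong_sets[OF P2D(2)[OF \<rho>] refl] by blast
  next

    \<comment> \<open>Moments of \<open>s\<close> by Jensen's inequality\<close>
    fix p :: real assume p: "1 \<le> p"
    show "(\<integral>\<^sup>+x. ennreal (s x powr p) \<partial>\<rho>) \<le> (\<integral>\<^sup>+\<nu>. moment p \<nu> \<partial>P)"
    proof (cases "(\<integral>\<^sup>+\<nu>. moment p \<nu> \<partial>P) = \<infinity>")
      case False
      define mp where "mp \<nu> = enn2real (moment p \<nu>)" for \<nu> :: "'a measure"
      have mp_m[measurable]: "mp \<in> borel_measurable P" using mom_m[OF p] unfolding mp_def by measurable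
      have mp: "AE \<nu> in P. moment p \<nu> = ennreal (mp \<nu>)"
        using nn_integral_PInf_AE[OF mom_m[OF p] False] by eventually_elim (simp add: mp_def less_top)
      have nn_mp: "(\<integral>\<^sup>+\<nu>. ennreal (mp \<nu>) \<partial>P) = (\<integral>\<^sup>+\<nu>. moment p \<nu> \<partial>P)"
        by (rule nn_integral_cong_AE) (use mp in \<open>eventually_elim; simp\<close>)
      have mp_int: "integrable P mp"
        using False by (intro integrableI_nonneg) (auto simp: mp_def[symmetric] nn_mp less_top, simp add: mp_def)
      have nn_mp': "(\<integral>\<^sup>+\<nu>. moment p \<nu> \<partial>P) = ennreal (integral\<^sup>L P mp)"
        unfolding nn_mp[symmetric] by (rule nn_integral_eq_integral[OF mp_int]) (simp add: mp_def)
      \<comment> \<open>Truncation makes \<open>a\<close> below finite, so that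
        \<open>(p - 1) * a\<close> can be subtracted from both sides.\<close>
      define g where "g k x = min (s x) (real k)" for k :: nat and x
      have g_m[measurable]: "g k \<in> borel_measurable \<rho>" for k unfolding g_def by measurable
      have g0: "0 \<le> g k x" "g k x \<le> real k" "g k x \<le> s x" for k x using s0[of x] by (auto simp: g_def)
      have k_le: "(\<integral>\<^sup>+x. ennreal (g k x powr p) \<partial>\<rho>) \<le> (\<integral>\<^sup>+\<nu>. moment p \<nu> \<partial>P)" for k
      proof -
        define a where "a = (\<integral>x. g k x powr p \<partial>\<rho>)"
        have gp: "(\<lambda>x. g k x powr p) \<in> ?BM"
          by (rule bounded_measurableI[of _ _ "real k powr p"]) (use g0 p in \<open>auto intro: powr_mono2\<close>)
        \<comment> \<open>The slope of the power function at \<open>g k x\<close>. Its tangent there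
          lies below \<open>norm y powr p\<close>, whence \<open>\<psi> x * norm y \<le> norm y powr
          p + (p - 1) * g k x powr p\<close>; after averaging, the left side is at least
          \<open>p * a\<close>.\<close>
        define \<psi> where "\<psi> x = p * g k x powr (p - 1)" for x
        have \<psi>: "\<psi> \<in> ?BM" unfolding \<psi>_def
          by (rule bounded_measurableI[of _ _ "p * real k powr (p - 1)"])
            (use g0 p in \<open>auto simp: abs_mult intro!: mult_left_mono powr_mono2\<close>)
        have gg: "g k x powr (p - 1) * g k x = g k x powr p" for x
          using g0[of k x] by (cases "g k x = 0") (auto simp: powr_mult_base mult.commute)
        have J_le: "J \<psi> (\<nu>, n) \<le> mp \<nu> + (p - 1) * a" if \<nu>: "\<nu> \<in> P2" and fin: "moment p \<nu> = ennreal (mp \<nu>)" for \<nu> n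
        proof -
          note \<gamma> = G[OF \<nu>, of n]
          have e: "(\<integral>\<^sup>+q. ennreal (norm (snd q) powr p) \<partial>G \<nu> n) = ennreal (mp \<nu>)"
            using nn_integral_coupling_snd[OF \<gamma>, of "\<lambda>y. ennreal (norm y powr p)"] fin by (simp add: moment_def)
          have meas: "(\<lambda>q. norm (snd q) powr p) \<in> borel_measurable (G \<nu> n)"
            unfolding measurable_coupling[OF \<gamma>] by measurable
          have yi: "integrable (G \<nu> n) (\<lambda>q. norm (snd q) powr p)"
            using e meas by (intro integrableI_nonneg) auto
          have ye: "(\<integral>q. norm (snd q) powr p \<partial>G \<nu> n) = mp \<nu>"
            using e meas by (subst integral_eq_nn_integral) (auto simp: mp_def)
          have pt: "\<psi> (fst q) * norm (snd q) \<le> norm (snd q) powr p + (p - 1) * g k (fst q) powr p" for q :: "'a \<times> 'a"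
            using powr_above_tangent[OF p g0(1)[of k "fst q"] norm_ge_zero[of "snd q"]] gg[of "fst q"]
            by (simp add: \<psi>_def algebra_simps)
          have "J \<psi> (\<nu>, n) = (\<integral>q. \<psi> (fst q) * norm (snd q) \<partial>G \<nu> n)" using \<nu> by (simp add: J_def)
          also have "\<dots> \<le> (\<integral>q. norm (snd q) powr p + (p - 1) * g k (fst q) powr p \<partial>G \<nu> n)"
            by (rule integral_mono[OF \<psi>y_int[OF \<nu> \<psi>] _ pt])
              (use G_int_fst(1)[OF \<nu> BM_int[OF gp]] yi in simp)
          also have "\<dots> = mp \<nu> + (p - 1) * a"
            using G_int_fst[OF \<nu> BM_int[OF gp]] yi ye by (simp add: a_def)
          finally show ?thesis .
        qed
        have "L (J \<psi>) \<le> integral\<^sup>L P (\<lambda>\<nu>. mp \<nu> + (p - 1) * a)"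
        proof (rule L_le[of _ _ 0, OF JV[OF \<psi>]])
          show "AE \<nu> in P. \<forall>n\<ge>0. J \<psi> (\<nu>, n) \<le> mp \<nu> + (p - 1) * a"
            using mp AE_space by eventually_elim (auto simp: spP J_le)
        qed (use mp_int in simp)
        then have "L (J \<psi>) \<le> integral\<^sup>L P mp + (p - 1) * a" using mp_int by (simp add: P.prob_space)
        moreover have "p * a \<le> L (J \<psi>)"
        proof -
          have \<psi>0: "0 \<le> \<psi> x" for x using p by (simp add: \<psi>_def)
          have \<psi>s: "integrable \<rho> (\<lambda>x. \<psi> x * s x)"
          proof -
            obtain C where C: "\<And>x. \<bar>\<psi> x\<bar> \<le> C"
              using \<psi> P2D(3)[OF \<rho>] by (auto simp: bounded_measurable_def)
            show ?thesis
              by (rule Bochner_Integration.integrable_bound[of _ "\<lambda>x. C * s x"])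
                (use s_int C order_trans[OF abs_ge_zero C] s0 in
                  \<open>auto simp: abs_mult \<psi>_def[abs_def] intro!: mult_right_mono\<close>)
          qed
          have "p * a = (\<integral>x. \<psi> x * g k x \<partial>\<rho>)"
            unfolding a_def \<psi>_def by (simp add: mult.assoc gg)
          also have "\<dots> \<le> (\<integral>x. \<psi> x * s x \<partial>\<rho>)"
          proof (rule integral_mono[OF _ \<psi>s])
            have "(\<lambda>x. \<psi> x * g k x) = (\<lambda>x. p * g k x powr p)" by (simp add: \<psi>_def mult.assoc gg)
            then show "integrable \<rho> (\<lambda>x. \<psi> x * g k x)" using BM_int[OF gp] by simp
          qed (use \<psi>0 g0 in \<open>auto intro: mult_left_mono\<close>)
          finally show ?thesis by (simp add: s[OF \<psi>])
        qed
        ultimately have "a \<le> integral\<^sup>L P mp" by (simp add: algebra_simps)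
        moreover have "(\<integral>\<^sup>+x. ennreal (g k x powr p) \<partial>\<rho>) = ennreal a"
          unfolding a_def by (rule nn_integral_eq_integral[OF BM_int[OF gp]]) simp
        ultimately show ?thesis by (simp add: nn_mp' ennreal_leI)
      qed
      have "(SUP k. ennreal (g k x powr p)) = ennreal (s x powr p)" for x
      proof (rule antisym)
        show "(SUP k. ennreal (g k x powr p)) \<le> ennreal (s x powr p)"
          using g0 p by (intro SUP_least ennreal_leI powr_mono2) auto
        obtain k :: nat where "s x \<le> real k" using real_arch_simple by blast
        then have "g k x = s x" by (simp add: g_def)
        then show "ennreal (s x powr p) \<le> (SUP k. ennreal (g k x powr p))" by (metis SUP_upper UNIV_I)
      qed
      then have "(\<integral>\<^sup>+x. ennreal (s x powr p) \<partial>\<rho>) = (\<integral>\<^sup>+x. (SUP k. ennreal (g k x powr p)) \<partial>\<rho>)" by simp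
      also have "\<dots> = (SUP k. \<integral>\<^sup>+x. ennreal (g k x powr p) \<partial>\<rho>)"
      proof (rule nn_integral_monotone_convergence_SUP)
        show "incseq (\<lambda>k x. ennreal (g k x powr p))"
          using p s0 by (auto simp: incseq_def le_fun_def g_def intro!: ennreal_leI powr_mono2)
      qed measurable
      also have "\<dots> \<le> (\<integral>\<^sup>+\<nu>. moment p \<nu> \<partial>P)" by (intro SUP_least k_le)
      finally show ?thesis .
    qed simp
  next

    \<comment> \<open>Transport cost after resampling\<close>
    fix B :: "'a set" and R r :: real and u :: "'a measure"
    assume B[measurable]: "B \<in> sets borel" and BR: "B \<subseteq> ball 0 R" and u: "u \<in> P2" and r: "0 \<le> r"
      and u_cost: "\<And>y. (\<integral>\<^sup>+x. ennreal ((norm (x - y))\<^sup>2) \<partial>u) \<le> ennreal ((r + norm y)\<^sup>2)"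
    let ?\<rho>' = "resample \<rho> B u"
    have \<rho>': "?\<rho>' \<in> P2" by (rule resample_in_P2[OF \<rho> u B])
    \<comment> \<open>On \<open>B\<close> the cost changes by at most
      \<open>(r + norm y)\<^sup>2 - (norm x - norm y)\<^sup>2\<close>, the subtracted square being a
      lower bound of the old cost. The squares of \<open>norm y\<close> cancel, leaving
      \<open>c x + \<psi> x * norm y\<close>, which is affine in \<open>norm y\<close>; hence only
      the conditional mean of \<open>norm y\<close> matters.\<close>
    define \<psi> where "\<psi> x = 2 * indicator B x * (norm x + r)" for x
    define c where "c x = indicator B x * (r\<^sup>2 - (norm x)\<^sup>2)" for x
    have nR: "norm x \<le> R" "0 \<le> R" if "x \<in> B" for x
      using subsetD[OF BR that] norm_ge_zero[of x] by (auto simp del: norm_ge_zero)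
    have \<psi>: "\<psi> \<in> ?BM"
      by (rule bounded_measurableI[of _ _ "2 * (\<bar>R\<bar> + r)"]) (use nR r in \<open>auto simp: \<psi>_def[abs_def] indicator_def\<close>)
    have c: "c \<in> ?BM"
    proof (rule bounded_measurableI[of _ _ "r\<^sup>2 + R\<^sup>2"])
      fix x :: 'a
      show "\<bar>c x\<bar> \<le> r\<^sup>2 + R\<^sup>2"
      proof (cases "x \<in> B")
        case True
        then have "(norm x)\<^sup>2 \<le> R\<^sup>2" using nR[OF True] by (intro power_mono) auto
        then have "\<bar>r\<^sup>2 - (norm x)\<^sup>2\<bar> \<le> r\<^sup>2 + R\<^sup>2"
          using zero_le_power2[of r] zero_le_power2[of "norm x"] unfolding abs_le_iff by linarith
        then show ?thesis using True by (simp add: c_def)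
      qed (simp add: c_def)
    qed (simp add: c_def[abs_def])
    have W_le: "W ?\<rho>' \<nu> - W \<rho> \<nu> - J \<psi> (\<nu>, n) \<le> integral\<^sup>L \<rho> c + 1 / Suc n" if \<nu>: "\<nu> \<in> P2" for \<nu> n
    proof -
      note \<gamma> = G[OF \<nu>, of n]
      have mc: "(\<lambda>q. (norm (fst q - snd q))\<^sup>2) \<in> borel_measurable (G \<nu> n)"
        unfolding measurable_coupling[OF \<gamma>] by measurable
      have cost: "(\<integral>\<^sup>+q. ennreal ((norm (fst q - snd q))\<^sup>2) \<partial>G \<nu> n) < ennreal (W \<rho> \<nu> + 1 / Suc n)"
        using G_cost[OF \<nu>, of n] unfolding case_prod_beta' .
      have ci: "integrable (G \<nu> n) (\<lambda>q. (norm (fst q - snd q))\<^sup>2)"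
        using mc less_trans[OF cost] by (intro integrableI_nonneg) auto
      have ce: "(\<integral>q. (norm (fst q - snd q))\<^sup>2 \<partial>G \<nu> n) \<le> W \<rho> \<nu> + 1 / Suc n"
      proof -
        have "ennreal (\<integral>q. (norm (fst q - snd q))\<^sup>2 \<partial>G \<nu> n) \<le> ennreal (W \<rho> \<nu> + 1 / Suc n)"
          using cost by (subst nn_integral_eq_integral[OF ci, symmetric]) auto
        then show ?thesis using W0[of \<rho> \<nu>] by (subst (asm) ennreal_le_iff) auto
      qed
      define h where "h q = (norm (fst q - snd q))\<^sup>2 + c (fst q) + \<psi> (fst q) * norm (snd q)" for q
      have hi: "integrable (G \<nu> n) h"
        unfolding h_def using ci G_int_fst(1)[OF \<nu> BM_int[OF c]] \<psi>y_int[OF \<nu> \<psi>] by auto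
      have far: "(r + norm y)\<^sup>2 \<le> h (x, y)" if "x \<in> B" for x y
      proof -
        have "(norm x - norm y)\<^sup>2 \<le> (norm (x - y))\<^sup>2"
          using norm_triangle_ineq3[of x y] by (metis abs_le_square_iff abs_norm_cancel)
        then show ?thesis using that by (simp add: h_def c_def \<psi>_def power2_eq_square algebra_simps)
      qed
      have near: "(norm (x - y))\<^sup>2 = h (x, y)" if "x \<notin> B" for x y
        using that by (simp add: h_def c_def \<psi>_def)
      have h0: "0 \<le> h q" for q
      proof (cases "fst q \<in> B")
        case True
        then show ?thesis using order_trans[OF zero_le_power2 far[of "fst q" "snd q"]] by simp
      next
        case False
        then have "h q = (norm (fst q - snd q))\<^sup>2" using near[of "fst q" "snd q"] by simp
        then show ?thesis by simp
      qed
      have "ennreal (W ?\<rho>' \<nu>) = W2_sq ?\<rho>' \<nu>" by (rule W[OF \<rho>' \<nu>, symmetric])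
      also have "\<dots> \<le> (\<integral>\<^sup>+(x, y). (if x \<in> B then \<integral>\<^sup>+x'. ennreal ((norm (x' - y))\<^sup>2) \<partial>u else ennreal ((norm (x - y))\<^sup>2)) \<partial>G \<nu> n)"
        by (rule W2_sq_resample_le[OF \<rho> u B \<gamma>])
      also have "\<dots> \<le> (\<integral>\<^sup>+q. ennreal (h q) \<partial>G \<nu> n)"
        by (rule nn_integral_mono)
          (use order_trans[OF u_cost ennreal_leI[OF far]] near in \<open>auto split: prod.splits\<close>)
      also have "\<dots> = ennreal (integral\<^sup>L (G \<nu> n) h)"
        by (rule nn_integral_eq_integral[OF hi]) (simp add: h0)
      finally have "W ?\<rho>' \<nu> \<le> integral\<^sup>L (G \<nu> n) h"
        using h0 by (subst (asm) ennreal_le_iff) (auto intro!: integral_nonneg_AE)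
      also have "\<dots> = (\<integral>q. (norm (fst q - snd q))\<^sup>2 \<partial>G \<nu> n) + integral\<^sup>L \<rho> c + J \<psi> (\<nu>, n)"
        unfolding h_def using ci G_int_fst[OF \<nu> BM_int[OF c]] \<psi>y_int[OF \<nu> \<psi>] \<nu> by (simp add: J_def)
      finally show ?thesis using ce by simp
    qed
    define F where "F = (\<lambda>i. ((\<lambda>(\<nu>, n). W ?\<rho>' \<nu>) i - (\<lambda>(\<nu>, n). W \<rho> \<nu>) i) - J \<psi> i)"
    note d1 = linear_functional_on_diff[OF V L WV[OF \<rho>'] WV[OF \<rho>]]
    note d2 = linear_functional_on_diff[OF V L d1(1) JV[OF \<psi>]]
    \<comment> \<open>The optimality error \<open>1 / Suc n\<close> is at most \<open>e\<close> from
      some \<open>N\<close> on, uniformly in \<open>\<nu>\<close>, and \<open>L\<close> does not see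
      the indices below \<open>N\<close>.\<close>
    have "L F \<le> integral\<^sup>L \<rho> c"
    proof (rule field_le_epsilon)
      fix e :: real assume "0 < e"
      then obtain N where N: "1 / real (Suc N) < e" using nat_approx_posE by blast
      have "1 / real (Suc n) \<le> e" if "n \<ge> N" for n
        using N that by (smt (verit) frac_le of_nat_0_less_iff of_nat_le_iff Suc_le_mono zero_less_Suc)
      then have "F (\<nu>, n) \<le> integral\<^sup>L \<rho> c + e" if "\<nu> \<in> P2" "n \<ge> N" for \<nu> n
        using W_le[OF that(1), of n] that(2) unfolding F_def by force
      then have "L F \<le> integral\<^sup>L P (\<lambda>_. integral\<^sup>L \<rho> c + e)"
        by (intro L_le[of _ _ N]) (use d2 in \<open>auto simp: F_def spP intro!: AE_I2\<close>)
      then show "L F \<le> integral\<^sup>L \<rho> c + e" by (simp add: P.prob_space)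
    qed
    then have "L (\<lambda>(\<nu>, n). W ?\<rho>' \<nu>) \<le> L (\<lambda>(\<nu>, n). W \<rho> \<nu>) + integral\<^sup>L \<rho> c + L (J \<psi>)"
      unfolding F_def d2(2) d1(2) by simp
    then show "enn2real (\<integral>\<^sup>+\<nu>. W2_sq ?\<rho>' \<nu> \<partial>P) \<le> enn2real (\<integral>\<^sup>+\<nu>. W2_sq \<rho> \<nu> \<partial>P) +
         (\<integral>x. indicator B x * (r\<^sup>2 - (norm x)\<^sup>2) \<partial>\<rho>) + (\<integral>x. 2 * indicator B x * (norm x + r) * s x \<partial>\<rho>)"
      using L_upper L_lower[OF \<rho>'] s[OF \<psi>] unfolding c_def \<psi>_def by linarith
  qed
qed

section \<open>The barycenter\<close>

lemma nn_integral_W2_sq_finite: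
  assumes \<mu>: "\<mu> \<in> P2" and P: "prob_space P" "sets P = sets P2_borel"
    and m2: "(\<integral>\<^sup>+\<nu>. moment 2 \<nu> \<partial>P) < \<infinity>"
  shows "(\<integral>\<^sup>+\<nu>. W2_sq \<mu> \<nu> \<partial>P) < \<infinity>"
proof -
  interpret prob_space P by fact
  have sp: "space P = P2" using sets_eq_imp_space_eq[OF P(2)] by (simp add: space_P2_borel)
  have [measurable]: "moment 2 \<in> borel_measurable P"
    using moment_measurable[of 2] measurable_cong_sets[OF P(2) refl] by auto
  have "(\<integral>\<^sup>+\<nu>. W2_sq \<mu> \<nu> \<partial>P) \<le> (\<integral>\<^sup>+\<nu>. 2 * moment 2 \<mu> + 2 * moment 2 \<nu> \<partial>P)"
    by (intro nn_integral_mono W2_sq_le_moments \<mu>) (simp add: sp)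
  also have "\<dots> = 2 * moment 2 \<mu> + 2 * (\<integral>\<^sup>+\<nu>. moment 2 \<nu> \<partial>P)"
    by (simp add: nn_integral_add nn_integral_cmult emeasure_space_1)
  also have "\<dots> < \<infinity>" using P2D(4)[OF \<mu>] m2 by (simp add: ennreal_mult_less_top)
  finally show ?thesis .
qed

text \<open>Minimality is transferred to the reals. The entropy of the competitor enters through an
  upper bound, so that it can be estimated by a majorant.\<close>

lemma bar_functional_leD:
  assumes w: "(\<integral>\<^sup>+\<nu>. W2_sq \<rho> \<nu> \<partial>P) < \<infinity>" and w': "(\<integral>\<^sup>+\<nu>. W2_sq \<rho>' \<nu> \<partial>P) < \<infinity>"
    and l: "0 < l" and E: "Ent \<Omega> \<rho> = ereal E" and E': "Ent \<Omega> \<rho>' \<le> ereal E'"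
    and le: "bar_functional l \<Omega> P \<rho> \<le> bar_functional l \<Omega> P \<rho>'"
  shows "enn2real (\<integral>\<^sup>+\<nu>. W2_sq \<rho> \<nu> \<partial>P) / 2 + l * E \<le> enn2real (\<integral>\<^sup>+\<nu>. W2_sq \<rho>' \<nu> \<partial>P) / 2 + l * E'"
proof -
  obtain a where a: "0 \<le> a" "(\<integral>\<^sup>+\<nu>. W2_sq \<rho> \<nu> \<partial>P) = ennreal a" using w by (auto simp: less_top_ennreal)
  obtain b where b: "0 \<le> b" "(\<integral>\<^sup>+\<nu>. W2_sq \<rho>' \<nu> \<partial>P) = ennreal b" using w' by (auto simp: less_top_ennreal)
  have A: "bar_functional l \<Omega> P \<rho> = ereal (a / 2 + l * E)"
    unfolding bar_functional_def a(2) E using a(1) by (simp add: enn2ereal_ennreal)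
  have B: "bar_functional l \<Omega> P \<rho>' \<le> ereal (1/2) * ereal b + ereal l * ereal E'"
    unfolding bar_functional_def b(2) using l E' b(1)
    by (intro add_mono ereal_mult_left_mono) (simp_all add: enn2ereal_ennreal)
  show ?thesis using order_trans[OF le B] unfolding A by (simp add: a b)
qed

text \<open>The inequality \<open>ln t \<le> t - 1\<close> is used twice, at
  \<open>(f + c) / a\<close> and at \<open>(f + c) / f\<close>; the two resulting multiples of
  \<open>c\<close> cancel. Apart from \<open>f * ln f\<close> the right side is affine in
  \<open>f\<close>, so the entropy created by adding mass is controlled without a bound on the
  density.\<close>

lemma xlnx_add_le:
  fixes f c a :: real
  assumes f: "0 \<le> f" and c: "0 \<le> c" and a: "0 < a"
  shows "(f + c) * ln (f + c) \<le> f * ln f + c * ((f + c) / a + ln a)"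
proof (cases "c = 0")
  case False
  then have t: "0 < f + c" and c: "0 < c" using f c by auto
  have "ln ((f + c) / a) \<le> (f + c) / a - 1" using t a by (intro ln_le_minus_one) simp
  then have "c * ln (f + c) \<le> c * ((f + c) / a - 1 + ln a)"
    using t a c by (intro mult_left_mono) (auto simp: ln_div)
  moreover have "f * ln (f + c) \<le> f * ln f + c"
  proof (cases "f = 0")
    case False
    then have f: "0 < f" using f by simp
    have "ln ((f + c) / f) \<le> (f + c) / f - 1" using t f by (intro ln_le_minus_one) simp
    then have "f * ln ((f + c) / f) \<le> f * ((f + c) / f - 1)" using f by (intro mult_left_mono) auto
    also have "f * ((f + c) / f - 1) = c" using f by (simp add: field_simps)
    finally show ?thesis using f t by (simp add: ln_div algebra_simps)
  qed (use c in simp)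
  ultimately show ?thesis by (simp add: algebra_simps)
qed simp

text \<open>On \<open>B\<close> the new density is zero, because \<open>K\<close> is disjoint from
  \<open>B\<close>, so the old contribution of \<open>B\<close> is simply removed. On
  \<open>K\<close> a constant is added to the density, and the cost of that is bounded by
  \<open>xlnx_add_le\<close> and the total mass alone.\<close>

lemma resample_competitor:
  fixes \<Omega> :: "'a::euclidean_space set" and \<rho> :: "'a measure" and f :: "'a \<Rightarrow> real"
  assumes \<Omega>[measurable]: "\<Omega> \<in> sets borel" and p: "prob_space \<rho>"
    and f[measurable]: "f \<in> borel_measurable borel" and f0: "\<And>x. 0 \<le> f x"
    and \<rho>: "\<rho> = density lborel (\<lambda>x. ennreal (f x))" and one: "emeasure \<rho> \<Omega> = 1"
    and fi: "integrable lborel (\<lambda>x. indicator \<Omega> x * (f x * ln (f x)))"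
    and K[measurable]: "K \<in> sets borel" and K\<Omega>: "K \<subseteq> \<Omega>" and Kpos: "0 < measure lborel K"
    and B[measurable]: "B \<in> sets borel" and B\<Omega>: "B \<subseteq> \<Omega>" and BK: "B \<inter> K = {}"
  shows "Ent \<Omega> (resample \<rho> B (uniform_measure lborel K)) \<le>
    ereal ((\<integral>x. indicator \<Omega> x * (f x * ln (f x)) \<partial>lborel) - (\<integral>x. indicator B x * (f x * ln (f x)) \<partial>lborel)
      + measure \<rho> B * (1 + ln ((1 + measure \<rho> B) / measure lborel K)))"
proof -
  interpret prob_space \<rho> by fact
  let ?u = "uniform_measure lborel K"
  define k where "k = measure lborel K"
  define m where "m = measure \<rho> B"
  define c where "c = m / k"
  \<comment> \<open>An upper bound for the mean of \<open>f + c\<close> over \<open>K\<close>, since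
    \<open>\<rho>\<close> gives \<open>K\<close> mass at most 1. With this choice the integral of
    \<open>c * (f + c) / a\<close> over \<open>K\<close> is at most
    \<open>c * k = m\<close>.\<close>
  define a where "a = (1 + m) / k"
  have k: "0 < k" using Kpos by (simp add: k_def)
  have m0: "0 \<le> m" by (simp add: m_def)
  have c0: "0 \<le> c" and a0: "0 < a" using k m0 by (auto simp: c_def a_def)
  have ek: "emeasure lborel K \<noteq> 0" "emeasure lborel K \<noteq> \<infinity>" using Kpos by (auto simp: measure_def)
  have ekk: "emeasure lborel K = ennreal k" using ek by (simp add: k_def emeasure_eq_ennreal_measure)
  interpret u: prob_space ?u using ek by (rule prob_space_uniform_measure)
  define g where "g x = indicator \<Omega> x * (f x * ln (f x)) - indicator B x * (f x * ln (f x))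
    + c * (indicator K x * f x / a) + c * (c / a + ln a) * indicator K x" for x
  have Bi: "integrable lborel (\<lambda>x. indicator B x * (f x * ln (f x)))"
  proof -
    have "(\<lambda>x. indicator B x * (f x * ln (f x))) = (\<lambda>x. indicator B x * (indicator \<Omega> x * (f x * ln (f x))))"
      using B\<Omega> by (auto simp: fun_eq_iff indicator_def)
    then show ?thesis using integrable_real_mult_indicator[OF _ fi, of B] by (simp add: mult.commute)
  qed
  have Kf: "integrable lborel (\<lambda>x. indicator K x * f x)" "(\<integral>x. indicator K x * f x \<partial>lborel) = measure \<rho> K"
  proof -
    have e: "(\<integral>\<^sup>+x. ennreal (indicator K x * f x) \<partial>lborel) = ennreal (measure \<rho> K)"
      unfolding emeasure_eq_measure[symmetric] unfolding \<rho>
      by (subst emeasure_density) (auto intro!: nn_integral_cong simp: indicator_def)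
    show "integrable lborel (\<lambda>x. indicator K x * f x)"
      using e f0 by (intro integrableI_nonneg) auto
    show "(\<integral>x. indicator K x * f x \<partial>lborel) = measure \<rho> K"
      using e f0 by (subst integral_eq_nn_integral) auto
  qed
  have Ki: "integrable lborel (indicator K :: 'a \<Rightarrow> real)"
    using ek by (simp add: integrable_indicator_iff less_top)
  have gi: "integrable lborel g"
    unfolding g_def using fi Bi Kf(1) Ki by auto
  have "integral\<^sup>L lborel g = (\<integral>x. indicator \<Omega> x * (f x * ln (f x)) \<partial>lborel) - (\<integral>x. indicator B x * (f x * ln (f x)) \<partial>lborel)
      + c * (measure \<rho> K / a) + c * (c / a + ln a) * k"
    unfolding g_def using fi Bi Kf Ki by (simp add: k_def)
  moreover have "c * (measure \<rho> K / a) + c * (c / a + ln a) * k \<le> m * (1 + ln a)"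
  proof -
    have ck: "c * k = m" using k by (simp add: c_def)
    have "c * (measure \<rho> K / a) + c * (c / a + ln a) * k = c * ((measure \<rho> K + c * k) / a) + (c * k) * ln a"
      by (simp add: algebra_simps add_divide_distrib)
    also have "\<dots> \<le> c * ((1 + m) / a) + m * ln a"
      unfolding ck using a0 c0 m0 by (intro add_mono mult_left_mono divide_right_mono) auto
    also have "(1 + m) / a = k" using m0 k by (simp add: a_def)
    finally show ?thesis by (simp add: ck algebra_simps)
  qed
  ultimately have g_le: "integral\<^sup>L lborel g \<le> (\<integral>x. indicator \<Omega> x * (f x * ln (f x)) \<partial>lborel)
      - (\<integral>x. indicator B x * (f x * ln (f x)) \<partial>lborel) + m * (1 + ln a)" by linarith
  have dens: "resample \<rho> B ?u = density lborel (\<lambda>x. ennreal (f x * indicator (- B) x + c * indicator K x))"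
    unfolding c_def m_def k_def by (rule resample_density[OF f f0 \<rho> p K Kpos B])
  have "Ent \<Omega> (resample \<rho> B ?u) \<le> ereal (integral\<^sup>L lborel g)"
  proof (rule Ent_le[OF _ _ dens \<Omega> _ gi])
    show "0 \<le> f x * indicator (- B) x + c * indicator K x" for x using f0 c0 by simp
    show "emeasure (resample \<rho> B ?u) \<Omega> = 1"
    proof -
      have u1: "emeasure ?u \<Omega> = 1"
        using K\<Omega> k by (simp add: Int_absorb2 ekk divide_ennreal)
      have "AE x in \<rho>. x \<in> \<Omega>" using one by (intro AE_prob_1) (simp add: emeasure_eq_measure)
      have "emeasure (resample \<rho> B ?u) \<Omega> = (\<integral>\<^sup>+x. indicator \<Omega> x \<partial>resample \<rho> B ?u)" by (simp add: resample_def)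
      also have "\<dots> = (\<integral>\<^sup>+x. (if x \<in> B then \<integral>\<^sup>+x'. indicator \<Omega> x' \<partial>?u else indicator \<Omega> x) \<partial>\<rho>)"
        by (rule nn_integral_resample) (auto simp: \<rho> u.prob_space_axioms)
      also have "(\<integral>\<^sup>+x'. indicator \<Omega> x' \<partial>?u) = 1" using u1 by (subst nn_integral_indicator) auto
      also have "(\<integral>\<^sup>+x. (if x \<in> B then 1 else indicator \<Omega> x) \<partial>\<rho>) = (\<integral>\<^sup>+x. 1 \<partial>\<rho>)"
        by (rule nn_integral_cong_AE) (use \<open>AE x in \<rho>. x \<in> \<Omega>\<close> in \<open>eventually_elim; simp\<close>)
      finally show ?thesis by (simp add: emeasure_space_1)
    qed
    fix x assume x: "x \<in> \<Omega>"
    show "(f x * indicator (- B) x + c * indicator K x) * ln (f x * indicator (- B) x + c * indicator K x) \<le> g x"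
    proof (cases "x \<in> B")
      case True
      then have "x \<notin> K" using BK by auto
      then show ?thesis using True x by (simp add: g_def)
    next
      case False
      then show ?thesis
        using xlnx_add_le[OF f0[of x] c0 a0] x by (cases "x \<in> K") (auto simp: g_def algebra_simps add_divide_distrib)
    qed
  next
    fix x assume "x \<notin> \<Omega>"
    then show "g x = 0" using B\<Omega> K\<Omega> by (auto simp: g_def indicator_def)
  qed measurable
  then show ?thesis using g_le by (auto simp: m_def a_def k_def intro: order_trans)
qed

text \<open>The factor 8 leaves room for moving all the mass of a set at once, so that no limit of small
  perturbations is needed: it suffices that \<open>1 + ln 2 < ln 8\<close>.\<close>

lemma barycenter_density_le:
  fixes \<Omega> :: "'a::euclidean_space set" and \<rho> :: "'a measure" and P :: "'a measure measure"
  assumes \<Omega>: "open \<Omega>" and l: "0 < l" and P: "prob_space P" "sets P = sets P2_borel"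
    and m2: "(\<integral>\<^sup>+\<nu>. moment 2 \<nu> \<partial>P) < \<infinity>" and bar: "is_entropic_barycenter l \<Omega> P \<rho>"
    and r: "0 < r" and Kpos: "0 < measure lborel (\<Omega> \<inter> ball 0 r)"
  obtains f s where "f \<in> borel_measurable borel" "\<And>x. 0 \<le> f x" "\<rho> = density lborel (\<lambda>x. ennreal (f x))"
    "s \<in> borel_measurable borel" "\<And>x. 0 \<le> s x"
    "\<And>p. 1 \<le> p \<Longrightarrow> (\<integral>\<^sup>+x. ennreal (s x powr p) \<partial>\<rho>) \<le> (\<integral>\<^sup>+\<nu>. moment p \<nu> \<partial>P)"
    "AE x in \<rho>. 3 * (r + s x) < norm x \<longrightarrow>
       f x \<le> 8 / measure lborel (\<Omega> \<inter> ball 0 r) * exp (- (norm x)\<^sup>2 / (6 * l))"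
proof -
  define K where "K = \<Omega> \<inter> ball 0 r"
  define k where "k = measure lborel K"
  have k: "0 < k" using Kpos by (simp add: k_def K_def)
  have [measurable]: "\<Omega> \<in> sets borel" using \<Omega> by simp
  have K_m[measurable]: "K \<in> sets borel" unfolding K_def by simp
  have \<rho>: "\<rho> \<in> P2" and min: "\<And>\<rho>'. \<rho>' \<in> P2 \<Longrightarrow> bar_functional l \<Omega> P \<rho> \<le> bar_functional l \<Omega> P \<rho>'"
    using bar by (auto simp: is_entropic_barycenter_def)
  interpret prob_space \<rho> by (rule P2D[OF \<rho>])
  let ?u = "uniform_measure lborel K"
  note u = uniform_measure_in_P2[OF K_m, of r, folded k_def, OF k]
  have u: "?u \<in> P2" and u_cost: "\<And>y. (\<integral>\<^sup>+x. ennreal ((norm (x - y))\<^sup>2) \<partial>?u) \<le> ennreal ((r + norm y)\<^sup>2)"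
    using u by (auto simp: K_def)
  have ek: "emeasure lborel K \<noteq> 0" "emeasure lborel K \<noteq> \<infinity>" using k by (auto simp: measure_def k_def)
  \<comment> \<open>The uniform measure on \<open>K\<close> is a competitor with finite functional,
    so the entropy of the minimizer is finite and \<open>\<rho>\<close> has a density.\<close>
  have "Ent \<Omega> ?u \<le> ereal (\<integral>x. indicator K x * (1 / k * ln (1 / k)) \<partial>lborel)"
  proof (rule Ent_le)
    show "?u = density lborel (\<lambda>x. ennreal (indicator K x / k))"
      using uniform_measure_density[of K] k ek by (simp add: k_def less_top)
    show "emeasure ?u \<Omega> = 1"
    proof -
      have "K \<inter> \<Omega> = K" by (auto simp: K_def)
      moreover have "emeasure lborel K = ennreal k" using ek by (simp add: k_def emeasure_eq_ennreal_measure)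
      ultimately show ?thesis using k by (simp add: divide_ennreal)
    qed
    show "integrable lborel (\<lambda>x. indicator K x * (1 / k * ln (1 / k)))"
      using ek by (intro integrable_mult_left) (simp add: integrable_indicator_iff less_top)
  qed (use k in \<open>auto simp: K_def indicator_def\<close>)
  then have Eu: "Ent \<Omega> ?u < \<infinity>" by (auto intro: le_less_trans)
  obtain b where b: "0 \<le> b" "(\<integral>\<^sup>+\<nu>. W2_sq ?u \<nu> \<partial>P) = ennreal b"
    using nn_integral_W2_sq_finite[OF u P m2] by (auto simp: less_top_ennreal)
  have "bar_functional l \<Omega> P ?u < \<infinity>"
    using Eu l b by (cases "Ent \<Omega> ?u") (auto simp: bar_functional_def enn2ereal_ennreal)
  then have "bar_functional l \<Omega> P \<rho> < \<infinity>" using min[OF u] by (rule le_less_trans[rotated])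
  then have Efin: "Ent \<Omega> \<rho> < \<infinity>"
    using l by (cases "Ent \<Omega> \<rho>") (auto simp: bar_functional_def)
  have [measurable_cong]: "sets \<rho> = sets borel" by (rule P2D[OF \<rho>])
  obtain f where f[measurable]: "f \<in> borel_measurable borel" and f0: "\<And>x. 0 \<le> f x"
    and \<rho>f: "\<rho> = density lborel (\<lambda>x. ennreal (f x))" and one: "emeasure \<rho> \<Omega> = 1"
    and fi: "integrable lborel (\<lambda>x. indicator \<Omega> x * (f x * ln (f x)))"
    and E: "Ent \<Omega> \<rho> = ereal (\<integral>x. indicator \<Omega> x * (f x * ln (f x)) \<partial>lborel)"
    by (rule Ent_finiteD[OF \<rho> Efin borel_open[OF \<Omega>]]) (rule that; assumption)
  obtain s where s[measurable]: "s \<in> borel_measurable borel" and s0: "\<And>x. 0 \<le> s x"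
    and s_p: "\<And>p. 1 \<le> p \<Longrightarrow> (\<integral>\<^sup>+x. ennreal (s x powr p) \<partial>\<rho>) \<le> (\<integral>\<^sup>+\<nu>. moment p \<nu> \<partial>P)"
    and s_W: "\<And>B R r u. B \<in> sets borel \<Longrightarrow> B \<subseteq> ball 0 R \<Longrightarrow> u \<in> P2 \<Longrightarrow> 0 \<le> r \<Longrightarrow>
       (\<And>y. (\<integral>\<^sup>+x. ennreal ((norm (x - y))\<^sup>2) \<partial>u) \<le> ennreal ((r + norm y)\<^sup>2)) \<Longrightarrow>
       enn2real (\<integral>\<^sup>+\<nu>. W2_sq (resample \<rho> B u) \<nu> \<partial>P) \<le> enn2real (\<integral>\<^sup>+\<nu>. W2_sq \<rho> \<nu> \<partial>P) +
         (\<integral>x. indicator B x * (r\<^sup>2 - (norm x)\<^sup>2) \<partial>\<rho>) + (\<integral>x. 2 * indicator B x * (norm x + r) * s x \<partial>\<rho>)"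
    using exists_averaged_coupling_norm[OF \<rho> P m2] by blast
  have s_int: "integrable \<rho> s"
  proof (rule integrableI_nonneg)
    have "ennreal (s x) \<le> ennreal 1 + ennreal (s x powr 2)" for x
    proof -
      have "2 * s x \<le> 1 + s x powr 2" using s0[of x] sum_squares_bound[of 1 "s x"] by simp
      then have "s x \<le> 1 + s x powr 2" using s0[of x] by linarith
      then have "ennreal (s x) \<le> ennreal (1 + s x powr 2)" by (rule ennreal_leI)
      also have "\<dots> = ennreal 1 + ennreal (s x powr 2)" by (rule ennreal_plus) auto
      finally show ?thesis .
    qed
    then have "(\<integral>\<^sup>+x. ennreal (s x) \<partial>\<rho>) \<le> (\<integral>\<^sup>+x. ennreal 1 + ennreal (s x powr 2) \<partial>\<rho>)" by (intro nn_integral_mono)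
    also have "\<dots> = 1 + (\<integral>\<^sup>+x. ennreal (s x powr 2) \<partial>\<rho>)"
      by (simp add: nn_integral_add emeasure_space_1)
    also have "\<dots> < \<infinity>" using s_p[of 2] m2 by (auto intro: le_less_trans)
    finally show "(\<integral>\<^sup>+x. ennreal (s x) \<partial>\<rho>) < \<infinity>" .
  qed (auto simp: s0 \<rho>f)
  \<comment> \<open>Cutting off at radius \<open>R\<close> makes all integrals over the set finite
    and puts it in the range of the cost estimate. Its points satisfy \<open>norm x > 3 * r\<close>,
    so it misses \<open>K\<close>.\<close>
  define bad where "bad R = {x \<in> \<Omega> \<inter> ball 0 R. 3 * (r + s x) < norm x \<and> 8 / k * exp (- (norm x)\<^sup>2 / (6 * l)) < f x}" for R
  have bad_m[measurable]: "bad R \<in> sets borel" for R unfolding bad_def by measurable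
  have bad0: "measure \<rho> (bad R) = 0" for R
  proof (rule ccontr)
    let ?B = "bad R"
    define m where "m = measure \<rho> ?B"
    assume "measure \<rho> ?B \<noteq> 0"
    then have m: "0 < m" "m \<le> 1" by (auto simp: m_def zero_less_measure_iff)
    let ?\<rho>' = "resample \<rho> ?B ?u"
    have \<rho>': "?\<rho>' \<in> P2" by (rule resample_in_P2[OF \<rho> u bad_m])
    have BR: "?B \<subseteq> ball 0 R" and B\<Omega>: "?B \<subseteq> \<Omega>" by (auto simp: bad_def)
    have BK: "?B \<inter> K = {}" 
    proof -
      have False if "x \<in> ?B" "x \<in> K" for x
        using that s0[of x] r by (auto simp: bad_def K_def)
      then show ?thesis by blast
    qed
    have nR: "norm x \<le> \<bar>R\<bar>" if "x \<in> ?B" for x using that by (auto simp: bad_def)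
    have Bint: "integrable \<rho> (\<lambda>x. indicator ?B x * h x)"
      if h: "h \<in> borel_measurable borel" "\<And>x. x \<in> ?B \<Longrightarrow> \<bar>h x\<bar> \<le> C" for h :: "'a \<Rightarrow> real" and C
      using that by (intro integrable_const_bound[of _ "\<bar>C\<bar>"]) (force simp: indicator_def \<rho>f)+
    have n2i: "integrable \<rho> (\<lambda>x. indicator ?B x * (norm x)\<^sup>2)"
      using nR power_mono[OF nR, of _ 2] by (intro Bint[of _ "R\<^sup>2"]) auto
    have c1: "integrable \<rho> (\<lambda>x. indicator ?B x * (r\<^sup>2 - (norm x)\<^sup>2))"
      using n2i Bint[of "\<lambda>_. r\<^sup>2" "r\<^sup>2"] by (simp add: right_diff_distrib)
    have c2: "integrable \<rho> (\<lambda>x. 2 * indicator ?B x * (norm x + r) * s x)"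
    proof (rule Bochner_Integration.integrable_bound[of _ "\<lambda>x. 2 * (\<bar>R\<bar> + r) * s x"])
      show "AE x in \<rho>. norm (2 * indicator ?B x * (norm x + r) * s x) \<le> norm (2 * (\<bar>R\<bar> + r) * s x)"
        using nR r s0 by (auto simp: indicator_def abs_mult intro!: AE_I2 mult_right_mono)
    qed (use s_int in \<open>auto simp: \<rho>f\<close>)
    \<comment> \<open>Inserting \<open>s x \<le> norm x / 3 - r\<close> gives
      \<open>- (norm x)\<^sup>2 / 3\<close> and two further nonpositive terms, which are
      dropped.\<close>
    have pt: "indicator ?B x * (r\<^sup>2 - (norm x)\<^sup>2) + 2 * indicator ?B x * (norm x + r) * s x
        \<le> - (1/3) * (indicator ?B x * (norm x)\<^sup>2)" for x
    proof (cases "x \<in> ?B")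
      case True
      then have "s x \<le> norm x / 3 - r" by (simp add: bad_def)
      then have "2 * (norm x + r) * s x \<le> 2 * (norm x + r) * (norm x / 3 - r)"
        using r by (intro mult_left_mono) auto
      moreover have "r\<^sup>2 - (norm x)\<^sup>2 + 2 * (norm x + r) * (norm x / 3 - r)
        = - (1/3) * (norm x)\<^sup>2 - (4/3) * (norm x * r) - r\<^sup>2"
        by (simp add: power2_eq_square algebra_simps)
      moreover have "0 \<le> norm x * r" using r by simp
      ultimately have "r\<^sup>2 - (norm x)\<^sup>2 + 2 * (norm x + r) * s x \<le> - (1/3) * (norm x)\<^sup>2"
        using zero_le_power2[of r] by linarith
      then show ?thesis using True by simp
    qed simp
    define Q where "Q = (\<integral>x. indicator ?B x * (norm x)\<^sup>2 \<partial>\<rho>)"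
    define H where "H = (\<integral>x. indicator ?B x * (f x * ln (f x)) \<partial>lborel)"
    have "(\<integral>x. indicator ?B x * (r\<^sup>2 - (norm x)\<^sup>2) \<partial>\<rho>) + (\<integral>x. 2 * indicator ?B x * (norm x + r) * s x \<partial>\<rho>)
      \<le> (\<integral>x. - (1/3) * (indicator ?B x * (norm x)\<^sup>2) \<partial>\<rho>)"
      unfolding Bochner_Integration.integral_add[OF c1 c2, symmetric]
      by (rule integral_mono[OF Bochner_Integration.integrable_add[OF c1 c2] _ pt]) (use n2i in simp)
    then have W: "enn2real (\<integral>\<^sup>+\<nu>. W2_sq ?\<rho>' \<nu> \<partial>P) \<le> enn2real (\<integral>\<^sup>+\<nu>. W2_sq \<rho> \<nu> \<partial>P) - Q / 3"
      using s_W[OF bad_m BR u less_imp_le[OF r] u_cost] by (simp add: Q_def)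
    have E': "Ent \<Omega> ?\<rho>' \<le> ereal ((\<integral>x. indicator \<Omega> x * (f x * ln (f x)) \<partial>lborel) - H + m * (1 + ln ((1 + m) / k)))"
      unfolding H_def m_def k_def
      by (rule resample_competitor[OF _ prob_space_axioms f f0 \<rho>f one fi K_m _ _ bad_m B\<Omega> BK])
        (use k in \<open>auto simp: K_def k_def\<close>)
    have "enn2real (\<integral>\<^sup>+\<nu>. W2_sq \<rho> \<nu> \<partial>P) / 2 + l * (\<integral>x. indicator \<Omega> x * (f x * ln (f x)) \<partial>lborel)
      \<le> enn2real (\<integral>\<^sup>+\<nu>. W2_sq ?\<rho>' \<nu> \<partial>P) / 2
        + l * ((\<integral>x. indicator \<Omega> x * (f x * ln (f x)) \<partial>lborel) - H + m * (1 + ln ((1 + m) / k)))"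
      by (rule bar_functional_leD[OF nn_integral_W2_sq_finite[OF \<rho> P m2] nn_integral_W2_sq_finite[OF \<rho>' P m2]
          l E E' min[OF \<rho>']])
    \<comment> \<open>\<open>Q / 6\<close> is half of the cost gain \<open>Q / 3\<close>, by the
      factor 1/2 in the functional.\<close>
    then have first: "l * H \<le> - Q / 6 + l * m * (1 + ln ((1 + m) / k))" using W by (simp add: algebra_simps)
    \<comment> \<open>On the bad set \<open>ln (f x)\<close> is at least the logarithm of the
      Gaussian bound. The exponent was chosen so that the \<open>Q\<close> terms cancel against
      those of \<open>first\<close>; then \<open>l * m\<close> divides out and
      \<open>ln 8 \<le> 1 + ln (1 + m)\<close> remains, impossible for
      \<open>m \<le> 1\<close>.\<close>
    have "m * ln (8 / k) - Q / (6 * l) \<le> H"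
    proof -
      have e: "(\<integral>x. indicator ?B x * (ln (8 / k) - (norm x)\<^sup>2 / (6 * l)) \<partial>\<rho>) = m * ln (8 / k) - Q / (6 * l)"
      proof -
        have "(\<lambda>x. indicator ?B x * (ln (8 / k) - (norm x)\<^sup>2 / (6 * l)))
          = (\<lambda>x. ln (8 / k) * indicator ?B x - (indicator ?B x * (norm x)\<^sup>2) / (6 * l))"
          by (auto simp: fun_eq_iff indicator_def)
        moreover have "integrable \<rho> (indicator ?B :: 'a \<Rightarrow> real)"
          using Bint[of "\<lambda>_. 1" 1] by simp
        ultimately show ?thesis using n2i by (simp add: Q_def m_def mult.commute \<rho>f)
      qed
      have li: "integrable \<rho> (\<lambda>x. indicator ?B x * (ln (8 / k) - (norm x)\<^sup>2 / (6 * l)))"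
      proof (rule Bint[of _ "\<bar>ln (8 / k)\<bar> + R\<^sup>2 / (6 * l)"])
        fix x assume "x \<in> ?B"
        then have "(norm x)\<^sup>2 / (6 * l) \<le> R\<^sup>2 / (6 * l)"
          using power_mono[OF nR, of x 2] l by (intro divide_right_mono) auto
        moreover have "0 \<le> (norm x)\<^sup>2 / (6 * l)" using l by simp
        ultimately show "\<bar>ln (8 / k) - (norm x)\<^sup>2 / (6 * l)\<bar> \<le> \<bar>ln (8 / k)\<bar> + R\<^sup>2 / (6 * l)" by linarith
      qed simp
      have meas: "(\<lambda>x. indicator ?B x * (ln (8 / k) - (norm x)\<^sup>2 / (6 * l))) \<in> borel_measurable lborel" by measurable
      have "m * ln (8 / k) - Q / (6 * l) = (\<integral>x. f x * (indicator ?B x * (ln (8 / k) - (norm x)\<^sup>2 / (6 * l))) \<partial>lborel)"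
        unfolding e[symmetric] unfolding \<rho>f using f0
        by (subst integral_real_density) (auto simp: f)
      also have "\<dots> \<le> H"
        unfolding H_def
      proof (rule integral_mono)
        show "integrable lborel (\<lambda>x. f x * (indicator ?B x * (ln (8 / k) - (norm x)\<^sup>2 / (6 * l))))"
          using li f0 unfolding \<rho>f by (subst (asm) integrable_real_density) (auto simp: f)
        have "(\<lambda>x. indicator ?B x * (f x * ln (f x))) = (\<lambda>x. indicator ?B x * (indicator \<Omega> x * (f x * ln (f x))))"
          using B\<Omega> by (auto simp: fun_eq_iff indicator_def)
        then show "integrable lborel (\<lambda>x. indicator ?B x * (f x * ln (f x)))"
          using integrable_real_mult_indicator[OF _ fi, of ?B] by (simp add: mult.commute)
        fix x :: 'a
        show "f x * (indicator ?B x * (ln (8 / k) - (norm x)\<^sup>2 / (6 * l))) \<le> indicator ?B x * (f x * ln (f x))"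
        proof (cases "x \<in> ?B")
          case True
          then have "ln (8 / k * exp (- (norm x)\<^sup>2 / (6 * l))) \<le> ln (f x)"
            using k by (intro ln_mono) (auto simp: bad_def)
          also have "ln (8 / k * exp (- (norm x)\<^sup>2 / (6 * l))) = ln (8 / k) - (norm x)\<^sup>2 / (6 * l)"
            using k by (subst ln_mult) auto
          finally show ?thesis using True f0 by (simp add: mult_left_mono)
        qed simp
      qed
      finally show ?thesis .
    qed
    then have "l * (m * ln (8 / k) - Q / (6 * l)) \<le> l * H" using l by (intro mult_left_mono) auto
    then have "l * m * ln (8 / k) \<le> l * m * (1 + ln ((1 + m) / k))"
      using first l by (simp add: algebra_simps)
    then have "ln (8 / k) \<le> 1 + ln ((1 + m) / k)" using l m by simp
    then have "ln 8 \<le> 1 + ln (1 + m)" using k m by (simp add: ln_div)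
    also have "ln (1 + m) \<le> ln 2" using m by simp
    finally have "ln 8 - ln 2 \<le> (1 :: real)" by simp
    then have "ln (4 :: real) \<le> 1" using ln_div[of 8 "2::real"] by simp
    then have "exp (ln (4 :: real)) \<le> exp 1" by (simp only: exp_le_cancel_iff)
    then show False using exp_le by simp
  qed
  have "AE x in \<rho>. \<forall>n::nat. x \<notin> bad (real n)"
    unfolding AE_all_countable
  proof
    fix n :: nat
    have "bad (real n) \<in> null_sets \<rho>"
    proof (rule null_setsI)
      show "emeasure \<rho> (bad (real n)) = 0" using bad0[of "real n"] by (simp add: emeasure_eq_measure)
    qed measurable
    then show "AE x in \<rho>. x \<notin> bad (real n)" by (rule AE_not_in)
  qed
  moreover have "AE x in \<rho>. x \<in> \<Omega>" using one by (intro AE_prob_1) (simp add: emeasure_eq_measure)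
  ultimately have "AE x in \<rho>. 3 * (r + s x) < norm x \<longrightarrow> f x \<le> 8 / k * exp (- (norm x)\<^sup>2 / (6 * l))"
  proof eventually_elim
    case (elim x)
    obtain n :: nat where n: "norm x < real n" using reals_Archimedean2 by blast
    have "x \<notin> bad (real n)" using elim(1) by blast
    then show ?case using n elim(2) unfolding bad_def by (auto simp: not_less)
  qed
  then show thesis using that[OF f f0 \<rho>f s s0 s_p] by (simp add: k_def K_def)
qed

lemma one_le_half_DIM_plus:
  fixes p :: real
  assumes p: "1 \<le> p"
  shows "1 \<le> (real DIM('a::euclidean_space) + p) / 2"
proof -
  have "real 1 \<le> real DIM('a)" by (rule of_nat_mono) simp
  then have "real 1 + 1 \<le> real DIM('a) + p" using p by (rule add_mono)
  then show ?thesis by simp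
qed

lemma barycenter_moment_le:
  fixes \<Omega> :: "'a::euclidean_space set" and \<rho> :: "'a measure" and P :: "'a measure measure"
  assumes \<Omega>: "open \<Omega>" and l: "0 < l" and P: "prob_space P" "sets P = sets P2_borel"
    and m2: "(\<integral>\<^sup>+\<nu>. moment 2 \<nu> \<partial>P) < \<infinity>" and p: "1 \<le> p" and bar: "is_entropic_barycenter l \<Omega> P \<rho>"
    and r: "0 < r" and Kpos: "0 < measure lborel (\<Omega> \<inter> ball 0 r)"
  shows "moment p \<rho> \<le> ennreal (6 powr p / 2) * (ennreal (r powr p) + (\<integral>\<^sup>+\<nu>. moment p \<nu> \<partial>P))
    + ennreal (measure lborel (ball (0::'a) 1) * Gamma ((real DIM('a) + p) / 2)
        / (2 * measure lborel (\<Omega> \<inter> ball 0 r)) * (96 * l) powr ((real DIM('a) + p) / 2))"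
proof -
  define k where "k = measure lborel (\<Omega> \<inter> ball 0 r)"
  have k: "0 < k" using Kpos by (simp add: k_def)
  define z where "z = (real DIM('a) + p) / 2"
  have z: "1 \<le> z" unfolding z_def by (rule one_le_half_DIM_plus[OF p])
  define V where "V = measure lborel (ball (0::'a) 1)"
  have V: "emeasure lborel (ball (0::'a) 1) = ennreal V"
    using emeasure_ball[of 1 "0::'a"] content_ball[of 1 "0::'a"] by (simp add: V_def)
  have V0: "0 \<le> V" by (simp add: V_def)
  obtain f s where f[measurable]: "f \<in> borel_measurable borel" and f0: "\<And>x. 0 \<le> f x"
    and \<rho>f: "\<rho> = density lborel (\<lambda>x. ennreal (f x))"
    and s[measurable]: "s \<in> borel_measurable borel" and s0: "\<And>x. 0 \<le> s x"
    and s_p: "\<And>p. 1 \<le> p \<Longrightarrow> (\<integral>\<^sup>+x. ennreal (s x powr p) \<partial>\<rho>) \<le> (\<integral>\<^sup>+\<nu>. moment p \<nu> \<partial>P)"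
    and good: "AE x in \<rho>. 3 * (r + s x) < norm x \<longrightarrow> f x \<le> 8 / k * exp (- (norm x)\<^sup>2 / (6 * l))"
    by (rule barycenter_density_le[OF \<Omega> l P m2 bar r Kpos, folded k_def]) (rule that; assumption)
  interpret prob_space \<rho> using bar P2D(1) by (auto simp: is_entropic_barycenter_def)
  have [measurable_cong]: "sets \<rho> = sets borel" by (simp add: \<rho>f)
  \<comment> \<open>Almost every point with \<open>3 * (r + s x) < norm x\<close> lies in
    \<open>D\<close>, and \<open>D\<close> no longer involves \<open>s\<close>, so the remaining
    integral is a Gaussian moment.\<close>
  define D where "D = {x. f x \<le> 8 / k * exp (- (norm x)\<^sup>2 / (6 * l))}"
  have D[measurable]: "D \<in> sets borel" unfolding D_def by measurable
  have "moment p \<rho> \<le> (\<integral>\<^sup>+x. ennreal (6 powr p / 2) * (ennreal (r powr p) + ennreal (s x powr p))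
      + ennreal (norm x powr p) * indicator D x \<partial>\<rho>)"
    unfolding moment_def
  proof (rule nn_integral_mono_AE, use good in eventually_elim)
    case (elim x)
    show ?case
    proof (cases "3 * (r + s x) < norm x")
      case True
      then have "x \<in> D" using elim by (simp add: D_def)
      then show ?thesis by (simp add: le_add_same_cancel2)
    next
      case False
      then have "norm x powr p \<le> (3 * (r + s x)) powr p" using p by (intro powr_mono2) auto
      also have "\<dots> \<le> 6 powr p / 2 * (r powr p + s x powr p)" using p r s0 by (intro powr_sum_le) auto
      finally have "ennreal (norm x powr p) \<le> ennreal (6 powr p / 2) * (ennreal (r powr p) + ennreal (s x powr p))"
        by (simp add: ennreal_mult[symmetric] ennreal_plus[symmetric] ennreal_leI del: ennreal_plus)
      then show ?thesis by (rule order_trans) simp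
    qed
  qed
  also have "\<dots> = ennreal (6 powr p / 2) * (ennreal (r powr p) + (\<integral>\<^sup>+x. ennreal (s x powr p) \<partial>\<rho>))
      + (\<integral>\<^sup>+x. ennreal (norm x powr p) * indicator D x \<partial>\<rho>)"
    by (simp add: nn_integral_add nn_integral_cmult emeasure_space_1)
  also have "\<dots> \<le> ennreal (6 powr p / 2) * (ennreal (r powr p) + (\<integral>\<^sup>+\<nu>. moment p \<nu> \<partial>P))
      + ennreal (V * Gamma z / (2 * k) * (96 * l) powr z)"
  proof (intro add_mono mult_left_mono order_refl s_p p)
    have "(\<integral>\<^sup>+x. ennreal (norm x powr p) * indicator D x \<partial>\<rho>)
      = (\<integral>\<^sup>+x. ennreal (f x) * (ennreal (norm x powr p) * indicator D x) \<partial>lborel)"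
      unfolding \<rho>f by (rule nn_integral_density) measurable
    also have "\<dots> \<le> (\<integral>\<^sup>+x. ennreal (8 / k) * ennreal (norm (x::'a) powr p * exp (- (norm x)\<^sup>2 / (6 * l))) \<partial>lborel)"
    proof (rule nn_integral_mono)
      fix x :: 'a
      show "ennreal (f x) * (ennreal (norm x powr p) * indicator D x)
        \<le> ennreal (8 / k) * ennreal (norm x powr p * exp (- (norm x)\<^sup>2 / (6 * l)))"
      proof (cases "x \<in> D")
        case True
        then have "f x * norm x powr p \<le> (8 / k * exp (- (norm x)\<^sup>2 / (6 * l))) * norm x powr p"
          by (intro mult_right_mono) (auto simp: D_def)
        then show ?thesis using True k f0 by (simp add: ennreal_mult[symmetric] ennreal_leI mult_ac)
      qed simp
    qed
    also have "\<dots> = ennreal (8 / k) * (\<integral>\<^sup>+x. ennreal (norm (x::'a) powr p * exp (- (norm x)\<^sup>2 / (6 * l))) \<partial>lborel)"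
      by (rule nn_integral_cmult) measurable
    also have "\<dots> \<le> ennreal (8 / k) * (ennreal V * ennreal ((6 * l) powr z * Gamma (z + 1)))"
      using nn_integral_norm_powr_gauss_le[of "6 * l" p, where 'a='a] l p V
      by (intro mult_left_mono) (auto simp: z_def)
    also have "\<dots> = ennreal (8 / k * (V * ((6 * l) powr z * Gamma (z + 1))))"
      using k V0 z by (simp add: ennreal_mult[symmetric] Gamma_real_nonneg)
    also have "\<dots> \<le> ennreal (V * Gamma z / (2 * k) * (96 * l) powr z)"
    proof (rule ennreal_leI)
      \<comment> \<open>\<open>8 * Gamma (z + 1)\<close> is \<open>16 * z * Gamma z / 2\<close>, and
        \<open>16 powr z\<close> merges with \<open>(6 * l) powr z\<close>.\<close>
      have "Gamma (z + 1) = z * Gamma z" using z by (intro Gamma_plus1) (auto elim!: nonpos_Ints_cases)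
      moreover have "(96 * l) powr z = 16 powr z * (6 * l) powr z"
        using l powr_mult[of 16 "6 * l" z] by simp
      moreover have "V * Gamma z * (6 * l) powr z / (2 * k) * (16 * z) \<le> V * Gamma z * (6 * l) powr z / (2 * k) * 16 powr z"
        using sixteen_times_le_16_powr[OF z] V0 z k
        by (intro mult_left_mono divide_nonneg_nonneg mult_nonneg_nonneg) (auto simp: Gamma_real_nonneg)
      ultimately show "8 / k * (V * ((6 * l) powr z * Gamma (z + 1))) \<le> V * Gamma z / (2 * k) * (96 * l) powr z"
        by (simp add: mult_ac)
    qed
    finally show "(\<integral>\<^sup>+x. ennreal (norm x powr p) * indicator D x \<partial>\<rho>) \<le> ennreal (V * Gamma z / (2 * k) * (96 * l) powr z)" .
  qed simp
  finally show ?thesis by (simp add: V_def z_def k_def)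
qed

theorem proposition4p2:
  fixes \<Omega> :: "'a::euclidean_space set"
    and P :: "'a measure measure"
    and \<rho> :: "'a measure"
    and l p :: real
  assumes "\<Omega> \<noteq> {}" and "open \<Omega>" and "connected \<Omega>" and "negligible (frontier \<Omega>)"
    and "l > 0"
    and "prob_space P" and "sets P = sets P2_borel"
    and "(\<integral>\<^sup>+ \<nu>. moment 2 \<nu> \<partial>P) < \<infinity>"
    and "p \<ge> 1"
    and "(\<integral>\<^sup>+ \<nu>. moment p \<nu> \<partial>P) < \<infinity>"
    and "is_entropic_barycenter l \<Omega> P \<rho>"
  shows "moment p \<rho> < \<infinity> \<and>
    (\<forall>r>0. moment p \<rho> \<le>
        ennreal (6 powr p / 2) * (ennreal (r powr p) + (\<integral>\<^sup>+ \<nu>. moment p \<nu> \<partial>P))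
        + emeasure lborel (ball (0::'a) 1) * ennreal (Gamma ((real DIM('a) + p) / 2))
            / (2 * emeasure lborel (\<Omega> \<inter> ball 0 r))
          * ennreal ((96 * l) powr ((real DIM('a) + p) / 2))) \<and>
    (\<Omega> = UNIV \<longrightarrow> moment p \<rho> \<le>
        ennreal (6 powr p / 2) * (\<integral>\<^sup>+ \<nu>. moment p \<nu> \<partial>P)
        + ennreal ((3456 * l) powr (p / 2) * Gamma ((real DIM('a) + p) / 2)))"
proof -
  define d where "d = real DIM('a)"
  define z where "z = (d + p) / 2"
  define k where "k r = measure lborel (\<Omega> \<inter> ball 0 r)" for r
  define V where "V = measure lborel (ball (0::'a) 1)"
  define Mp where "Mp = (\<integral>\<^sup>+ \<nu>. moment p \<nu> \<partial>P)"
  have z: "1 \<le> z" unfolding z_def d_def by (rule one_le_half_DIM_plus[OF assms(9)])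
  have G: "3 / 4 \<le> Gamma z" by (rule Gamma_real_ge[OF z])
  have V: "emeasure lborel (ball (0::'a) 1) = ennreal V" "0 < V"
    using emeasure_ball[of 1 "0::'a"] content_ball[of 1 "0::'a"] by (auto simp: V_def)
  have ek: "emeasure lborel (\<Omega> \<inter> ball 0 r) = ennreal (k r)" for r
  proof -
    have "emeasure lborel (\<Omega> \<inter> ball 0 r) \<le> emeasure lborel (ball (0::'a) \<bar>r\<bar>)"
      by (rule emeasure_mono) auto
    also have "\<dots> < \<infinity>" using emeasure_ball[of "\<bar>r\<bar>" "0::'a"] by simp
    finally show ?thesis by (simp add: k_def emeasure_eq_ennreal_measure)
  qed
  have le: "moment p \<rho> \<le> ennreal (6 powr p / 2) * (ennreal (r powr p) + Mp)
      + ennreal (V * Gamma z / (2 * k r) * (96 * l) powr z)" if "0 < r" "0 < k r" for r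
    using barycenter_moment_le[OF assms(2,5,6,7,8,9,11) that(1)] that(2)
    by (simp add: Mp_def V_def z_def k_def d_def)
  have Mp: "Mp < \<infinity>" using assms(10) by (simp add: Mp_def)
  have first: "moment p \<rho> < \<infinity>"
  proof -
    \<comment> \<open>Finiteness takes one radius of positive volume: a ball around any point of
      \<open>\<Omega>\<close> fits into \<open>\<Omega>\<close> and a larger ball about the
      origin.\<close>
    obtain x where x: "x \<in> \<Omega>" using assms(1) by auto
    have "open (\<Omega> \<inter> ball 0 (norm x + 1))" using assms(2) by auto
    moreover have "x \<in> \<Omega> \<inter> ball 0 (norm x + 1)" using x by simp
    ultimately obtain e where e: "0 < e" "ball x e \<subseteq> \<Omega> \<inter> ball 0 (norm x + 1)" by (rule openE)
    have "0 < emeasure lborel (ball x e)" using e(1) emeasure_ball[of e x] by simp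
    also have "\<dots> \<le> ennreal (k (norm x + 1))" unfolding ek[symmetric] using assms(2) by (intro emeasure_mono e) auto
    finally have "0 < k (norm x + 1)" by simp
    then have "moment p \<rho> \<le> ennreal (6 powr p / 2) * (ennreal ((norm x + 1) powr p) + Mp)
      + ennreal (V * Gamma z / (2 * k (norm x + 1)) * (96 * l) powr z)"
      by (intro le) (auto intro: add_nonneg_pos)
    also have "\<dots> < \<infinity>" using Mp by (simp add: ennreal_mult_less_top)
    finally show ?thesis .
  qed
  have second: "moment p \<rho> \<le> ennreal (6 powr p / 2) * (ennreal (r powr p) + Mp)
      + ennreal V * ennreal (Gamma z) / (2 * ennreal (k r)) * ennreal ((96 * l) powr z)" if r: "0 < r" for r
  proof (cases "0 < k r")
    case True
    have "ennreal V * ennreal (Gamma z) / (2 * ennreal (k r)) * ennreal ((96 * l) powr z)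
      = ennreal (V * Gamma z / (2 * k r) * (96 * l) powr z)"
    proof -
      have "2 * ennreal (k r) = ennreal (2 * k r)" using True by (simp add: ennreal_mult)
      then show ?thesis using True V(2) G
        by (simp add: ennreal_mult[symmetric] divide_ennreal)
    qed
    then show ?thesis using le[OF r True] by simp
  next
    case False
    \<comment> \<open>Division by 0 in \<open>ennreal\<close> gives infinity only for a nonzero
      numerator, and infinity times 0 is 0; hence both factors are checked to be nonzero before the
      right side is seen to be infinite.\<close>
    then have "ennreal (k r) = 0" by (simp add: ennreal_neg)
    moreover have "ennreal V * ennreal (Gamma z) \<noteq> 0" using V(2) G by (simp add: ennreal_eq_0_iff)
    moreover have "ennreal ((96 * l) powr z) \<noteq> 0" using assms(5) by (simp add: ennreal_eq_0_iff)
    ultimately show ?thesis by (simp add: ennreal_divide_zero ennreal_top_mult)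
  qed
  have third: "moment p \<rho> \<le> ennreal (6 powr p / 2) * Mp + ennreal ((3456 * l) powr (p / 2) * Gamma z)"
    if univ: "\<Omega> = UNIV"
  proof -
    \<comment> \<open>With this radius the volume of the ball is
      \<open>V * (96 * l) powr (d / 2)\<close>, which cancels against the second term, while
      \<open>r powr p\<close> becomes \<open>(96 * l) powr (p / 2)\<close>, the power that remains
      there.\<close>
    define r where "r = sqrt (96 * l)"
    have r: "0 < r" using assms(5) by (simp add: r_def)
    have rpow: "r powr a = (96 * l) powr (a / 2)" for a
      using assms(5) by (simp add: r_def powr_half_sqrt[symmetric] powr_powr)
    have kr: "k r = V * (96 * l) powr (d / 2)"
      using content_ball[of r "0::'a"] content_ball[of 1 "0::'a"] r
      by (simp add: k_def univ V_def rpow[symmetric] d_def powr_realpow)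
    have kpos: "0 < k r" using V(2) assms(5) by (simp add: kr)
    have lz: "(96 * l) powr z = (96 * l) powr (d / 2) * (96 * l) powr (p / 2)"
      by (simp add: z_def powr_add[symmetric] add_divide_distrib)
    have s6: "(3456 * l) powr (p / 2) = 6 powr p * (96 * l) powr (p / 2)"
    proof -
      have "(3456 * l) powr (p / 2) = (6 powr 2 * (96 * l)) powr (p / 2)" by simp
      also have "\<dots> = (6 powr 2) powr (p / 2) * (96 * l) powr (p / 2)"
        using assms(5) by (intro powr_mult)
      finally show ?thesis by (simp only: powr_powr) simp
    qed
    have six: "6 \<le> (6 :: real) powr p" using powr_mono[OF assms(9), of 6] by simp
    have e: "V * Gamma z / (2 * k r) * (96 * l) powr z = Gamma z / 2 * (96 * l) powr (p / 2)"
      using V(2) assms(5) by (simp add: kr lz)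
    have "moment p \<rho> \<le> ennreal (6 powr p / 2) * (ennreal ((96 * l) powr (p / 2)) + Mp)
      + ennreal (Gamma z / 2 * (96 * l) powr (p / 2))"
      using le[OF r kpos] unfolding e rpow .
    also have "\<dots> = ennreal (6 powr p / 2) * Mp + ennreal ((6 powr p / 2 + Gamma z / 2) * (96 * l) powr (p / 2))"
      using G by (simp add: distrib_left distrib_right ennreal_mult[symmetric] ennreal_plus add_ac)
    also have "\<dots> \<le> ennreal (6 powr p / 2) * Mp + ennreal ((3456 * l) powr (p / 2) * Gamma z)"
    proof (intro add_mono order_refl ennreal_leI)
      have "6 powr p / 2 + Gamma z / 2 \<le> 6 powr p * Gamma z"
      proof -
        \<comment> \<open>Expanding the product gives
          \<open>6 powr p * Gamma z \<ge> 3/4 * 6 powr p + 6 * Gamma z - 9/2\<close>, and the lower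
          bounds 6 and 3/4 make this exceed half the sum.\<close>
        have "0 \<le> (6 powr p - 6) * (Gamma z - 3 / 4)" using six G by simp
        then show ?thesis using six G by (simp add: algebra_simps)
      qed
      then have "(6 powr p / 2 + Gamma z / 2) * (96 * l) powr (p / 2) \<le> (6 powr p * Gamma z) * (96 * l) powr (p / 2)"
        by (intro mult_right_mono) auto
      then show "(6 powr p / 2 + Gamma z / 2) * (96 * l) powr (p / 2) \<le> (3456 * l) powr (p / 2) * Gamma z"
        unfolding s6 by (simp only: mult_ac)
    qed
    finally show ?thesis .
  qed
  show ?thesis
    using first second third unfolding Mp_def V(1) ek z_def d_def by blast
qed

end
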